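(* Let $X,X_1,X_2,\ldots$ be identically distributed real-valued random variables with common distribution $F\in\mathcal{D}\cap\mathcal{L}$, and let $\Theta,\Theta_1,\Theta_2,\ldots$ be non-negative, identically distributed random variables, non-degenerate at zero, such that all the products $\Theta_iX_i$ have the same distribution as $\Theta X$. Let $N$ be a random variable with values in $\{0,1,2,\ldots\}$, non-degenerate at zero, with $\mathbf{P}[N>r_N]=0$ for some integer $r_N\ge2$, and independent of the sequences $(X_i)$ and $(\Theta_i)$ (jointly). Put $n=r_N$ and suppose that: (i) there exists a function $b:[0,\infty)\to(0,\infty)$ such that $b(x)\to\infty$ and $b(x)/x\to 0$ as $x\to\infty$, and, for all $1\le i\ne j\le n$, $$\mathbf{P}[\Theta_i>b(x_i)]=o\big(\mathbf{P}[\Theta_iX_i>x_i,\ \Theta_jX_j>x_j]\big)\quad\text{as } x_i\wedge x_j\to\infty;$$ (ii) there exists a function $h:[0,\infty)\to(0,\infty)$ such that, for each $i=1,\ldots,n$, $$\mathbf{P}[X_i>x\mid\Theta_i=\theta]\sim h(\theta)\,\mathbf{P}[X_i>x]\quad\text{as }x\to\infty,\ \text{uniformly for }\theta\in s_{\Theta};$$ (iii) there exist a measurable function $g:[0,\infty)^2\to(0,\infty)$ and constants $0<L\le U<\infty$ such that, for all $1\le i\neq j\le n$, as $x_i\wedge x_j\to\infty$, uniformly for $(\theta_i,\theta_j)\in s_{\Theta}\times s_{\Theta}$, $$\mathbf{P}[|X_i|>x_i,\ X_j>x_j\mid\Theta_i=\theta_i,\Theta_j=\theta_j]\sim g(\theta_i,\theta_j)\,\mathbf{P}[|X_i|>x_i,\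 X_j>x_j]$$ and $$L\,g(\theta_i,\theta_j)\mathbf{P}[X_i>x_i,X_j>x_j]\lesssim \mathbf{P}[X_i>x_i,X_j>x_j\mid\Theta_i=\theta_i,\Theta_j=\theta_j]\lesssim U\,g(\theta_i,\theta_j)\mathbf{P}[X_i>x_i,X_j>x_j].$$ Let $\psi(x,N)=\mathbf{P}[S_{(N)}^{\Theta}>x]$ be the random-time ruin probability, where $S_{(N)}^{\Theta}=0$ if $N=0$ and $S_{(N)}^{\Theta}=\max_{1\le k\le N}\sum_{i=1}^k\Theta_iX_i$ if $N\ge1$. (1) If either $X_1,\ldots,X_n$ are pTAI, or $X_1,\ldots,X_n$ are pQAI and $F\in\mathcal{C}$, then $$\psi(x,N)\sim\mathbf{E}[N]\,\mathbf{P}[\Theta X>x]\quad\text{as }x\to\infty.$$ (2) If, in addition to (i)-(iii), $F\in\mathcal{R}_{-\alpha}$ for some $\alpha>0$ and $\mathbf{E}[\Theta^{p}h(\Theta)]<\infty$ for some $p>\alpha$, and if $X_1,\ldots,X_n$ are pTAI or pQAI, then $$\psi(x,N)\sim\mathbf{E}[N]\,\mathbf{E}[\Theta^{\alpha}h(\Theta)]\,\overline F(x)\quad\text{as }x\to\infty.$$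
   Context: For a distribution $F$, $\overline F(x)=1-F(x)$; throughout $\overline F(x)>0$ for all $x\ge0$ for the distribution $F$ of $X$. "Non-degenerate at zero" means not almost surely equal to $0$. $x\wedge y=\min\{x,y\}$, $x^+=\max\{x,0\}$, $x^-=-\min\{x,0\}$. In the risk model, $X_i$ are net losses, $\Theta_i$ discount factors and $x$ the initial surplus. $f=o(g)$ means $f/g\to0$; $f\sim g$ means $f/g\to1$; $f\lesssim g$ means $\limsup f/g\le1$. Uniformity of $\sim$ over $\theta$ means that the supremum over $\theta$ of $|f/g-1|$ tends to $0$; uniformity of $\lesssim$ means $\limsup$ of the supremum over $\theta$ of the ratio $f/g$ is $\le1$. Support: $s_{\Theta}=\{\theta\in\mathbb{R}:\mathbf{P}(\Theta\in[\theta-\delta,\theta+\delta])>0\text{ for any }\delta>0\}$. For an event $A$, $\mathbf{P}[A\mid\Theta_i=\theta_i,\Theta_j=\theta_j]$ is defined as $$\lim_{\delta\downarrow0}\frac{\mathbf{P}[A,\ \Theta_i\in[\theta_i-\delta,\theta_i+\delta],\ \Theta_j\in[\theta_j-\delta,\theta_j+\delta]]}{\mathbf{P}[\Theta_i\in[\theta_i-\delta,\theta_i+\delta],\ \Theta_j\in[\theta_j-\delta,\theta_j+\delta]]},$$ and $\mathbf{P}[A\mid\Theta_i=\theta]$ is defined analogously with a single weight. Distribution classes: $F\in\mathcal{D}$ if $\limsup_{x\to\infty}\overline F(bx)/\overline F(x)<\infty$ for any (equivalently, some) $b\in(0,1)$; $F\in\mathcal{L}$ if $\lim_{x\to\infty}\overline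 F(x-a)/\overline F(x)=1$ for any (equivalently, some) $a>0$; $F\in\mathcal{C}$ if $\lim_{v\uparrow1}\limsup_{x\to\infty}\overline F(vx)/\overline F(x)=1$; $F\in\mathcal{R}_{-\alpha}$ ($0<\alpha<\infty$) if $\lim_{x\to\infty}\overline F(bx)/\overline F(x)=b^{-\alpha}$ for every $b>0$. Real-valued random variables $Y_1,\ldots,Y_n$ are pTAI if for all $i\ne j$, $\lim_{x_i\wedge x_j\to\infty}\mathbf{P}[|Y_i|>x_i\mid Y_j>x_j]=0$. They are pQAI if for all $i\neq j$, $$\lim_{x\to\infty}\frac{\mathbf{P}[Y_i^+>x,\,Y_j^+>x]}{\mathbf{P}[Y_i>x]+\mathbf{P}[Y_j>x]}=\lim_{x\to\infty}\frac{\mathbf{P}[Y_i^->x,\,Y_j>x]}{\mathbf{P}[Y_i>x]+\mathbf{P}[Y_j>x]}=0.$$ *)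

theory Defs
  imports "HOL-Probability.Probability" "HOL-Library.Landau_Symbols"
begin

definition min_at_top :: "(real \<times> real) filter" where
  "min_at_top = filtercomap (\<lambda>(x, y). min x y) at_top"

text \<open>Relations between f and g that are uniform over a parameter set S. In the first one a
  vanishing denominator makes the quotient 0, so it forces g to be nonzero eventually. In the
  second one the quotient is taken in the extended reals, where a positive number divided by 0
  is infinite; a real quotient would be 0 there and the condition would hold for free.\<close>

definition uniformly_equiv ::
    "'b set \<Rightarrow> 'c filter \<Rightarrow> ('c \<Rightarrow> 'b \<Rightarrow> real) \<Rightarrow> ('c \<Rightarrow> 'b \<Rightarrow> real) \<Rightarrow> bool" where
  "uniformly_equiv S F f g \<longleftrightarrow> uniform_limit S (\<lambda>x t. f x t / g x t) (\<lambda>_. 1) F"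

definition uniformly_lesssim ::
    "'b set \<Rightarrow> 'c filter \<Rightarrow> ('c \<Rightarrow> 'b \<Rightarrow> real) \<Rightarrow> ('c \<Rightarrow> 'b \<Rightarrow> real) \<Rightarrow> bool" where
  "uniformly_lesssim S F f g \<longleftrightarrow> Limsup F (\<lambda>x. SUP t\<in>S. ereal (f x t) / ereal (g x t)) \<le> 1"

text \<open>The quotients below are meaningful for distributions with unbounded support to the right,
  that is, with an everywhere positive tail.\<close>

definition tail :: "real measure \<Rightarrow> real \<Rightarrow> real" where
  "tail F x = 1 - cdf F x"

definition dominatedly_varying :: "real measure \<Rightarrow> bool" where
  "dominatedly_varying F \<longleftrightarrow>
    (\<forall>b. 0 < b \<and> b < 1 \<longrightarrow> Limsup at_top (\<lambda>x. ereal (tail F (b * x) / tail F x)) < \<infinity>)"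

definition long_tailed :: "real measure \<Rightarrow> bool" where
  "long_tailed F \<longleftrightarrow> (\<forall>a>0. ((\<lambda>x. tail F (x - a) / tail F x) \<longlongrightarrow> 1) at_top)"

definition consistently_varying :: "real measure \<Rightarrow> bool" where
  "consistently_varying F \<longleftrightarrow>
    ((\<lambda>v. Limsup at_top (\<lambda>x. ereal (tail F (v * x) / tail F x))) \<longlongrightarrow> 1) (at_left 1)"

text \<open>Regular variation of the tail with index minus alpha.\<close>

definition regularly_varying :: "real \<Rightarrow> real measure \<Rightarrow> bool" where
  "regularly_varying \<alpha> F \<longleftrightarrow>
    (\<forall>b>0. ((\<lambda>x. tail F (b * x) / tail F x) \<longlongrightarrow> b powr (- \<alpha>)) at_top)"

text \<open>Pairwise tail and pairwise quasi asymptotic independence of Y 1, ..., Y n.\<close>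

definition pTAI :: "'a measure \<Rightarrow> nat \<Rightarrow> (nat \<Rightarrow> 'a \<Rightarrow> real) \<Rightarrow> bool" where
  "pTAI M n Y \<longleftrightarrow> (\<forall>i\<in>{1..n}. \<forall>j\<in>{1..n}. i \<noteq> j \<longrightarrow>
    ((\<lambda>(xi, xj). \<P>(\<omega> in M. \<bar>Y i \<omega>\<bar> > xi \<bar> Y j \<omega> > xj)) \<longlongrightarrow> 0) min_at_top)"

definition pQAI :: "'a measure \<Rightarrow> nat \<Rightarrow> (nat \<Rightarrow> 'a \<Rightarrow> real) \<Rightarrow> bool" where
  "pQAI M n Y \<longleftrightarrow> (\<forall>i\<in>{1..n}. \<forall>j\<in>{1..n}. i \<noteq> j \<longrightarrow>
    ((\<lambda>x. \<P>(\<omega> in M. max (Y i \<omega>) 0 > x \<and> max (Y j \<omega>) 0 > x) /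
          (\<P>(\<omega> in M. Y i \<omega> > x) + \<P>(\<omega> in M. Y j \<omega> > x))) \<longlongrightarrow> 0) at_top \<and>
    ((\<lambda>x. \<P>(\<omega> in M. - min (Y i \<omega>) 0 > x \<and> Y j \<omega> > x) /
          (\<P>(\<omega> in M. Y i \<omega> > x) + \<P>(\<omega> in M. Y j \<omega> > x))) \<longlongrightarrow> 0) at_top)"

definition rv_support :: "'a measure \<Rightarrow> ('a \<Rightarrow> real) \<Rightarrow> real set" where
  "rv_support M T = {\<theta>. \<forall>\<delta>>0. \<P>(\<omega> in M. T \<omega> \<in> {\<theta> - \<delta>..\<theta> + \<delta>}) > 0}"

text \<open>Conditional probabilities given the exact values of one or two weights are limits over
  shrinking windows. The value is arbitrary if the limit does not exist, so existence is a
  separate predicate.\<close>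

definition window_prob1 ::
    "'a measure \<Rightarrow> ('a \<Rightarrow> bool) \<Rightarrow> ('a \<Rightarrow> real) \<Rightarrow> real \<Rightarrow> real \<Rightarrow> real" where
  "window_prob1 M A T \<theta> \<delta> = \<P>(\<omega> in M. A \<omega> \<bar> T \<omega> \<in> {\<theta> - \<delta>..\<theta> + \<delta>})"

definition has_cond_prob1 ::
    "'a measure \<Rightarrow> ('a \<Rightarrow> bool) \<Rightarrow> ('a \<Rightarrow> real) \<Rightarrow> real \<Rightarrow> bool" where
  "has_cond_prob1 M A T \<theta> \<longleftrightarrow> (\<exists>p. (window_prob1 M A T \<theta> \<longlongrightarrow> p) (at_right 0))"

definition cond_prob1 ::
    "'a measure \<Rightarrow> ('a \<Rightarrow> bool) \<Rightarrow> ('a \<Rightarrow> real) \<Rightarrow> real \<Rightarrow> real" where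
  "cond_prob1 M A T \<theta> = Lim (at_right 0) (window_prob1 M A T \<theta>)"

definition window_prob2 ::
    "'a measure \<Rightarrow> ('a \<Rightarrow> bool) \<Rightarrow> ('a \<Rightarrow> real) \<Rightarrow> ('a \<Rightarrow> real) \<Rightarrow> real \<times> real \<Rightarrow> real \<Rightarrow> real" where
  "window_prob2 M A T T' \<theta> \<delta> =
    \<P>(\<omega> in M. A \<omega> \<bar> T \<omega> \<in> {fst \<theta> - \<delta>..fst \<theta> + \<delta>} \<and> T' \<omega> \<in> {snd \<theta> - \<delta>..snd \<theta> + \<delta>})"

definition has_cond_prob2 ::
    "'a measure \<Rightarrow> ('a \<Rightarrow> bool) \<Rightarrow> ('a \<Rightarrow> real) \<Rightarrow> ('a \<Rightarrow> real) \<Rightarrow> real \<times> real \<Rightarrow> bool" where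
  "has_cond_prob2 M A T T' \<theta> \<longleftrightarrow> (\<exists>p. (window_prob2 M A T T' \<theta> \<longlongrightarrow> p) (at_right 0))"

definition cond_prob2 ::
    "'a measure \<Rightarrow> ('a \<Rightarrow> bool) \<Rightarrow> ('a \<Rightarrow> real) \<Rightarrow> ('a \<Rightarrow> real) \<Rightarrow> real \<times> real \<Rightarrow> real" where
  "cond_prob2 M A T T' \<theta> = Lim (at_right 0) (window_prob2 M A T T' \<theta>)"

definition max_weighted_sum ::
    "(nat \<Rightarrow> 'a \<Rightarrow> real) \<Rightarrow> (nat \<Rightarrow> 'a \<Rightarrow> real) \<Rightarrow> nat \<Rightarrow> 'a \<Rightarrow> real" where
  "max_weighted_sum \<Theta> X m \<omega> =
    (if m = 0 then 0 else Max ((\<lambda>k. \<Sum>i=1..k. \<Theta> i \<omega> * X i \<omega>) ` {1..m}))"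

definition ruin_prob :: "'a measure \<Rightarrow> (nat \<Rightarrow> 'a \<Rightarrow> real) \<Rightarrow> (nat \<Rightarrow> 'a \<Rightarrow> real) \<Rightarrow>
    ('a \<Rightarrow> nat) \<Rightarrow> real \<Rightarrow> real" where
  "ruin_prob M \<Theta> X N x = \<P>(\<omega> in M. max_weighted_sum \<Theta> X (N \<omega>) \<omega> > x)"

text \<open>N is independent of the two sequences taken jointly: the sigma-algebra generated by N is
  independent of the one generated by all pairs (X i, T i), i at least 1. The library constant for
  independent random variables needs a common value type and does not apply.\<close>

definition indep_of_sequences :: "'a measure \<Rightarrow> ('a \<Rightarrow> nat) \<Rightarrow> (nat \<Rightarrow> 'a \<Rightarrow> real) \<Rightarrow>
    (nat \<Rightarrow> 'a \<Rightarrow> real) \<Rightarrow> bool" where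
  "indep_of_sequences M N X T \<longleftrightarrow>
    prob_space.indep_set M
      (sets (vimage_algebra (space M) N (count_space UNIV)))
      (sets (vimage_algebra (space M) (\<lambda>\<omega>. \<lambda>i\<in>{1..}. (X i \<omega>, T i \<omega>))
        (PiM {1..} (\<lambda>_. borel \<Otimes>\<^sub>M borel))))"

end

theory Submission
  imports Defs
begin

text \<open>The argument rests on three observations about the products \<^term>\<open>\<Theta> i * X i\<close>.

  The weights are bounded. In the condition on the weights and b, the first level may be kept fixed
  while the second one tends to infinity; the joint probability then vanishes, so
  \<^term>\<open>\<Theta> i\<close> exceeds a suitable constant B only with probability zero. Consequently a joint
  exceedance of the products at levels a and x entails one of the X at levels a / B and x / B.
  Dominated variation makes the tail of X at x / B comparable to the tail T of the product at x,
  and so each kind of asymptotic independence of the X passes to the products directly.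

  The tail of the product is a mixture. Let \<open>\<kappa>\<close> be the law of the weight with density h, restricted
  to (0, B]. The given conditional tails are limits over windows shrinking to a point, so a
  differentiation theorem on the line is needed to integrate them: if the ratio of two measures on
  small windows around the points of a bounded set is at most c, then so is their ratio on the set.
  This is proved by a Vitali-type exhaustion (\<open>measure_le_of_windows\<close>), and it gives
  P(X > x, \<open>\<Theta>\<close> in A) = (1 + o(1)) P(X > x) \<open>\<kappa>\<close>(A) uniformly in A (\<open>tilted_bounds\<close>).
  Decomposing the region z > x / \<open>\<theta>\<close> into rectangles yields T(x) \<open>\<sim>\<close> J(x), where J(x) is the
  \<open>\<kappa>\<close>-integral of P(X > x / \<open>\<theta>\<close>) (\<open>product_tail_equiv\<close>). Long tails, consistent variation and
  regular variation pass from X to J; small weights, over which x / \<open>\<theta>\<close> could not be controlled,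
  contribute a negligible share (\<open>small_weights_negligible\<close>).

  A single big jump decides (\<open>max_partial_sum_tail\<close>). Choose a shift l that hardly changes T but is
  so large that two of the products rarely exceed l / m and x / m together: a large constant under
  pairwise tail asymptotic independence, a small multiple of x under pairwise quasi asymptotic
  independence and consistent variation. Then the maximum of m partial sums has tail m T(x) up to a
  factor 1 + o(1), and averaging over the independent horizon N gives the first claim. A regularly
  varying tail varies consistently, and dominated convergence gives
  J(x) \<open>\<sim>\<close> E[\<open>\<Theta>\<close>^\<open>\<alpha>\<close> h(\<open>\<Theta>\<close>)] P(X > x), so the second claim follows from the first.\<close>

section \<open>Comparison of measures by shrinking windows\<close>

lemma borel_measurable_window:
  fixes \<nu> :: "real measure"
  assumes "finite_measure \<nu>" and sets: "sets \<nu> = sets borel"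
  shows "(\<lambda>\<theta>. measure \<nu> {\<theta> - \<delta>..\<theta> + \<delta>}) \<in> borel_measurable borel"
proof -
  interpret finite_measure \<nu> by fact
  define Q where "Q = {p :: real \<times> real. fst p - \<delta> \<le> snd p \<and> snd p \<le> fst p + \<delta>}"
  have "closed Q" unfolding Q_def
    by (intro closed_Collect_conj closed_Collect_le continuous_intros)
  then have "Q \<in> sets (borel \<Otimes>\<^sub>M borel)" unfolding borel_prod by simp
  also have "sets (borel \<Otimes>\<^sub>M borel) = sets (borel \<Otimes>\<^sub>M \<nu>)"
    by (rule sets_pair_measure_cong) (simp_all add: sets)
  finally have "(\<lambda>\<theta>. emeasure \<nu> (Pair \<theta> -` Q)) \<in> borel_measurable (borel :: real measure)"
    by (rule measurable_emeasure_Pair)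
  moreover have "Pair \<theta> -` Q = {\<theta> - \<delta>..\<theta> + \<delta>}" for \<theta>
    by (auto simp: Q_def)
  ultimately show ?thesis by (simp add: measure_def)
qed

text \<open>One step of the exhaustion: a finite disjoint union of windows that lies in a given
  neighbourhood and covers at least a sixth of E. Half of E is retained by a radius e so small that
  most windows stay inside the neighbourhood; cutting the line into cells of length e and keeping
  only the cells with the best residue modulo 3 retains a third of that and makes the windows
  disjoint.\<close>

lemma window_cover_step:
  fixes \<nu> \<nu>' :: "real measure" and d :: "nat \<Rightarrow> real"
  assumes fin: "finite_measure \<nu>" "finite_measure \<nu>'"
    and sets: "sets \<nu> = sets borel" "sets \<nu>' = sets borel"
    and d: "\<And>m. d m > 0" "decseq d" "d \<longlonglongrightarrow> 0"
    and E: "E \<in> sets borel" "bounded E" and U: "open U" "E \<subseteq> U"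
    and win: "\<And>\<theta> m. \<theta> \<in> E \<Longrightarrow> m \<ge> k \<Longrightarrow>
      measure \<nu> {\<theta> - d m..\<theta> + d m} \<le> c * measure \<nu>' {\<theta> - d m..\<theta> + d m}"
  shows "\<exists>W. closed W \<and> W \<subseteq> U \<and> measure \<nu> W \<le> c * measure \<nu>' W \<and>
    measure \<nu> (E - W) \<le> 5 / 6 * measure \<nu> E"
proof (cases "measure \<nu> E = 0")
  case True
  then show ?thesis by (intro exI[of _ "{}"]) auto
next
  case False
  interpret N: finite_measure \<nu> by fact
  interpret N': finite_measure \<nu>' by fact
  have pos: "measure \<nu> E > 0" using False by (simp add: zero_less_measure_iff)
  define V where "V m = {\<theta>. {\<theta> - d m..\<theta> + d m} \<subseteq> U}" for m
  have V_borel: "V m \<in> sets borel" for m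
  proof -
    have "closed (\<Union>x\<in>- U. \<Union>y\<in>{- d m..d m}. {x + y})"
      using U(1) by (intro closed_compact_sums) (auto simp: closed_Compl)
    also have "(\<Union>x\<in>- U. \<Union>y\<in>{- d m..d m}. {x + y}) = - V m"
    proof -
      have "\<theta> \<in> (\<Union>x\<in>- U. \<Union>y\<in>{- d m..d m}. {x + y}) \<longleftrightarrow> (\<exists>t\<in>{\<theta> - d m..\<theta> + d m}. t \<notin> U)" for \<theta>
      proof
        assume "\<exists>t\<in>{\<theta> - d m..\<theta> + d m}. t \<notin> U"
        then obtain t where t: "t \<notin> U" "\<theta> - t \<in> {- d m..d m}" by auto
        then show "\<theta> \<in> (\<Union>x\<in>- U. \<Union>y\<in>{- d m..d m}. {x + y})"
          by (intro UN_I[of t] UN_I[of "\<theta> - t"]) auto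
      qed force
      then show ?thesis by (auto simp: V_def)
    qed
    finally show ?thesis by (metis borel_closed borel_comp double_complement)
  qed
  have "(\<lambda>m. measure \<nu> (E \<inter> V m)) \<longlonglongrightarrow> measure \<nu> (\<Union>m. E \<inter> V m)"
  proof (rule N.finite_Lim_measure_incseq)
    show "range (\<lambda>m. E \<inter> V m) \<subseteq> sets \<nu>" using E V_borel sets by auto
    show "incseq (\<lambda>m. E \<inter> V m)"
    proof (rule incseq_SucI)
      fix m
      have "d (Suc m) \<le> d m" using d(2) by (simp add: decseq_SucD)
      then have "{\<theta> - d (Suc m)..\<theta> + d (Suc m)} \<subseteq> {\<theta> - d m..\<theta> + d m}" for \<theta> by auto
      then show "E \<inter> V m \<subseteq> E \<inter> V (Suc m)" unfolding V_def by blast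
    qed
  qed
  moreover have "(\<Union>m. E \<inter> V m) = E"
  proof -
    have "\<exists>m. \<theta> \<in> V m" if \<theta>: "\<theta> \<in> E" for \<theta>
    proof -
      obtain e where e: "e > 0" "cball \<theta> e \<subseteq> U"
        using bspec[OF open_contains_cball[THEN iffD1, OF U(1)], of \<theta>] \<theta> U(2) by blast
      have "\<forall>\<^sub>F m in sequentially. d m < e" using d(3) e(1) by (rule order_tendstoD)
      then obtain m where "d m < e" by (auto simp: eventually_sequentially)
      then have "{\<theta> - d m..\<theta> + d m} \<subseteq> cball \<theta> e" by (auto simp: cball_eq_atLeastAtMost)
      with e show ?thesis by (auto simp: V_def)
    qed
    then show ?thesis by auto
  qed
  ultimately have "\<forall>\<^sub>F m in sequentially. measure \<nu> (E \<inter> V m) > measure \<nu> E / 2"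
    using pos by (intro order_tendstoD(1)[of _ "measure \<nu> E"]) auto
  then have "\<forall>\<^sub>F m in sequentially. measure \<nu> (E \<inter> V m) > measure \<nu> E / 2 \<and> m \<ge> k"
    using eventually_ge_at_top[of k] by eventually_elim auto
  then obtain m where m: "measure \<nu> (E \<inter> V m) > measure \<nu> E / 2" "m \<ge> k"
    by (auto simp: eventually_sequentially)
  define e where "e = d m"
  have e: "e > 0" using d by (simp add: e_def)
  \<comment> \<open>a window of radius e meets only the cell of its centre and the two adjacent cells\<close>
  define C where "C r = {\<theta> \<in> E \<inter> V m. \<lfloor>\<theta> / e\<rfloor> mod 3 = r}" for r :: int
  have C_borel: "C r \<in> sets \<nu>" for r
  proof -
    have "{\<theta> \<in> space borel. \<lfloor>\<theta> / e\<rfloor> mod 3 = r} \<in> sets borel" by measurable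
    moreover have "C r = (E \<inter> V m) \<inter> {\<theta> \<in> space borel. \<lfloor>\<theta> / e\<rfloor> mod 3 = r}"
      by (auto simp: C_def)
    ultimately show ?thesis using E V_borel sets by auto
  qed
  have "measure \<nu> (E \<inter> V m) = measure \<nu> (\<Union>r\<in>{0..<3}. C r)"
    by (rule arg_cong[of _ _ "measure \<nu>"]) (auto simp: C_def)
  also have "\<dots> \<le> (\<Sum>r\<in>{0..<3}. measure \<nu> (C r))"
    using C_borel by (intro N.finite_measure_subadditive_finite) auto
  finally have "\<exists>r\<in>{0..<3}. measure \<nu> (C r) > measure \<nu> E / 6"
  proof (rule contrapos_pp)
    assume "\<not> (\<exists>r\<in>{0..<3}. measure \<nu> (C r) > measure \<nu> E / 6)"
    then have "(\<Sum>r\<in>{0..<3::int}. measure \<nu> (C r)) \<le> (\<Sum>r\<in>{0..<3::int}. measure \<nu> E / 6)"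
      by (intro sum_mono) (auto simp: not_less)
    then show "\<not> measure \<nu> (E \<inter> V m) \<le> (\<Sum>r\<in>{0..<3}. measure \<nu> (C r))"
      using m(1) by simp
  qed
  then obtain r where r: "measure \<nu> (C r) > measure \<nu> E / 6" by blast
  define J where "J = (\<lambda>\<theta>. \<lfloor>\<theta> / e\<rfloor>) ` C r"
  obtain R where R: "\<And>\<theta>. \<theta> \<in> E \<Longrightarrow> \<bar>\<theta>\<bar> \<le> R" using E(2) by (auto simp: bounded_iff)
  have "finite J"
  proof (rule finite_subset)
    show "J \<subseteq> {\<lfloor>- R / e\<rfloor>..\<lfloor>R / e\<rfloor>}"
    proof
      fix a assume "a \<in> J"
      then obtain \<theta> where \<theta>: "\<theta> \<in> E" "a = \<lfloor>\<theta> / e\<rfloor>" by (auto simp: J_def C_def)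
      have "- R \<le> \<theta>" "\<theta> \<le> R" using R[OF \<theta>(1)] by (auto simp: abs_le_iff)
      then have "- R / e \<le> \<theta> / e" "\<theta> / e \<le> R / e" using e by (simp_all only: divide_le_cancel) auto
      then show "a \<in> {\<lfloor>- R / e\<rfloor>..\<lfloor>R / e\<rfloor>}" unfolding \<theta>(2) by (auto intro: floor_mono)
    qed
  qed simp
  obtain \<tau> where \<tau>: "\<And>a. a \<in> J \<Longrightarrow> \<tau> a \<in> C r" "\<And>a. a \<in> J \<Longrightarrow> \<lfloor>\<tau> a / e\<rfloor> = a"
  proof -
    have "\<forall>a\<in>J. \<exists>\<theta>. \<theta> \<in> C r \<and> \<lfloor>\<theta> / e\<rfloor> = a" by (auto simp: J_def)
    from bchoice[OF this] show ?thesis using that by blast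
  qed
  define I where "I a = {\<tau> a - e..\<tau> a + e}" for a
  define W where "W = (\<Union>a\<in>J. I a)"
  have cell: "a * e \<le> \<tau> a \<and> \<tau> a < (a + 1) * e" if "a \<in> J" for a
    using floor_divide_lower[OF e, of "\<tau> a"] floor_divide_upper[OF e, of "\<tau> a"]
    unfolding \<tau>(2)[OF that] by auto
  have "disjoint_family_on I J"
  proof -
    have "I a \<inter> I a' = {}" if a: "a \<in> J" "a' \<in> J" "a < a'" for a a'
    proof -
      have "a mod 3 = r" "a' mod 3 = r" using \<tau> a by (auto simp: C_def)
      with a(3) have "a' \<ge> a + 3" by presburger
      then have "real_of_int (a + 3) * e \<le> a' * e" using e by (intro mult_right_mono) auto
      then have "\<tau> a + e < \<tau> a' - e"
        using cell[OF a(1)] cell[OF a(2)] e by (simp add: algebra_simps)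
      then show ?thesis by (auto simp: I_def)
    qed
    then show ?thesis unfolding disjoint_family_on_def
      by (metis Int_commute linorder_neqE_linordered_idom)
  qed
  moreover have "range I \<subseteq> sets borel" by (auto simp: I_def)
  ultimately have sums: "measure \<nu> W = (\<Sum>a\<in>J. measure \<nu> (I a))" "measure \<nu>' W = (\<Sum>a\<in>J. measure \<nu>' (I a))"
    unfolding W_def using \<open>finite J\<close> \<open>range I \<subseteq> sets borel\<close> sets
    by (auto intro!: N.finite_measure_finite_Union N'.finite_measure_finite_Union)
  have "measure \<nu> (I a) \<le> c * measure \<nu>' (I a)" if "a \<in> J" for a
    using win[OF _ m(2), of "\<tau> a"] \<tau>(1)[OF that] by (auto simp: I_def e_def C_def)
  then have "measure \<nu> W \<le> c * measure \<nu>' W"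
    unfolding sums sum_distrib_left by (intro sum_mono)
  moreover have "closed W" unfolding W_def using \<open>finite J\<close> by (auto simp: I_def)
  moreover have "W \<subseteq> U" using \<tau>(1) by (fastforce simp: W_def I_def C_def V_def e_def)
  moreover have "measure \<nu> (E - W) \<le> 5 / 6 * measure \<nu> E"
  proof -
    have "C r \<subseteq> W"
    proof
      fix \<theta> assume \<theta>: "\<theta> \<in> C r"
      define a where "a = \<lfloor>\<theta> / e\<rfloor>"
      have "a \<in> J" using \<theta> by (auto simp: J_def a_def)
      have "a * e \<le> \<theta> \<and> \<theta> < (a + 1) * e"
        using floor_divide_lower[OF e] floor_divide_upper[OF e] unfolding a_def by auto
      with cell[OF \<open>a \<in> J\<close>] have "\<theta> \<in> I a" by (auto simp: I_def algebra_simps)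
      with \<open>a \<in> J\<close> show "\<theta> \<in> W" by (auto simp: W_def)
    qed
    then have "measure \<nu> (E - W) \<le> measure \<nu> (E - C r)"
      using E C_borel sets by (intro N.finite_measure_mono) auto
    also have "\<dots> = measure \<nu> E - measure \<nu> (C r)"
      using E C_borel sets by (intro N.finite_measure_Diff) (auto simp: C_def)
    finally show ?thesis using r by simp
  qed
  ultimately show ?thesis by blast
qed

text \<open>Repeating the step inside the complement of the windows chosen so far exhausts E up to a null
  set, with the window inequality adding up over disjoint windows.\<close>

lemma measure_le_of_uniform_windows:
  fixes \<nu> \<nu>' :: "real measure" and d :: "nat \<Rightarrow> real"
  assumes fin: "finite_measure \<nu>" "finite_measure \<nu>'"
    and sets: "sets \<nu> = sets borel" "sets \<nu>' = sets borel"
    and d: "\<And>m. d m > 0" "decseq d" "d \<longlonglongrightarrow> 0" and c: "c \<ge> 0"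
    and E: "E \<in> sets borel" "bounded E"
    and win: "\<And>\<theta> m. \<theta> \<in> E \<Longrightarrow> m \<ge> k \<Longrightarrow>
      measure \<nu> {\<theta> - d m..\<theta> + d m} \<le> c * measure \<nu>' {\<theta> - d m..\<theta> + d m}"
  shows "measure \<nu> E \<le> c * measure \<nu>' E"
proof -
  interpret N: finite_measure \<nu> by fact
  interpret N': finite_measure \<nu>' by fact
  have open_bound: "measure \<nu> E \<le> c * measure \<nu>' U" if U: "open U" "E \<subseteq> U" for U
  proof -
    have iter: "\<exists>W. closed W \<and> W \<subseteq> U \<and> measure \<nu> W \<le> c * measure \<nu>' W \<and>
      measure \<nu> (E - W) \<le> (5 / 6) ^ q * measure \<nu> E" for q
    proof (induction q)
      case 0
      then show ?case by (intro exI[of _ "{}"]) auto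
    next
      case (Suc q)
      then obtain W where W: "closed W" "W \<subseteq> U" "measure \<nu> W \<le> c * measure \<nu>' W"
        "measure \<nu> (E - W) \<le> (5 / 6) ^ q * measure \<nu> E" by blast
      have "\<exists>W'. closed W' \<and> W' \<subseteq> U - W \<and> measure \<nu> W' \<le> c * measure \<nu>' W' \<and>
        measure \<nu> (E - W - W') \<le> 5 / 6 * measure \<nu> (E - W)"
        using U W E win
        by (intro window_cover_step[OF fin sets d, where k = k]) (auto intro: bounded_subset)
      then obtain W' where W': "closed W'" "W' \<subseteq> U - W" "measure \<nu> W' \<le> c * measure \<nu>' W'"
        "measure \<nu> (E - W - W') \<le> 5 / 6 * measure \<nu> (E - W)" by blast
      have disj: "W \<inter> W' = {}" using W' by auto
      have "measure \<nu> (W \<union> W') = measure \<nu> W + measure \<nu> W'"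
        "measure \<nu>' (W \<union> W') = measure \<nu>' W + measure \<nu>' W'"
        using disj W(1) W'(1) sets
        by (auto intro!: N.finite_measure_Union N'.finite_measure_Union)
      then have "measure \<nu> (W \<union> W') \<le> c * measure \<nu>' (W \<union> W')"
        using W W' by (simp add: distrib_left)
      moreover have "measure \<nu> (E - (W \<union> W')) \<le> (5 / 6) ^ Suc q * measure \<nu> E"
        using W(4) W'(4) by (simp add: Diff_Diff_Int set_diff_eq conj_assoc)
      ultimately show ?case using W W' by (intro exI[of _ "W \<union> W'"]) auto
    qed
    have "measure \<nu> E \<le> c * measure \<nu>' U + (5 / 6) ^ q * measure \<nu> E" for q
    proof -
      obtain W where W: "closed W" "W \<subseteq> U" "measure \<nu> W \<le> c * measure \<nu>' W"
        "measure \<nu> (E - W) \<le> (5 / 6) ^ q * measure \<nu> E" using iter by blast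
      have "measure \<nu> E \<le> measure \<nu> (W \<union> (E - W))"
        using W E sets by (intro N.finite_measure_mono) auto
      also have "\<dots> \<le> measure \<nu> W + measure \<nu> (E - W)"
        using W E sets by (intro measure_Un_le) auto
      also have "measure \<nu>' W \<le> measure \<nu>' U"
        using W U sets by (intro N'.finite_measure_mono) auto
      then have "measure \<nu> W \<le> c * measure \<nu>' U"
        using W(3) c by (meson mult_left_mono order_trans)
      finally show ?thesis using W(4) by linarith
    qed
    moreover have "(\<lambda>q. c * measure \<nu>' U + (5 / 6) ^ q * measure \<nu> E)
        \<longlonglongrightarrow> c * measure \<nu>' U + 0 * measure \<nu> E"
      by (intro tendsto_intros LIMSEQ_realpow_zero) auto
    ultimately show ?thesis
      by (intro LIMSEQ_le_const[of _ "c * measure \<nu>' U"]) auto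
  qed
  have "ennreal (measure \<nu> E) \<le> ennreal c * ennreal (measure \<nu>' E)"
  proof (rule ennreal_le_epsilon)
    fix e :: real assume "e > 0"
    define e' where "e' = e / (c + 1)"
    have e': "e' > 0" "c * e' \<le> e" using \<open>e > 0\<close> c by (auto simp: e'_def field_simps)
    have "emeasure \<nu>' E = (INF U\<in>{U. E \<subseteq> U \<and> open U}. emeasure \<nu>' U)"
      using sets E N'.emeasure_finite by (intro outer_regular) auto
    moreover have "emeasure \<nu>' E < emeasure \<nu>' E + ennreal e'"
      using e' N'.emeasure_finite[of E] by (simp add: ennreal_add_left_cancel_less)
    ultimately obtain U where U: "E \<subseteq> U" "open U" "emeasure \<nu>' U < emeasure \<nu>' E + ennreal e'"
      by (metis (no_types, lifting) INF_less_iff mem_Collect_eq)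
    have "measure \<nu>' U \<le> measure \<nu>' E + e'"
      using U(3) e' unfolding N'.emeasure_eq_measure
      by (metis ennreal_le_iff ennreal_plus less_imp_le add_nonneg_nonneg measure_nonneg)
    then have "measure \<nu> E \<le> c * (measure \<nu>' E + e')"
      using open_bound[OF U(2,1)] c by (meson mult_left_mono order_trans)
    then have "measure \<nu> E \<le> c * measure \<nu>' E + e"
      using e' by (simp add: distrib_left)
    then show "ennreal (measure \<nu> E) \<le> ennreal c * ennreal (measure \<nu>' E) + ennreal e"
      using c \<open>e > 0\<close> by (simp flip: ennreal_mult ennreal_plus)
  qed
  then show ?thesis using c by (simp flip: ennreal_mult)
qed

text \<open>The radius from which on the window inequality holds may depend on the point; the sets on which
  it holds along the radii 1 / (m + 1) for all m from k on increase to E.\<close>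

lemma measure_le_of_windows:
  fixes \<nu> \<nu>' :: "real measure"
  assumes fin: "finite_measure \<nu>" "finite_measure \<nu>'"
    and sets: "sets \<nu> = sets borel" "sets \<nu>' = sets borel"
    and c: "c \<ge> 0" and E: "E \<in> sets borel" "bounded E"
    and win: "\<And>\<theta>. \<theta> \<in> E \<Longrightarrow>
      \<forall>\<^sub>F \<delta> in at_right 0. measure \<nu> {\<theta> - \<delta>..\<theta> + \<delta>} \<le> c * measure \<nu>' {\<theta> - \<delta>..\<theta> + \<delta>}"
  shows "measure \<nu> E \<le> c * measure \<nu>' E"
proof -
  interpret N: finite_measure \<nu> by fact
  interpret N': finite_measure \<nu>' by fact
  define d where "d m = inverse (real (Suc m))" for m
  have d: "\<And>m. d m > 0" "decseq d" "d \<longlonglongrightarrow> 0"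
    using LIMSEQ_inverse_real_of_nat
    by (auto simp: d_def[abs_def] decseq_def intro!: le_imp_inverse_le)
  have d_right: "filterlim d (at_right 0) sequentially"
    using d by (intro tendsto_imp_filterlim_at_right always_eventually) auto
  define w where "w m \<theta> \<longleftrightarrow>
      measure \<nu> {\<theta> - d m..\<theta> + d m} \<le> c * measure \<nu>' {\<theta> - d m..\<theta> + d m}" for m \<theta>
  define A where "A k = E \<inter> {\<theta>. \<forall>m. m \<ge> k \<longrightarrow> w m \<theta>}" for k
  have A_borel: "A k \<in> sets borel" for k
  proof -
    have "{\<theta> \<in> space borel. w m \<theta>} \<in> sets borel" for m
      unfolding w_def
      by (intro borel_measurable_le borel_measurable_times borel_measurable_const
          borel_measurable_window fin sets)
    then have "(\<Inter>m\<in>{k..}. {\<theta>. w m \<theta>}) \<in> sets borel"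
      by (intro sets.countable_INT') auto
    moreover have "(\<Inter>m\<in>{k..}. {\<theta>. w m \<theta>}) = {\<theta>. \<forall>m. m \<ge> k \<longrightarrow> w m \<theta>}" by auto
    ultimately have "{\<theta>. \<forall>m. m \<ge> k \<longrightarrow> w m \<theta>} \<in> sets borel" by (simp only:)
    then show ?thesis unfolding A_def using E(1) by (rule sets.Int[rotated])
  qed
  have "(\<lambda>k. measure \<nu> (A k)) \<longlonglongrightarrow> measure \<nu> (\<Union>k. A k)"
    using A_borel sets by (intro N.finite_Lim_measure_incseq incseq_SucI) (auto simp: A_def)
  moreover have "(\<Union>k. A k) = E"
  proof -
    have "\<exists>k. \<theta> \<in> A k" if "\<theta> \<in> E" for \<theta>
      using filterlim_iff[THEN iffD1, OF d_right, rule_format, OF win[OF that]] that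
      by (auto simp: A_def w_def eventually_sequentially)
    then show ?thesis by (auto simp: A_def)
  qed
  moreover have "measure \<nu> (A k) \<le> c * measure \<nu>' E" for k
  proof -
    have "measure \<nu> (A k) \<le> c * measure \<nu>' (A k)"
    proof (rule measure_le_of_uniform_windows[OF fin sets d c A_borel])
      show "bounded (A k)" using E(2) by (rule bounded_subset) (auto simp: A_def)
    qed (auto simp: A_def w_def)
    also have "\<dots> \<le> c * measure \<nu>' E"
      using c E sets by (intro mult_left_mono N'.finite_measure_mono) (auto simp: A_def)
    finally show ?thesis .
  qed
  ultimately show ?thesis by (auto intro: LIMSEQ_le_const2)
qed

section \<open>Density bounds\<close>

lemma emeasure_le_by_pieces:
  fixes S :: "int \<Rightarrow> 'b set"
  assumes "sets P = sets Q" "\<And>k. S k \<in> sets P" "disjoint_family S"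
    and "\<And>k. emeasure P (S k) \<le> emeasure Q (S k)"
  shows "emeasure P (\<Union>k. S k) \<le> emeasure Q (\<Union>k. S k)"
  using assms by (subst (1 2) emeasure_UN_countable) (auto intro!: nn_integral_mono)

context
  fixes \<nu> \<mu> :: "real measure" and E :: "real set" and p :: "real \<Rightarrow> real"
  assumes fin: "finite_measure \<nu>" "finite_measure \<mu>"
    and sets: "sets \<nu> = sets borel" "sets \<mu> = sets borel"
    and E: "E \<in> sets borel" "bounded E"
    and p: "p \<in> borel_measurable borel" "\<And>\<theta>. \<theta> \<in> E \<Longrightarrow> p \<theta> > 0"
begin

interpretation N: finite_measure \<nu> by (rule fin)
interpretation M: finite_measure \<mu> by (rule fin)

text \<open>The part of A on which p lies between the k-th and the (k+1)-st power of r. On a layer the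
  function p is constant up to the factor r, so the comparison of measures with a constant ratio
  applies.\<close>

definition layer :: "real \<Rightarrow> real set \<Rightarrow> int \<Rightarrow> real set" where
  "layer r A k = {\<theta> \<in> A. \<lfloor>log r (p \<theta>)\<rfloor> = k}"

lemma layer_bounds:
  assumes "r > 1" "A \<subseteq> E" "\<theta> \<in> layer r A k"
  shows "r powr k \<le> p \<theta>" "p \<theta> \<le> r * r powr k"
proof -
  have pos: "p \<theta> > 0" using assms p by (auto simp: layer_def)
  have k: "k = \<lfloor>log r (p \<theta>)\<rfloor>" using assms(3) by (auto simp: layer_def)
  have "of_int k \<le> log r (p \<theta>)" "log r (p \<theta>) < of_int k + 1"
    unfolding k by linarith+
  then have "r powr k \<le> p \<theta>" "p \<theta> < r powr (k + 1)"
    using assms(1) pos by (auto simp: powr_le_iff less_powr_iff)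
  then show "r powr k \<le> p \<theta>" "p \<theta> \<le> r * r powr k"
    using assms(1) by (auto simp: powr_add mult.commute)
qed

lemma layer_sets:
  assumes "A \<in> sets borel"
  shows "layer r A k \<in> sets borel"
proof -
  note [measurable] = p(1)
  have "{\<theta> \<in> space borel. \<lfloor>log r (p \<theta>)\<rfloor> = k} \<in> sets borel" by measurable
  then have "A \<inter> {\<theta>. \<lfloor>log r (p \<theta>)\<rfloor> = k} \<in> sets borel" using assms by simp
  then show ?thesis by (simp add: layer_def Int_def)
qed

lemma layer_disjoint: "disjoint_family (layer r A)"
  by (auto simp: disjoint_family_on_def layer_def)

lemma layer_Union: "(\<Union>k. layer r A k) = A"
  by (auto simp: layer_def)

lemma measure_le_density_of_windows:
  assumes r: "r > 1" and A: "A \<in> sets borel" "A \<subseteq> E"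
    and win: "\<And>\<theta>. \<theta> \<in> E \<Longrightarrow>
      \<forall>\<^sub>F \<delta> in at_right 0. measure \<nu> {\<theta> - \<delta>..\<theta> + \<delta>} \<le> p \<theta> * measure \<mu> {\<theta> - \<delta>..\<theta> + \<delta>}"
  shows "emeasure \<nu> A \<le> ennreal r * emeasure (density \<mu> (\<lambda>\<theta>. ennreal (p \<theta>))) A"
proof -
  define \<rho> where "\<rho> = scale_measure r (density \<mu> (\<lambda>\<theta>. ennreal (p \<theta>)))"
  have "emeasure \<nu> (\<Union>k. layer r A k) \<le> emeasure \<rho> (\<Union>k. layer r A k)"
  proof (rule emeasure_le_by_pieces)
    fix k
    let ?L = "layer r A k"
    have L: "?L \<in> sets borel" "?L \<subseteq> E" using A layer_sets by (auto simp: layer_def)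
    have "measure \<nu> ?L \<le> (r * r powr k) * measure \<mu> ?L"
    proof (rule measure_le_of_windows[OF fin sets])
      show "bounded ?L" using E L by (blast intro: bounded_subset)
      fix \<theta> assume \<theta>: "\<theta> \<in> ?L"
      have "p \<theta> * measure \<mu> {\<theta> - \<delta>..\<theta> + \<delta>} \<le> r * r powr k * measure \<mu> {\<theta> - \<delta>..\<theta> + \<delta>}" for \<delta>
        using layer_bounds(2)[OF r A(2) \<theta>] by (intro mult_right_mono) auto
      then show "\<forall>\<^sub>F \<delta> in at_right 0.
          measure \<nu> {\<theta> - \<delta>..\<theta> + \<delta>} \<le> r * r powr k * measure \<mu> {\<theta> - \<delta>..\<theta> + \<delta>}"
        using win[of \<theta>] \<theta> L
        by (intro eventually_mono[OF win[of \<theta>]]) (auto intro: order_trans)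
    qed (use r L in auto)
    then have "emeasure \<nu> ?L \<le> ennreal r * (ennreal (r powr k) * emeasure \<mu> ?L)"
      using r unfolding N.emeasure_eq_measure M.emeasure_eq_measure
      by (simp flip: ennreal_mult add: mult.assoc)
    also have "ennreal (r powr k) * emeasure \<mu> ?L = (\<integral>\<^sup>+\<theta>. ennreal (r powr k) * indicator ?L \<theta> \<partial>\<mu>)"
      using L sets by (simp add: nn_integral_cmult_indicator)
    also have "\<dots> \<le> (\<integral>\<^sup>+\<theta>. ennreal (p \<theta>) * indicator ?L \<theta> \<partial>\<mu>)"
      using layer_bounds(1)[OF r A(2)]
      by (intro nn_integral_mono) (auto split: split_indicator intro: ennreal_leI)
    also have "\<dots> = emeasure (density \<mu> (\<lambda>\<theta>. ennreal (p \<theta>))) ?L"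
      using L sets p(1) by (subst emeasure_density) (auto simp: measurable_cong_sets[OF sets(2) refl])
    finally show "emeasure \<nu> ?L \<le> emeasure \<rho> ?L"
      by (simp add: \<rho>_def emeasure_scale_measure mult_left_mono)
  qed (use A sets layer_sets layer_disjoint in \<open>auto simp: \<rho>_def\<close>)
  then show ?thesis by (simp add: layer_Union \<rho>_def emeasure_scale_measure)
qed

lemma density_le_measure_of_windows:
  assumes r: "r > 1" and A: "A \<in> sets borel" "A \<subseteq> E"
    and win: "\<And>\<theta>. \<theta> \<in> E \<Longrightarrow>
      \<forall>\<^sub>F \<delta> in at_right 0. p \<theta> * measure \<mu> {\<theta> - \<delta>..\<theta> + \<delta>} \<le> measure \<nu> {\<theta> - \<delta>..\<theta> + \<delta>}"
  shows "emeasure (density \<mu> (\<lambda>\<theta>. ennreal (p \<theta>))) A \<le> ennreal r * emeasure \<nu> A"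
proof -
  define \<rho> where "\<rho> = density \<mu> (\<lambda>\<theta>. ennreal (p \<theta>))"
  have "emeasure \<rho> (\<Union>k. layer r A k) \<le> emeasure (scale_measure r \<nu>) (\<Union>k. layer r A k)"
  proof (rule emeasure_le_by_pieces)
    fix k
    let ?L = "layer r A k"
    have L: "?L \<in> sets borel" "?L \<subseteq> E" using A layer_sets by (auto simp: layer_def)
    have "measure \<mu> ?L \<le> (1 / r powr k) * measure \<nu> ?L"
    proof (rule measure_le_of_windows[OF fin(2,1) sets(2,1)])
      show "bounded ?L" using E L by (blast intro: bounded_subset)
      fix \<theta> assume \<theta>: "\<theta> \<in> ?L"
      have *: "r powr k * measure \<mu> {\<theta> - \<delta>..\<theta> + \<delta>} \<le> p \<theta> * measure \<mu> {\<theta> - \<delta>..\<theta> + \<delta>}" for \<delta>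
        using layer_bounds(1)[OF r A(2) \<theta>] by (intro mult_right_mono) auto
      have "\<forall>\<^sub>F \<delta> in at_right 0. r powr k * measure \<mu> {\<theta> - \<delta>..\<theta> + \<delta>} \<le> measure \<nu> {\<theta> - \<delta>..\<theta> + \<delta>}"
        using \<theta> L by (intro eventually_mono[OF win[of \<theta>]]) (auto intro: order_trans[OF *])
      then show "\<forall>\<^sub>F \<delta> in at_right 0.
          measure \<mu> {\<theta> - \<delta>..\<theta> + \<delta>} \<le> 1 / r powr k * measure \<nu> {\<theta> - \<delta>..\<theta> + \<delta>}"
        using r by (simp add: field_simps)
    qed (use r L in auto)
    then have *: "r * r powr k * measure \<mu> ?L \<le> r * measure \<nu> ?L"
      using r by (simp add: field_simps)
    have "emeasure \<rho> ?L = (\<integral>\<^sup>+\<theta>. ennreal (p \<theta>) * indicator ?L \<theta> \<partial>\<mu>)"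
      unfolding \<rho>_def
      using L sets p(1) by (subst emeasure_density) (auto simp: measurable_cong_sets[OF sets(2) refl])
    also have "\<dots> \<le> (\<integral>\<^sup>+\<theta>. ennreal (r * r powr k) * indicator ?L \<theta> \<partial>\<mu>)"
      using layer_bounds(2)[OF r A(2)]
      by (intro nn_integral_mono) (auto split: split_indicator intro: ennreal_leI)
    also have "\<dots> = ennreal (r * r powr k) * emeasure \<mu> ?L"
      using L sets by (simp add: nn_integral_cmult_indicator)
    also have "\<dots> \<le> ennreal r * emeasure \<nu> ?L"
      using r * unfolding N.emeasure_eq_measure M.emeasure_eq_measure
      by (simp flip: ennreal_mult)
    finally show "emeasure \<rho> ?L \<le> emeasure (scale_measure r \<nu>) ?L"
      by (simp add: emeasure_scale_measure)
  qed (use A sets layer_sets layer_disjoint in \<open>auto simp: \<rho>_def\<close>)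
  then show ?thesis by (simp add: layer_Union \<rho>_def emeasure_scale_measure)
qed

end

text \<open>An inequality between two measures on rectangles that are unbounded above extends to the region
  above the graph of a function: dyadic approximations of the function from above turn the region
  into an increasing union of disjoint unions of such rectangles.\<close>

lemma emeasure_epigraph_le:
  fixes P Q :: "(real \<times> real) measure" and \<phi> :: "real \<Rightarrow> real"
  assumes sets: "sets P = sets borel" "sets Q = sets borel"
    and D: "D \<in> sets borel" and \<phi>: "\<phi> \<in> borel_measurable borel" "\<And>\<theta>. \<theta> \<in> D \<Longrightarrow> K \<le> \<phi> \<theta>"
    and rect: "\<And>A t. A \<in> sets borel \<Longrightarrow> A \<subseteq> D \<Longrightarrow> t \<ge> K \<Longrightarrow>
      emeasure P (A \<times> {t<..}) \<le> emeasure Q (A \<times> {t<..})"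
  shows "emeasure P {(\<theta>, z). \<theta> \<in> D \<and> z > \<phi> \<theta>} \<le> emeasure Q {(\<theta>, z). \<theta> \<in> D \<and> z > \<phi> \<theta>}"
proof -
  define fl where "fl m \<theta> = \<lfloor>2 ^ m * \<phi> \<theta>\<rfloor>" for m :: nat and \<theta>
  define \<psi> where "\<psi> m \<theta> = (of_int (fl m \<theta>) + 1) / (2 ^ m :: real)" for m \<theta>
  define A where "A m k = {\<theta> \<in> D. fl m \<theta> = k}" for m k
  define R where "R m k = A m k \<times> {(of_int k + 1) / 2 ^ m :: real<..}" for m and k :: int
  define S where "S m = (\<Union>k. R m k)" for m
  have S_alt: "S m = {(\<theta>, z). \<theta> \<in> D \<and> z > \<psi> m \<theta>}" for m
    by (auto simp: S_def R_def A_def \<psi>_def)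
  have A_borel: "A m k \<in> sets borel" for m k
  proof -
    note [measurable] = \<phi>(1)
    have "{\<theta> \<in> space borel. fl m \<theta> = k} \<in> sets borel" unfolding fl_def by measurable
    then have "D \<inter> {\<theta>. fl m \<theta> = k} \<in> sets borel" using D by simp
    then show ?thesis by (simp add: A_def Int_def)
  qed
  have R_borel: "R m k \<in> sets borel" for m k
    unfolding R_def borel_prod[symmetric] using A_borel by (intro pair_measureI) auto
  have S_borel: "S m \<in> sets borel" for m using R_borel by (auto simp: S_def)
  have floor_bounds: "2 ^ m * \<phi> \<theta> < of_int (fl m \<theta>) + 1" "of_int (fl m \<theta>) \<le> 2 ^ m * \<phi> \<theta>"
    for m \<theta> unfolding fl_def by linarith+
  have upper: "\<phi> \<theta> < \<psi> m \<theta>" for m \<theta>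
    using floor_bounds(1)[of m \<theta>] by (simp add: \<psi>_def field_simps)
  have lower: "\<psi> m \<theta> \<le> \<phi> \<theta> + (1 / 2) ^ m" for m \<theta>
    using floor_bounds(2)[of m \<theta>] by (simp add: \<psi>_def field_simps power_one_over)
  have le: "emeasure P (S m) \<le> emeasure Q (S m)" for m
    unfolding S_def
  proof (rule emeasure_le_by_pieces)
    fix k
    show "emeasure P (R m k) \<le> emeasure Q (R m k)"
    proof (cases "A m k = {}")
      case False
      then obtain \<theta> where "\<theta> \<in> D" "fl m \<theta> = k" by (auto simp: A_def)
      then have "K \<le> (of_int k + 1) / 2 ^ m"
        using \<phi>(2)[of \<theta>] upper[of \<theta> m] by (simp add: \<psi>_def)
      then show ?thesis unfolding R_def using A_borel by (intro rect) (auto simp: A_def)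
    qed (simp add: R_def)
  qed (use sets R_borel in \<open>auto simp: R_def A_def disjoint_family_on_def\<close>)
  have "incseq S"
  proof (rule incseq_SucI)
    fix m
    have "\<psi> (Suc m) \<theta> \<le> \<psi> m \<theta>" for \<theta>
    proof -
      have "2 ^ Suc m * \<phi> \<theta> < of_int (2 * (fl m \<theta> + 1))"
        using floor_bounds(1)[of m \<theta>] by simp
      then have "fl (Suc m) \<theta> < 2 * (fl m \<theta> + 1)"
        unfolding fl_def[of "Suc m"] by (simp only: floor_less_iff)
      then have "fl (Suc m) \<theta> + 1 \<le> 2 * (fl m \<theta> + 1)" by simp
      then have "of_int (fl (Suc m) \<theta> + 1) \<le> (of_int (2 * (fl m \<theta> + 1)) :: real)"
        by (simp only: of_int_le_iff)
      then have "(of_int (fl (Suc m) \<theta>) + 1) / (2 * 2 ^ m) \<le> (2 * (of_int (fl m \<theta>) + 1)) / (2 * 2 ^ m :: real)"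
        by (intro divide_right_mono) auto
      then show ?thesis unfolding \<psi>_def power_Suc
        by (subst (asm) mult_divide_mult_cancel_left) auto
    qed
    then show "S m \<le> S (Suc m)" by (auto simp: S_alt intro: le_less_trans)
  qed
  moreover have "(\<Union>m. S m) = {(\<theta>, z). \<theta> \<in> D \<and> z > \<phi> \<theta>}"
  proof -
    have "\<exists>m. z > \<psi> m \<theta>" if z: "z > \<phi> \<theta>" for \<theta> z
    proof -
      obtain m where "(1 / 2) ^ m < z - \<phi> \<theta>"
        using z real_arch_pow_inv[of "z - \<phi> \<theta>" "1 / 2"] by auto
      then show ?thesis using lower[of m \<theta>] by (intro exI[of _ m]) linarith
    qed
    then show ?thesis using less_trans[OF upper] by (auto simp: S_alt)
  qed
  moreover have "(SUP m. emeasure P (S m)) = emeasure P (\<Union>m. S m)"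
    "(SUP m. emeasure Q (S m)) = emeasure Q (\<Union>m. S m)"
    using \<open>incseq S\<close> S_borel sets by (auto intro!: SUP_emeasure_incseq)
  moreover have "(SUP m. emeasure P (S m)) \<le> (SUP m. emeasure Q (S m))"
    using le by (intro SUP_mono) auto
  ultimately show ?thesis by (simp only:)
qed

section \<open>Tails of products\<close>

text \<open>The tail G of a random variable, positive everywhere, and a finite measure \<open>\<kappa>\<close> of weights that
  charges the interval (0, B].\<close>

locale weighted_tail = finite_measure \<kappa> for \<kappa> :: "real measure" +
  fixes G :: "real \<Rightarrow> real" and B :: real
  assumes sets_\<kappa>: "sets \<kappa> = sets borel"
    and G_antimono: "antimono G" and G_le: "\<And>x. G x \<le> 1" and G_pos: "\<And>x. G x > 0"
    and B_pos: "B > 0" and \<kappa>_pos: "measure \<kappa> {0<..B} > 0"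
begin

lemma G_measurable [measurable]: "G \<in> borel_measurable borel"
proof -
  have "(\<lambda>x. - G x) \<in> borel_measurable borel"
    using G_antimono by (intro borel_measurable_mono) (auto simp: mono_def antimono_def)
  then have "(\<lambda>x. - (- G x)) \<in> borel_measurable borel" by (rule borel_measurable_uminus)
  then show ?thesis by simp
qed

lemma borel_measurable_\<kappa>: "f \<in> borel_measurable borel \<Longrightarrow> f \<in> borel_measurable \<kappa>"
  by (simp add: measurable_cong_sets[OF sets_\<kappa> refl])

text \<open>The contribution of the weights in A to the tail of the product. The convention x / 0 = 0 plays
  no role, as only sets A of positive weights occur.\<close>

definition part :: "real set \<Rightarrow> real \<Rightarrow> real" where
  "part A x = (\<integral>\<theta>. indicator A \<theta> * G (x / \<theta>) \<partial>\<kappa>)"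

abbreviation J :: "real \<Rightarrow> real" where
  "J \<equiv> part {0<..B}"

lemma part_integrable:
  assumes "A \<in> sets borel" "f \<in> borel_measurable borel"
  shows "integrable \<kappa> (\<lambda>\<theta>. indicator A \<theta> * G (f \<theta> * x))"
proof (rule integrable_const_bound[of _ 1])
  show "AE \<theta> in \<kappa>. norm (indicator A \<theta> * G (f \<theta> * x)) \<le> 1"
    using G_le G_pos by (auto split: split_indicator simp: abs_of_pos)
  show "(\<lambda>\<theta>. indicator A \<theta> * G (f \<theta> * x)) \<in> borel_measurable \<kappa>"
    using assms
    by (intro borel_measurable_\<kappa> borel_measurable_times borel_measurable_indicator
        measurable_compose[OF _ G_measurable] borel_measurable_const)
qed

lemma part_integrable' [simp]:
  assumes "A \<in> sets borel"
  shows "integrable \<kappa> (\<lambda>\<theta>. indicator A \<theta> * G (x / \<theta>))"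
  using part_integrable[OF assms, of "\<lambda>\<theta>. 1 / \<theta>" x] by simp

lemma part_mono:
  assumes "A \<in> sets borel" "\<And>\<theta>. \<theta> \<in> A \<Longrightarrow> G (x / \<theta>) \<le> c * G (y / \<theta>)"
  shows "part A x \<le> c * part A y"
proof -
  have "part A x \<le> (\<integral>\<theta>. c * (indicator A \<theta> * G (y / \<theta>)) \<partial>\<kappa>)"
    unfolding part_def using assms
    by (intro integral_mono integrable_mult_right part_integrable')
       (auto split: split_indicator)
  then show ?thesis by (simp add: part_def)
qed

lemma part_Un:
  assumes "A \<in> sets borel" "A' \<in> sets borel" "A \<inter> A' = {}"
  shows "part (A \<union> A') x = part A x + part A' x"
proof -
  have "part (A \<union> A') x = (\<integral>\<theta>. indicator A \<theta> * G (x / \<theta>) + indicator A' \<theta> * G (x / \<theta>) \<partial>\<kappa>)"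
    unfolding part_def using assms(3)
    by (intro Bochner_Integration.integral_cong) (auto split: split_indicator)
  also have "\<dots> = part A x + part A' x"
    unfolding part_def using assms by (intro Bochner_Integration.integral_add) auto
  finally show ?thesis .
qed

lemma part_le_subset:
  assumes "A \<in> sets borel" "A' \<in> sets borel" "A \<subseteq> A'"
  shows "part A x \<le> part A' x"
  unfolding part_def using assms G_pos
  by (intro integral_mono part_integrable') (auto split: split_indicator intro: less_imp_le)

lemma part_nonneg: "part A x \<ge> 0"
  unfolding part_def using G_pos
  by (intro integral_nonneg_AE) (auto split: split_indicator intro: less_imp_le)

lemma J_antimono: "x \<le> y \<Longrightarrow> J y \<le> J x"
  using part_mono[of "{0<..B}" y 1 x] G_antimono
  by (auto simp: antimono_def divide_right_mono)

lemma J_ge: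
  assumes "0 < c" "0 \<le> x"
  shows "G (x / c) * measure \<kappa> {c<..B} \<le> J x"
proof -
  have "G (x / c) * measure \<kappa> {c<..B} = (\<integral>\<theta>. indicator {c<..B} \<theta> * G (x / c) \<partial>\<kappa>)"
    using sets_\<kappa> by simp
  also have "\<dots> \<le> part {c<..B} x"
    unfolding part_def
  proof (intro integral_mono part_integrable')
    show "integrable \<kappa> (\<lambda>\<theta>. indicator {c<..B} \<theta> * G (x / c))"
      using part_integrable[of "{c<..B}" "\<lambda>_. 1 / c" x] by simp
    fix \<theta>
    have "G (x / c) \<le> G (x / \<theta>)" if "\<theta> > c"
      using that assms G_antimono by (auto simp: antimono_def frac_le)
    then show "indicator {c<..B} \<theta> * G (x / c) \<le> indicator {c<..B} \<theta> * G (x / \<theta>)"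
      by (auto split: split_indicator)
  qed auto
  also have "\<dots> \<le> J x" using assms by (intro part_le_subset) auto
  finally show ?thesis .
qed

lemma \<kappa>_pos_away_from_zero: obtains c where "0 < c" "c < B" "measure \<kappa> {c<..B} > 0"
proof -
  define f where "f n = {inverse (real (Suc n))<..B}" for n
  have "(\<lambda>n. measure \<kappa> (f n)) \<longlonglongrightarrow> measure \<kappa> (\<Union>n. f n)"
  proof (rule finite_Lim_measure_incseq)
    show "incseq f"
    proof (rule incseq_SucI)
      fix n
      have "inverse (real (Suc (Suc n))) \<le> inverse (real (Suc n))" by (intro le_imp_inverse_le) auto
      then show "f n \<le> f (Suc n)"
        unfolding f_def by (intro subsetI) (auto simp only: greaterThanAtMost_iff intro: le_less_trans)
    qed
  qed (auto simp: f_def sets_\<kappa>)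
  moreover have "(\<Union>n. f n) = {0<..B}"
  proof (intro equalityI subsetI)
    fix \<theta> assume "\<theta> \<in> {0<..B}"
    then show "\<theta> \<in> (\<Union>n. f n)" using reals_Archimedean[of \<theta>] by (auto simp: f_def)
  next
    fix \<theta> assume "\<theta> \<in> (\<Union>n. f n)"
    then obtain n where "inverse (real (Suc n)) < \<theta>" "\<theta> \<le> B" by (auto simp: f_def)
    moreover have "0 < inverse (real (Suc n))" by simp
    ultimately have "0 < \<theta>" by (metis less_trans)
    then show "\<theta> \<in> {0<..B}" using \<open>\<theta> \<le> B\<close> by simp
  qed
  ultimately have "\<forall>\<^sub>F n in sequentially. measure \<kappa> (f n) > 0"
    using \<kappa>_pos by (intro order_tendstoD(1)[of _ "measure \<kappa> {0<..B}"]) auto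
  then obtain n where n: "measure \<kappa> (f n) > 0" by (auto simp: eventually_sequentially)
  then have "f n \<noteq> {}" by auto
  then have "inverse (real (Suc n)) < B" by (auto simp: f_def)
  with n that[of "inverse (real (Suc n))"] show ?thesis by (auto simp: f_def)
qed

lemma J_pos: "J x > 0"
proof -
  obtain c where c: "0 < c" "c < B" "measure \<kappa> {c<..B} > 0" by (rule \<kappa>_pos_away_from_zero)
  have "0 < G (max x 0 / c) * measure \<kappa> {c<..B}" using c G_pos by simp
  also have "\<dots> \<le> J (max x 0)" using c by (intro J_ge) auto
  also have "\<dots> \<le> J x" by (intro J_antimono) auto
  finally show ?thesis .
qed

text \<open>Small weights contribute a negligible part, uniformly in the threshold: they cannot raise a
  tail above that of a weight bounded away from zero, and they have little mass.\<close>

lemma small_weights_negligible: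
  assumes "\<epsilon> > 0"
  obtains \<eta> where "0 < \<eta>" "\<eta> < B" "\<And>x. x \<ge> 0 \<Longrightarrow> part {0<..\<eta>} x \<le> \<epsilon> * J x"
proof -
  obtain c where c: "0 < c" "c < B" "measure \<kappa> {c<..B} > 0" by (rule \<kappa>_pos_away_from_zero)
  define f where "f n = {0<..inverse (real (Suc n))}" for n
  have "(\<lambda>n. measure \<kappa> (f n)) \<longlonglongrightarrow> measure \<kappa> (\<Inter>n. f n)"
  proof (rule finite_Lim_measure_decseq)
    show "decseq f"
    proof (rule decseq_SucI)
      fix n
      have "inverse (real (Suc (Suc n))) \<le> inverse (real (Suc n))" by (intro le_imp_inverse_le) auto
      then show "f (Suc n) \<le> f n"
        unfolding f_def by (intro subsetI) (auto simp only: greaterThanAtMost_iff intro: order_trans)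
    qed
  qed (auto simp: f_def sets_\<kappa>)
  moreover have "(\<Inter>n. f n) = {}"
  proof -
    have "\<exists>n. \<theta> \<notin> f n" for \<theta>
    proof (cases "\<theta> > 0")
      case True
      then show ?thesis using reals_Archimedean[of \<theta>] by (auto simp: f_def not_le)
    qed (auto simp: f_def)
    then show ?thesis by auto
  qed
  ultimately have "\<forall>\<^sub>F n in sequentially. measure \<kappa> (f n) < \<epsilon> * measure \<kappa> {c<..B}"
    using c assms by (intro order_tendstoD(2)[of _ 0]) auto
  moreover have "\<forall>\<^sub>F n in sequentially. inverse (real (Suc n)) < c"
    using LIMSEQ_inverse_real_of_nat c(1) by (rule order_tendstoD)
  ultimately have "\<forall>\<^sub>F n in sequentially. measure \<kappa> (f n) < \<epsilon> * measure \<kappa> {c<..B} \<and> inverse (real (Suc n)) < c"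
    by eventually_elim auto
  then obtain n where "measure \<kappa> (f n) < \<epsilon> * measure \<kappa> {c<..B}" "inverse (real (Suc n)) < c"
    by (auto simp: eventually_sequentially)
  then obtain \<eta> where \<eta>: "\<eta> > 0" "\<eta> < c" "measure \<kappa> {0<..\<eta>} < \<epsilon> * measure \<kappa> {c<..B}"
    using that[of "inverse (real (Suc n))"] by (auto simp: f_def)
  have "part {0<..\<eta>} x \<le> \<epsilon> * J x" if "x \<ge> 0" for x
  proof -
    have "part {0<..\<eta>} x \<le> (\<integral>\<theta>. indicator {0<..\<eta>} \<theta> * G (x / c) \<partial>\<kappa>)"
      unfolding part_def
    proof (intro integral_mono part_integrable')
      show "integrable \<kappa> (\<lambda>\<theta>. indicator {0<..\<eta>} \<theta> * G (x / c))"
        using part_integrable[of "{0<..\<eta>}" "\<lambda>_. 1 / c" x] by simp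
      fix \<theta>
      have "G (x / \<theta>) \<le> G (x / c)" if "0 < \<theta>" "\<theta> \<le> \<eta>"
        using that \<eta> \<open>x \<ge> 0\<close> G_antimono by (auto simp: antimono_def frac_le)
      then show "indicator {0<..\<eta>} \<theta> * G (x / \<theta>) \<le> indicator {0<..\<eta>} \<theta> * G (x / c)"
        by (auto split: split_indicator)
    qed auto
    also have "\<dots> = G (x / c) * measure \<kappa> {0<..\<eta>}" using sets_\<kappa> by simp
    also have "\<dots> \<le> G (x / c) * (\<epsilon> * measure \<kappa> {c<..B})"
      using \<eta> G_pos by (intro mult_left_mono) (auto intro: less_imp_le)
    also have "\<dots> \<le> \<epsilon> * J x" using J_ge[OF c(1) that] assms by (simp add: mult.left_commute)
    finally show ?thesis .
  qed
  with \<eta> c show ?thesis by (intro that[of \<eta>]) auto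
qed

lemma J_long_tailed:
  assumes long: "\<And>a. a > 0 \<Longrightarrow> ((\<lambda>x. G (x - a) / G x) \<longlongrightarrow> 1) at_top"
    and "a > 0" "\<epsilon> > 0"
  shows "\<forall>\<^sub>F x in at_top. J (x - a) \<le> (1 + \<epsilon>) * J x"
proof -
  define \<epsilon>1 where "\<epsilon>1 = \<epsilon> / (2 + \<epsilon>)"
  have \<epsilon>1: "0 < \<epsilon>1" "\<epsilon>1 < 1" "1 + \<epsilon>1 = (1 + \<epsilon>) * (1 - \<epsilon>1)"
    using \<open>\<epsilon> > 0\<close> by (auto simp: \<epsilon>1_def field_simps)
  obtain \<eta> where \<eta>: "0 < \<eta>" "\<eta> < B" "\<And>x. x \<ge> 0 \<Longrightarrow> part {0<..\<eta>} x \<le> \<epsilon>1 * J x"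
    using small_weights_negligible[OF \<epsilon>1(1)] by blast
  have "\<forall>\<^sub>F y in at_top. G (y - a / \<eta>) / G y < 1 + \<epsilon>1"
    using long[of "a / \<eta>"] \<eta> \<open>a > 0\<close> \<epsilon>1 by (intro order_tendstoD(2)) auto
  then obtain K where K: "\<And>y. y \<ge> K \<Longrightarrow> G (y - a / \<eta>) / G y < 1 + \<epsilon>1"
    by (auto simp: eventually_at_top_linorder)
  show ?thesis
    using eventually_ge_at_top[of a] eventually_ge_at_top[of "max K 0 * B"]
  proof eventually_elim
    case (elim x)
    have split: "J y = part {0<..\<eta>} y + part {\<eta><..B} y" for y
      using \<eta> by (subst part_Un[symmetric]) (auto simp: ivl_disj_un)
    have "part {\<eta><..B} (x - a) \<le> (1 + \<epsilon>1) * part {\<eta><..B} x"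
    proof (rule part_mono)
      fix \<theta> assume \<theta>: "\<theta> \<in> {\<eta><..B}"
      then have "\<theta> > 0" using \<eta> by auto
      have "max K 0 * \<theta> \<le> max K 0 * B" using \<theta> by (intro mult_left_mono) auto
      then have "max K 0 * \<theta> \<le> x" using elim(2) by linarith
      then have "max K 0 \<le> x / \<theta>" using \<open>\<theta> > 0\<close> by (simp only: pos_le_divide_eq)
      then have "G (x / \<theta> - a / \<eta>) / G (x / \<theta>) < 1 + \<epsilon>1" by (intro K) auto
      then have "G (x / \<theta> - a / \<eta>) \<le> (1 + \<epsilon>1) * G (x / \<theta>)"
        using G_pos[of "x / \<theta>"] by (simp add: pos_divide_less_eq)
      moreover have "a / \<theta> \<le> a / \<eta>" using \<theta> \<eta> \<open>a > 0\<close> by (intro divide_left_mono) auto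
      then have "G ((x - a) / \<theta>) \<le> G (x / \<theta> - a / \<eta>)"
        using G_antimono by (simp add: antimono_def diff_divide_distrib)
      ultimately show "G ((x - a) / \<theta>) \<le> (1 + \<epsilon>1) * G (x / \<theta>)" by linarith
    qed auto
    also have "\<dots> \<le> (1 + \<epsilon>1) * J x"
      using split[of x] part_nonneg[of "{0<..\<eta>}" x] \<epsilon>1 by (intro mult_left_mono) auto
    finally have "J (x - a) \<le> \<epsilon>1 * J (x - a) + (1 + \<epsilon>1) * J x"
      using split[of "x - a"] \<eta>(3)[of "x - a"] elim(1) by simp
    then have "(1 - \<epsilon>1) * J (x - a) \<le> (1 - \<epsilon>1) * ((1 + \<epsilon>) * J x)"
      using \<epsilon>1(3) by (simp add: algebra_simps)
    then show ?case using \<epsilon>1 by simp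
  qed
qed

lemma J_scale:
  assumes "\<forall>\<^sub>F x in at_top. G (v * x) \<le> c * G x"
  shows "\<forall>\<^sub>F x in at_top. J (v * x) \<le> c * J x"
proof -
  obtain K where K: "\<And>y. y \<ge> K \<Longrightarrow> G (v * y) \<le> c * G y"
    using assms by (auto simp: eventually_at_top_linorder)
  show ?thesis
    using eventually_ge_at_top[of "max K 0 * B"]
  proof eventually_elim
    case (elim x)
    show ?case
    proof (rule part_mono)
      fix \<theta> assume \<theta>: "\<theta> \<in> {0<..B}"
      have "max K 0 * \<theta> \<le> max K 0 * B" using \<theta> by (intro mult_left_mono) auto
      then have "max K 0 * \<theta> \<le> x" using elim by linarith
      then have "max K 0 \<le> x / \<theta>" using \<theta> by (subst pos_le_divide_eq) auto
      then show "G (v * x / \<theta>) \<le> c * G (x / \<theta>)" using K[of "x / \<theta>"] by simp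
    qed auto
  qed
qed

text \<open>Under dominated variation the tail of the product is at least of the order of the original
  tail at any fixed multiple of the argument.\<close>

lemma J_dominates:
  assumes dom: "\<And>v. 0 < v \<Longrightarrow> v < 1 \<Longrightarrow> \<exists>C. \<forall>\<^sub>F x in at_top. G (v * x) \<le> C * G x"
    and "s > 0"
  obtains C where "C > 0" "\<forall>\<^sub>F x in at_top. G (s * x) \<le> C * J x"
proof -
  obtain c where c: "0 < c" "c < B" "measure \<kappa> {c<..B} > 0" by (rule \<kappa>_pos_away_from_zero)
  define v where "v = min (1 / 2) (s * c)"
  have v: "0 < v" "v < 1" "v \<le> s * c" using c \<open>s > 0\<close> by (auto simp: v_def)
  obtain C where C: "\<forall>\<^sub>F x in at_top. G (v * x) \<le> C * G x" using dom v by blast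
  define C' where "C' = max C 1 / measure \<kappa> {c<..B}"
  have "filterlim (\<lambda>x. (1 / c) * x) at_top at_top"
    using c by (intro filterlim_tendsto_pos_mult_at_top[OF tendsto_const] filterlim_ident) auto
  from eventually_compose_filterlim[OF C this]
  have "\<forall>\<^sub>F x in at_top. G (s * x) \<le> C' * J x"
    using eventually_ge_at_top[of 0]
  proof eventually_elim
    case (elim x)
    have "v * (1 / c * x) \<le> s * x"
    proof -
      have "v * x \<le> s * c * x" using v elim by (intro mult_right_mono) auto
      then show ?thesis using c by (simp add: field_simps)
    qed
    then have "G (s * x) \<le> G (v * (1 / c * x))" using G_antimono by (simp add: antimono_def)
    also have "\<dots> \<le> C * G (x / c)" using elim by simp
    also have "\<dots> \<le> max C 1 * G (x / c)" using G_pos by (intro mult_right_mono) (auto intro: less_imp_le)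
    also have "\<dots> = C' * (G (x / c) * measure \<kappa> {c<..B})" using c by (simp add: C'_def)
    also have "\<dots> \<le> C' * J x" using c elim by (intro mult_left_mono J_ge) (auto simp: C'_def)
    finally show ?case .
  qed
  moreover have "C' > 0" using c by (simp add: C'_def)
  ultimately show ?thesis using that by blast
qed

lemma J_regularly_varying:
  assumes rv: "\<And>v. v > 0 \<Longrightarrow> ((\<lambda>x. G (v * x) / G x) \<longlongrightarrow> v powr (- \<alpha>)) at_top"
  shows "((\<lambda>x. J x / G x) \<longlongrightarrow> (\<integral>\<theta>. indicator {0<..B} \<theta> * \<theta> powr \<alpha> \<partial>\<kappa>)) at_top"
proof -
  define C where "C = (1 / B) powr (- \<alpha>) + 1"
  have bound: "\<forall>\<^sub>F x in at_top. G (1 / B * x) / G x < C"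
    using rv[of "1 / B"] B_pos by (intro order_tendstoD(2)) (auto simp: C_def)
  have "((\<lambda>x. \<integral>\<theta>. indicator {0<..B} \<theta> * (G (x / \<theta>) / G x) \<partial>\<kappa>)
      \<longlongrightarrow> (\<integral>\<theta>. indicator {0<..B} \<theta> * \<theta> powr \<alpha> \<partial>\<kappa>)) at_top"
  proof (rule integral_dominated_convergence_at_top[where w = "\<lambda>_. C"])
    show "AE \<theta> in \<kappa>. ((\<lambda>x. indicator {0<..B} \<theta> * (G (x / \<theta>) / G x))
        \<longlongrightarrow> indicator {0<..B} \<theta> * \<theta> powr \<alpha>) at_top"
    proof (rule AE_I2)
      fix \<theta> :: real
      have "((\<lambda>x. G (x / \<theta>) / G x) \<longlongrightarrow> \<theta> powr \<alpha>) at_top" if "\<theta> > 0"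
        using rv[of "1 / \<theta>"] that by (simp add: powr_divide powr_minus_divide)
      then show "((\<lambda>x. indicator {0<..B} \<theta> * (G (x / \<theta>) / G x))
          \<longlongrightarrow> indicator {0<..B} \<theta> * \<theta> powr \<alpha>) at_top"
        by (cases "\<theta> > 0") (auto split: split_indicator intro!: tendsto_mult_left)
    qed
    show "\<forall>\<^sub>F x in at_top. AE \<theta> in \<kappa>. norm (indicator {0<..B} \<theta> * (G (x / \<theta>) / G x)) \<le> C"
      using bound eventually_ge_at_top[of 0]
    proof eventually_elim
      case (elim x)
      have "G (x / \<theta>) / G x \<le> C" if "0 < \<theta>" "\<theta> \<le> B" for \<theta>
      proof -
        have "G (x / \<theta>) \<le> G (1 / B * x)"
          using that elim G_antimono by (auto simp: antimono_def frac_le)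
        then have "G (x / \<theta>) / G x \<le> G (1 / B * x) / G x"
          using G_pos by (intro divide_right_mono) (auto intro: less_imp_le)
        then show ?thesis using elim by linarith
      qed
      moreover have "C \<ge> 0" by (simp add: C_def)
      ultimately show ?case
        using G_pos by (intro AE_I2) (auto split: split_indicator simp: abs_of_pos)
    qed
    show "(\<lambda>\<theta>. indicator {0<..B} \<theta> * \<theta> powr \<alpha>) \<in> borel_measurable \<kappa>"
      by (intro borel_measurable_\<kappa>) measurable
    show "(\<lambda>\<theta>. indicator {0<..B} \<theta> * (G (x / \<theta>) / G x)) \<in> borel_measurable \<kappa>" for x
      by (intro borel_measurable_\<kappa>) measurable
  qed auto
  moreover have "J x / G x = (\<integral>\<theta>. indicator {0<..B} \<theta> * (G (x / \<theta>) / G x) \<partial>\<kappa>)" for x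
    by (simp add: part_def)
  ultimately show ?thesis by (simp only:)
qed

lemma power_moment_pos:
  assumes "\<alpha> > 0"
  shows "(\<integral>\<theta>. indicator {0<..B} \<theta> * \<theta> powr \<alpha> \<partial>\<kappa>) > 0"
proof -
  obtain c where c: "0 < c" "c < B" "measure \<kappa> {c<..B} > 0" by (rule \<kappa>_pos_away_from_zero)
  have "0 < c powr \<alpha> * measure \<kappa> {c<..B}" using c by simp
  also have "\<dots> = (\<integral>\<theta>. indicator {c<..B} \<theta> * c powr \<alpha> \<partial>\<kappa>)" using sets_\<kappa> by simp
  also have "\<dots> \<le> (\<integral>\<theta>. indicator {0<..B} \<theta> * \<theta> powr \<alpha> \<partial>\<kappa>)"
  proof (rule integral_mono)
    show "integrable \<kappa> (\<lambda>\<theta>. indicator {c<..B} \<theta> * c powr \<alpha>)"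
    proof (rule integrable_const_bound[of _ "c powr \<alpha>"])
      show "(\<lambda>\<theta>. indicator {c<..B} \<theta> * c powr \<alpha>) \<in> borel_measurable \<kappa>"
        by (intro borel_measurable_\<kappa>) measurable
    qed (auto split: split_indicator)
    show "integrable \<kappa> (\<lambda>\<theta>. indicator {0<..B} \<theta> * \<theta> powr \<alpha>)"
    proof (rule integrable_const_bound[of _ "B powr \<alpha>"])
      show "(\<lambda>\<theta>. indicator {0<..B} \<theta> * \<theta> powr \<alpha>) \<in> borel_measurable \<kappa>"
        by (intro borel_measurable_\<kappa>) measurable
    qed (use assms in \<open>auto split: split_indicator intro!: AE_I2 powr_mono2\<close>)
    show "indicator {c<..B} \<theta> * c powr \<alpha> \<le> indicator {0<..B} \<theta> * \<theta> powr \<alpha>" for \<theta>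
      using c assms by (auto split: split_indicator intro: powr_mono2)
  qed
  finally show ?thesis .
qed

end

section \<open>From conditional tails to product tails\<close>

lemma eventually_min_at_top:
  "eventually P min_at_top \<longleftrightarrow> (\<exists>K. \<forall>x\<ge>K. \<forall>y\<ge>K. P (x, y))"
  unfolding min_at_top_def eventually_filtercomap eventually_at_top_linorder
proof
  assume "\<exists>Q. (\<exists>K. \<forall>x\<ge>K. Q x) \<and> (\<forall>p. Q (case p of (x, y) \<Rightarrow> min x y) \<longrightarrow> P p)"
  then obtain Q K where "\<forall>x\<ge>K. Q x" and "\<forall>p. Q (case p of (x, y) \<Rightarrow> min x y) \<longrightarrow> P p" by blast
  then show "\<exists>K. \<forall>x\<ge>K. \<forall>y\<ge>K. P (x, y)" by (intro exI[of _ K]) auto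
next
  assume "\<exists>K. \<forall>x\<ge>K. \<forall>y\<ge>K. P (x, y)"
  then obtain K where "\<forall>x\<ge>K. \<forall>y\<ge>K. P (x, y)" by blast
  then show "\<exists>Q. (\<exists>K. \<forall>x\<ge>K. Q x) \<and> (\<forall>p. Q (case p of (x, y) \<Rightarrow> min x y) \<longrightarrow> P p)"
    by (intro exI[of _ "\<lambda>z. z \<ge> K"]) auto
qed

lemma tendsto_quotient_1I:
  fixes f g :: "real \<Rightarrow> real"
  assumes g: "\<And>x. g x > 0"
    and le: "\<And>c. c > 1 \<Longrightarrow> \<forall>\<^sub>F x in F. f x \<le> c * g x \<and> g x \<le> c * f x"
  shows "((\<lambda>x. f x / g x) \<longlongrightarrow> 1) F"
proof (rule tendstoI)
  fix e :: real assume "e > 0"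
  then have "1 + e / 2 > 1" by simp
  from le[OF this] show "\<forall>\<^sub>F x in F. dist (f x / g x) 1 < e"
  proof eventually_elim
    case (elim x)
    have "f x / g x \<le> 1 + e / 2" using elim g[of x] by (simp add: pos_divide_le_eq)
    moreover have "1 - e / 2 \<le> f x / g x"
    proof -
      have "1 \<le> (1 + e / 2) * (f x / g x)" using elim g[of x] by (simp add: pos_le_divide_eq)
      then have "f x / g x \<ge> 1 / (1 + e / 2)" using \<open>e > 0\<close> by (simp add: pos_divide_le_eq mult.commute)
      moreover have "(1 - e / 2) * (1 + e / 2) \<le> 1" using \<open>e > 0\<close> by (simp add: algebra_simps)
      then have "1 - e / 2 \<le> 1 / (1 + e / 2)" using \<open>e > 0\<close> by (simp add: pos_le_divide_eq)
      ultimately show ?thesis by linarith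
    qed
    ultimately show ?case using \<open>e > 0\<close> by (simp add: dist_real_def abs_less_iff)
  qed
qed

context prob_space
begin

lemma rv_support_borel:
  assumes T: "T \<in> borel_measurable M"
  shows "rv_support M T \<in> sets borel" and "AE \<omega> in M. T \<omega> \<in> rv_support M T"
proof -
  note [measurable] = T
  define I where "I = {r \<in> \<rat> \<times> \<rat>. prob {\<omega> \<in> space M. T \<omega> \<in> {fst r<..<snd r}} = 0}"
  have "countable (\<rat> \<times> \<rat> :: (real \<times> real) set)" using countable_rat by (intro countable_SIGMA)
  then have I: "countable I" by (rule countable_subset[rotated]) (auto simp: I_def)
  have "- rv_support M T = (\<Union>r\<in>I. {fst r<..<snd r})"
  proof (intro equalityI subsetI)
    fix \<theta> assume "\<theta> \<in> - rv_support M T"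
    then obtain \<delta> where \<delta>: "\<delta> > 0" "prob {\<omega> \<in> space M. T \<omega> \<in> {\<theta> - \<delta>..\<theta> + \<delta>}} = 0"
      by (auto simp: rv_support_def not_less measure_le_0_iff)
    obtain p q where pq: "p \<in> \<rat>" "\<theta> - \<delta> < p" "p < \<theta>" "q \<in> \<rat>" "\<theta> < q" "q < \<theta> + \<delta>"
      using Rats_dense_in_real[of "\<theta> - \<delta>" \<theta>] Rats_dense_in_real[of \<theta> "\<theta> + \<delta>"] \<delta>(1) by auto
    have "prob {\<omega> \<in> space M. T \<omega> \<in> {p<..<q}} \<le> prob {\<omega> \<in> space M. T \<omega> \<in> {\<theta> - \<delta>..\<theta> + \<delta>}}"
      using pq by (intro finite_measure_mono) auto
    then have "(p, q) \<in> I" using \<delta> pq by (simp add: I_def measure_le_0_iff)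
    then show "\<theta> \<in> (\<Union>r\<in>I. {fst r<..<snd r})" using pq by (intro UN_I[of "(p, q)"]) auto
  next
    fix \<theta> assume "\<theta> \<in> (\<Union>r\<in>I. {fst r<..<snd r})"
    then obtain p q where pq: "(p, q) \<in> I" "p < \<theta>" "\<theta> < q" by auto
    define \<delta> where "\<delta> = min (\<theta> - p) (q - \<theta>) / 2"
    have \<delta>: "\<delta> > 0" "p < \<theta> - \<delta>" "\<theta> + \<delta> < q" using pq by (auto simp: \<delta>_def min_def field_simps)
    have "prob {\<omega> \<in> space M. T \<omega> \<in> {\<theta> - \<delta>..\<theta> + \<delta>}} \<le> prob {\<omega> \<in> space M. T \<omega> \<in> {p<..<q}}"
      using \<delta> by (intro finite_measure_mono) auto
    then have "\<not> prob {\<omega> \<in> space M. T \<omega> \<in> {\<theta> - \<delta>..\<theta> + \<delta>}} > 0" using pq(1) by (simp add: I_def)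
    then show "\<theta> \<in> - rv_support M T" using \<delta>(1) unfolding rv_support_def by blast
  qed
  then have compl: "rv_support M T = - (\<Union>r\<in>I. {fst r<..<snd r})" by blast
  show "rv_support M T \<in> sets borel"
    unfolding compl using I by (intro borel_comp sets.countable_UN') auto
  have "AE \<omega> in M. \<forall>r\<in>I. \<not> T \<omega> \<in> {fst r<..<snd r}"
  proof (subst AE_ball_countable[OF I], rule ballI)
    fix r assume "r \<in> I"
    then have "prob {\<omega> \<in> space M. T \<omega> \<in> {fst r<..<snd r}} = 0" by (simp add: I_def)
    then show "AE \<omega> in M. \<not> T \<omega> \<in> {fst r<..<snd r}" by (subst (asm) prob_eq_0) auto
  qed
  then show "AE \<omega> in M. T \<omega> \<in> rv_support M T" unfolding compl by eventually_elim auto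
qed

text \<open>The density h, set to zero off the support of T and off (0, B]. On the support h is a limit of
  window quotients, and so this truncation is Borel (\<open>tilt_measurable\<close>) although h need not be.\<close>

definition tilt :: "('a \<Rightarrow> real) \<Rightarrow> (real \<Rightarrow> real) \<Rightarrow> real \<Rightarrow> real \<Rightarrow> real" where
  "tilt T h B \<theta> = (if \<theta> \<in> rv_support M T \<inter> {0<..B} then h \<theta> else 0)"

text \<open>The law of T with density h on (0, B].\<close>

definition tilted :: "('a \<Rightarrow> real) \<Rightarrow> (real \<Rightarrow> real) \<Rightarrow> real \<Rightarrow> real measure" where
  "tilted T h B = density (distr M borel T) (\<lambda>\<theta>. ennreal (tilt T h B \<theta>))"

text \<open>The law of T on the event that X exceeds x, as a measure of total mass P(X > x).\<close>

definition slice :: "('a \<Rightarrow> real) \<Rightarrow> ('a \<Rightarrow> real) \<Rightarrow> real \<Rightarrow> real measure" where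
  "slice X T x = distr (density M (indicator {\<omega> \<in> space M. X \<omega> > x})) borel T"

context
  fixes X T :: "'a \<Rightarrow> real" and h :: "real \<Rightarrow> real" and B :: real
  assumes X: "X \<in> borel_measurable M" and T: "T \<in> borel_measurable M"
    and h: "\<And>\<theta>. \<theta> \<ge> 0 \<Longrightarrow> h \<theta> > 0"
    and X_pos: "\<And>x. prob {\<omega> \<in> space M. X \<omega> > x} > 0"
    and ex: "\<forall>\<^sub>F x in at_top. \<forall>\<theta>\<in>rv_support M T. has_cond_prob1 M (\<lambda>\<omega>. X \<omega> > x) T \<theta>"
    and unif: "uniformly_equiv (rv_support M T) at_top
        (\<lambda>x \<theta>. cond_prob1 M (\<lambda>\<omega>. X \<omega> > x) T \<theta>)
        (\<lambda>x \<theta>. h \<theta> * prob {\<omega> \<in> space M. X \<omega> > x})"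
begin

lemma emeasure_slice:
  assumes "A \<in> sets borel"
  shows "emeasure (slice X T x) A = emeasure M {\<omega> \<in> space M. X \<omega> > x \<and> T \<omega> \<in> A}"
proof -
  note [measurable] = X T assms
  have "emeasure (slice X T x) A = emeasure (density M (indicator {\<omega> \<in> space M. X \<omega> > x})) (T -` A \<inter> space M)"
    unfolding slice_def by (subst emeasure_distr) auto
  also have "\<dots> = emeasure M ({\<omega> \<in> space M. X \<omega> > x} \<inter> (T -` A \<inter> space M))"
    by (intro emeasure_restricted) auto
  also have "{\<omega> \<in> space M. X \<omega> > x} \<inter> (T -` A \<inter> space M) = {\<omega> \<in> space M. X \<omega> > x \<and> T \<omega> \<in> A}"
    by auto
  finally show ?thesis .
qed

lemma measure_slice:
  "A \<in> sets borel \<Longrightarrow> measure (slice X T x) A = prob {\<omega> \<in> space M. X \<omega> > x \<and> T \<omega> \<in> A}"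
  by (simp add: measure_def emeasure_slice)

lemma finite_slice: "finite_measure (slice X T x)"
  by (rule finite_measureI) (simp add: emeasure_slice slice_def[THEN arg_cong[of _ _ space]])

lemma sets_slice: "sets (slice X T x) = sets borel" by (simp add: slice_def)

lemma window_slice:
  "window_prob1 M (\<lambda>\<omega>. X \<omega> > x) T \<theta> \<delta> =
    measure (slice X T x) {\<theta> - \<delta>..\<theta> + \<delta>} / measure (distr M borel T) {\<theta> - \<delta>..\<theta> + \<delta>}"
proof -
  have "T -` {\<theta> - \<delta>..\<theta> + \<delta>} \<inter> space M = {\<omega> \<in> space M. T \<omega> \<in> {\<theta> - \<delta>..\<theta> + \<delta>}}" by auto
  then show ?thesis
    unfolding window_prob1_def cond_prob_def using T
    by (simp add: measure_slice measure_distr del: atLeastAtMost_iff)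
qed

lemma window_tendsto_cond_prob:
  assumes "has_cond_prob1 M A T \<theta>"
  shows "(window_prob1 M A T \<theta> \<longlongrightarrow> cond_prob1 M A T \<theta>) (at_right 0)"
  using assms tendsto_Lim[of "at_right (0::real)"]
  unfolding has_cond_prob1_def cond_prob1_def by auto

lemma support_window_pos:
  assumes "\<theta> \<in> rv_support M T" "\<delta> > 0"
  shows "measure (distr M borel T) {\<theta> - \<delta>..\<theta> + \<delta>} > 0"
proof -
  have "T -` {\<theta> - \<delta>..\<theta> + \<delta>} \<inter> space M = {\<omega> \<in> space M. T \<omega> \<in> {\<theta> - \<delta>..\<theta> + \<delta>}}" by auto
  then show ?thesis
    using assms T by (simp add: rv_support_def measure_distr del: atLeastAtMost_iff)
qed

lemma tilt_measurable: "tilt T h B \<in> borel_measurable borel"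
proof -
  let ?G = "\<lambda>x. prob {\<omega> \<in> space M. X \<omega> > x}"
  let ?s = "rv_support M T"
  note [measurable] = rv_support_borel(1)[OF T]
  obtain K where K: "\<And>x \<theta>. x \<ge> K \<Longrightarrow> \<theta> \<in> ?s \<Longrightarrow> has_cond_prob1 M (\<lambda>\<omega>. X \<omega> > x) T \<theta>"
    using ex by (auto simp: eventually_at_top_linorder)
  define d where "d m = inverse (real (Suc m))" for m
  have d: "filterlim d (at_right 0) sequentially"
    using LIMSEQ_inverse_real_of_nat unfolding d_def[abs_def]
    by (intro tendsto_imp_filterlim_at_right always_eventually) auto
  define C where "C x \<theta> = indicator ?s \<theta> * cond_prob1 M (\<lambda>\<omega>. X \<omega> > x) T \<theta>" for x \<theta>
  have C: "C x \<in> borel_measurable borel" if "x \<ge> K" for x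
  proof (rule borel_measurable_LIMSEQ_real)
    fix \<theta> :: real
    show "(\<lambda>m. indicator ?s \<theta> * window_prob1 M (\<lambda>\<omega>. X \<omega> > x) T \<theta> (d m)) \<longlonglongrightarrow> C x \<theta>"
    proof (cases "\<theta> \<in> ?s")
      case True
      from filterlim_compose[OF window_tendsto_cond_prob[OF K[OF that True]] d]
      show ?thesis using True by (simp add: C_def)
    qed (simp add: C_def)
  next
    fix m
    interpret \<mu>: prob_space "distr M borel T" by (rule prob_space_distr) (rule T)
    have [measurable]: "(\<lambda>\<theta>. measure (slice X T x) {\<theta> - d m..\<theta> + d m}) \<in> borel_measurable borel"
      "(\<lambda>\<theta>. measure (distr M borel T) {\<theta> - d m..\<theta> + d m}) \<in> borel_measurable borel"
      by (auto intro!: borel_measurable_window finite_slice sets_slice \<mu>.finite_measure_axioms)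
    show "(\<lambda>\<theta>. indicator ?s \<theta> * window_prob1 M (\<lambda>\<omega>. X \<omega> > x) T \<theta> (d m)) \<in> borel_measurable borel"
      unfolding window_slice by measurable
  qed
  have "(\<lambda>\<theta>. indicator ?s \<theta> * h \<theta> * indicator {0<..B} \<theta>) \<in> borel_measurable borel"
  proof (rule borel_measurable_LIMSEQ_real)
    fix k
    have [measurable]: "C (max K (real k)) \<in> borel_measurable borel" by (rule C) simp
    show "(\<lambda>\<theta>. C (max K (real k)) \<theta> / ?G (max K (real k)) * indicator {0<..B} \<theta>) \<in> borel_measurable borel"
      by measurable
  next
    fix \<theta> :: real
    show "(\<lambda>k. C (max K (real k)) \<theta> / ?G (max K (real k)) * indicator {0<..B} \<theta>)
        \<longlonglongrightarrow> indicator ?s \<theta> * h \<theta> * indicator {0<..B} \<theta>"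
    proof (cases "\<theta> \<in> ?s \<and> \<theta> > 0")
      case True
      have lim: "filterlim (\<lambda>k. max K (real k)) at_top sequentially"
        by (rule filterlim_at_top_mono[OF filterlim_real_sequentially]) (auto intro: always_eventually)
      have "((\<lambda>x. cond_prob1 M (\<lambda>\<omega>. X \<omega> > x) T \<theta> / (h \<theta> * ?G x)) \<longlongrightarrow> 1) at_top"
        using tendsto_uniform_limitI[OF unif[unfolded uniformly_equiv_def]] True by auto
      from tendsto_mult_left[OF filterlim_compose[OF this lim], of "h \<theta>"]
      have "(\<lambda>k. C (max K (real k)) \<theta> / ?G (max K (real k))) \<longlonglongrightarrow> h \<theta>"
        using True h[of \<theta>] by (simp add: C_def)
      from tendsto_mult_right[OF this] show ?thesis using True by simp
    qed (auto simp: C_def split: split_indicator)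
  qed
  also have "(\<lambda>\<theta>. indicator ?s \<theta> * h \<theta> * indicator {0<..B} \<theta>) = tilt T h B"
    by (auto simp: tilt_def split: split_indicator)
  finally show ?thesis .
qed

lemma tilted_scale:
  assumes "A \<in> sets borel" "k \<ge> 0"
  shows "emeasure (density (distr M borel T) (\<lambda>\<theta>. ennreal (k * tilt T h B \<theta>))) A = ennreal k * emeasure (tilted T h B) A"
proof -
  note [measurable] = tilt_measurable assms(1)
  have "tilt T h B \<theta> \<ge> 0" for \<theta> using h[of \<theta>] by (auto simp: tilt_def)
  then show ?thesis
    unfolding tilted_def using assms(2)
    by (simp add: emeasure_density ennreal_mult mult.assoc nn_integral_cmult)
qed

text \<open>Differentiation at every point of the support turns the asymptotics of the conditional tails
  into bounds that are uniform over all Borel sets A of weights.\<close>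

lemma tilted_bounds:
  assumes "c > 1"
  shows "\<exists>K. \<forall>x\<ge>K. \<forall>A\<in>sets borel. A \<subseteq> {0<..B} \<longrightarrow>
    emeasure M {\<omega> \<in> space M. X \<omega> > x \<and> T \<omega> \<in> A}
      \<le> ennreal c * (ennreal (prob {\<omega> \<in> space M. X \<omega> > x}) * emeasure (tilted T h B) A) \<and>
    ennreal (prob {\<omega> \<in> space M. X \<omega> > x}) * emeasure (tilted T h B) A
      \<le> ennreal c * emeasure M {\<omega> \<in> space M. X \<omega> > x \<and> T \<omega> \<in> A}"
proof -
  let ?G = "\<lambda>x. prob {\<omega> \<in> space M. X \<omega> > x}"
  let ?s = "rv_support M T"
  note [measurable] = rv_support_borel(1)[OF T] X T
  interpret \<mu>: prob_space "distr M borel T" by (rule prob_space_distr) (rule T)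
  \<comment> \<open>one factor r for the conditional tails, another one for passing from windows to sets\<close>
  define r where "r = sqrt c"
  have r: "r > 1" "r * r = c" using assms by (auto simp: r_def)
  define e where "e = min (r - 1) (1 - 1 / r)"
  have e: "e > 0" "1 + e \<le> r" "1 / r \<le> 1 - e" using r by (auto simp: e_def)
  have "\<forall>\<^sub>F x in at_top. \<forall>\<theta>\<in>?s. dist (cond_prob1 M (\<lambda>\<omega>. X \<omega> > x) T \<theta> / (h \<theta> * ?G x)) 1 < e"
    using uniform_limitD[OF unif[unfolded uniformly_equiv_def] e(1)] .
  with ex have "\<forall>\<^sub>F x in at_top. (\<forall>\<theta>\<in>?s. has_cond_prob1 M (\<lambda>\<omega>. X \<omega> > x) T \<theta>) \<and>
      (\<forall>\<theta>\<in>?s. dist (cond_prob1 M (\<lambda>\<omega>. X \<omega> > x) T \<theta> / (h \<theta> * ?G x)) 1 < e)"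
    by (rule eventually_conj)
  then obtain K where K: "\<And>x \<theta>. x \<ge> K \<Longrightarrow> \<theta> \<in> ?s \<Longrightarrow> has_cond_prob1 M (\<lambda>\<omega>. X \<omega> > x) T \<theta>"
    "\<And>x \<theta>. x \<ge> K \<Longrightarrow> \<theta> \<in> ?s \<Longrightarrow> dist (cond_prob1 M (\<lambda>\<omega>. X \<omega> > x) T \<theta> / (h \<theta> * ?G x)) 1 < e"
    unfolding eventually_at_top_linorder by blast
  define E where "E = ?s \<inter> {0<..B}"
  have E: "E \<in> sets borel" "bounded E"
    by (auto simp: E_def intro: bounded_subset[OF bounded_closed_interval[of 0 B]])
  have window: "\<forall>\<^sub>F \<delta> in at_right 0.
      measure (slice X T x) {\<theta> - \<delta>..\<theta> + \<delta>}
        \<le> (r * ?G x) * tilt T h B \<theta> * measure (distr M borel T) {\<theta> - \<delta>..\<theta> + \<delta>} \<and>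
      (?G x / r) * tilt T h B \<theta> * measure (distr M borel T) {\<theta> - \<delta>..\<theta> + \<delta>}
        \<le> measure (slice X T x) {\<theta> - \<delta>..\<theta> + \<delta>}"
    if "x \<ge> K" "\<theta> \<in> E" for x \<theta>
  proof -
    let ?q = "cond_prob1 M (\<lambda>\<omega>. X \<omega> > x) T \<theta>"
    have \<theta>: "\<theta> \<in> ?s" "h \<theta> > 0" "tilt T h B \<theta> = h \<theta>" using that h[of \<theta>] by (auto simp: E_def tilt_def)
    have G: "?G x > 0" by (rule X_pos)
    have "\<bar>?q / (h \<theta> * ?G x) - 1\<bar> < e" using K(2)[OF that(1) \<theta>(1)] by (simp add: dist_real_def)
    then have "?q / (h \<theta> * ?G x) < r" "1 / r < ?q / (h \<theta> * ?G x)" using e by linarith+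
    then have q: "?q < r * (h \<theta> * ?G x)" "1 / r * (h \<theta> * ?G x) < ?q"
      using G \<theta>(2) by (simp_all only: pos_divide_less_eq pos_less_divide_eq mult_pos_pos)
    note lim = window_tendsto_cond_prob[OF K(1)[OF that(1) \<theta>(1)]]
    show ?thesis
      using order_tendstoD(2)[OF lim q(1)] order_tendstoD(1)[OF lim q(2)] eventually_at_right_less[of 0]
    proof eventually_elim
      case (elim \<delta>)
      have "measure (distr M borel T) {\<theta> - \<delta>..\<theta> + \<delta>} > 0"
        using support_window_pos[OF \<theta>(1)] elim by simp
      then show ?case
        using elim(1,2) \<theta>(3) unfolding window_slice
        by (simp add: pos_divide_less_eq pos_less_divide_eq mult_ac)
    qed
  qed
  note windows = eventually_conj_iff[THEN iffD1, OF window, THEN conjunct1]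
    eventually_conj_iff[THEN iffD1, OF window, THEN conjunct2]
  have tilt_pos: "tilt T h B \<theta> > 0" if "\<theta> \<in> E" for \<theta> using that h[of \<theta>] by (auto simp: E_def tilt_def)
  show ?thesis
  proof (intro exI[of _ K] allI impI ballI)
    fix x A assume x: "x \<ge> K" and A: "A \<in> sets borel" "A \<subseteq> {0<..B}"
    note [measurable] = A(1)
    have G: "?G x > 0" by (rule X_pos)
    have "emeasure M {\<omega> \<in> space M. X \<omega> > x \<and> T \<omega> \<in> A} = emeasure M {\<omega> \<in> space M. X \<omega> > x \<and> T \<omega> \<in> A \<inter> E}"
    proof (rule emeasure_eq_AE)
      show "AE \<omega> in M. (\<omega> \<in> {\<omega> \<in> space M. X \<omega> > x \<and> T \<omega> \<in> A}) =
          (\<omega> \<in> {\<omega> \<in> space M. X \<omega> > x \<and> T \<omega> \<in> A \<inter> E})"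
        using rv_support_borel(2)[OF T] by eventually_elim (use A in \<open>auto simp: E_def\<close>)
    qed (use E(1) in measurable)
    then have slice_eq: "emeasure M {\<omega> \<in> space M. X \<omega> > x \<and> T \<omega> \<in> A} = emeasure (slice X T x) (A \<inter> E)"
      using E A by (simp add: emeasure_slice)
    have tilted_eq: "emeasure (tilted T h B) A = emeasure (tilted T h B) (A \<inter> E)"
    proof -
      have "ennreal (tilt T h B \<theta>) * indicator A \<theta> = ennreal (tilt T h B \<theta>) * indicator (A \<inter> E) \<theta>" for \<theta>
        by (auto simp: tilt_def E_def split: split_indicator)
      then show ?thesis
        unfolding tilted_def using tilt_measurable E A by (simp add: emeasure_density)
    qed
    have AE': "A \<inter> E \<in> sets borel" "A \<inter> E \<subseteq> E" using A E by auto
    have meas: "(\<lambda>\<theta>. k * tilt T h B \<theta>) \<in> borel_measurable borel" for k :: real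
      using tilt_measurable by measurable
    have "emeasure (slice X T x) (A \<inter> E) \<le>
        ennreal r * emeasure (density (distr M borel T) (\<lambda>\<theta>. ennreal (r * ?G x * tilt T h B \<theta>))) (A \<inter> E)"
      using r(1) G tilt_pos windows[OF x] E AE' meas
      by (intro measure_le_density_of_windows[where E = E and \<nu> = "slice X T x"] finite_slice
          sets_slice \<mu>.finite_measure_axioms) auto
    also have "\<dots> = ennreal c * (ennreal (?G x) * emeasure (tilted T h B) (A \<inter> E))"
      using r G by (subst tilted_scale[OF AE'(1)]) (simp_all add: ennreal_mult mult.assoc flip: r(2))
    finally have upper: "emeasure (slice X T x) (A \<inter> E) \<le> ennreal c * (ennreal (?G x) * emeasure (tilted T h B) (A \<inter> E))" .
    have "emeasure (density (distr M borel T) (\<lambda>\<theta>. ennreal (?G x / r * tilt T h B \<theta>))) (A \<inter> E)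
        \<le> ennreal r * emeasure (slice X T x) (A \<inter> E)"
      using r(1) G tilt_pos windows[OF x] E AE' meas
      by (intro density_le_measure_of_windows[where E = E and \<nu> = "slice X T x"] finite_slice
          sets_slice \<mu>.finite_measure_axioms) auto
    then have "ennreal (?G x / r) * emeasure (tilted T h B) (A \<inter> E) \<le> ennreal r * emeasure (slice X T x) (A \<inter> E)"
      using r G by (subst (asm) tilted_scale[OF AE'(1)]) auto
    then have "ennreal r * (ennreal (?G x / r) * emeasure (tilted T h B) (A \<inter> E))
        \<le> ennreal r * (ennreal r * emeasure (slice X T x) (A \<inter> E))"
      by (intro mult_left_mono) auto
    then have "ennreal (?G x) * emeasure (tilted T h B) (A \<inter> E) \<le> ennreal c * emeasure (slice X T x) (A \<inter> E)"
      using r(1) G by (simp flip: mult.assoc r(2) ennreal_mult)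
    with upper show "emeasure M {\<omega> \<in> space M. X \<omega> > x \<and> T \<omega> \<in> A}
      \<le> ennreal c * (ennreal (?G x) * emeasure (tilted T h B) A) \<and>
    ennreal (?G x) * emeasure (tilted T h B) A \<le> ennreal c * emeasure M {\<omega> \<in> space M. X \<omega> > x \<and> T \<omega> \<in> A}"
      unfolding slice_eq tilted_eq by blast
  qed
qed

end

end

context prob_space
begin

text \<open>The lower bound at a single level already shows that the tilted law is finite; no
  integrability of h is needed.\<close>

lemma weighted_tail_tilted:
  fixes X T :: "'a \<Rightarrow> real"
  assumes X: "X \<in> borel_measurable M" and T: "T \<in> borel_measurable M"
    and h: "\<And>\<theta>. \<theta> \<ge> 0 \<Longrightarrow> h \<theta> > 0"
    and X_pos: "\<And>x. prob {\<omega> \<in> space M. X \<omega> > x} > 0"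
    and meas: "tilt T h B \<in> borel_measurable borel"
    and bounds: "\<exists>c K. \<forall>x\<ge>K. \<forall>A\<in>sets borel. A \<subseteq> {0<..B} \<longrightarrow>
      ennreal (prob {\<omega> \<in> space M. X \<omega> > x}) * emeasure (tilted T h B) A
        \<le> ennreal c * emeasure M {\<omega> \<in> space M. X \<omega> > x \<and> T \<omega> \<in> A}"
    and B: "B > 0" "AE \<omega> in M. 0 \<le> T \<omega> \<and> T \<omega> \<le> B" and T_nz: "\<not> (AE \<omega> in M. T \<omega> = 0)"
  shows "weighted_tail (tilted T h B) (\<lambda>x. prob {\<omega> \<in> space M. X \<omega> > x}) B"
proof -
  note [measurable] = X T meas
  let ?G = "\<lambda>x. prob {\<omega> \<in> space M. X \<omega> > x}"
  let ?K = "tilted T h B"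
  have sets: "sets ?K = sets borel" by (simp add: tilted_def)
  have space: "space ?K = UNIV" by (simp add: tilted_def)
  obtain c K where cK: "\<And>x A. x \<ge> K \<Longrightarrow> A \<in> sets borel \<Longrightarrow> A \<subseteq> {0<..B} \<Longrightarrow>
      ennreal (?G x) * emeasure ?K A \<le> ennreal c * emeasure M {\<omega> \<in> space M. X \<omega> > x \<and> T \<omega> \<in> A}"
    using bounds by blast
  have density_alt: "emeasure ?K A = (\<integral>\<^sup>+\<theta>. ennreal (tilt T h B \<theta>) * indicator A \<theta> \<partial>distr M borel T)"
    if "A \<in> sets borel" for A
    using that by (simp add: tilted_def emeasure_density)
  have UNIV_eq: "emeasure ?K UNIV = emeasure ?K {0<..B}"
  proof -
    have "ennreal (tilt T h B \<theta>) * indicator UNIV \<theta> = ennreal (tilt T h B \<theta>) * indicator {0<..B} \<theta>" for \<theta>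
      by (auto simp: tilt_def split: split_indicator)
    moreover have "emeasure ?K UNIV = (\<integral>\<^sup>+\<theta>. ennreal (tilt T h B \<theta>) * indicator UNIV \<theta> \<partial>distr M borel T)"
      by (rule density_alt) simp
    moreover have "emeasure ?K {0<..B} = (\<integral>\<^sup>+\<theta>. ennreal (tilt T h B \<theta>) * indicator {0<..B} \<theta> \<partial>distr M borel T)"
      by (rule density_alt) simp
    ultimately show ?thesis by (simp only:)
  qed
  have "ennreal (?G K) * emeasure ?K {0<..B} < \<infinity>"
  proof -
    have "ennreal (?G K) * emeasure ?K {0<..B}
        \<le> ennreal c * emeasure M {\<omega> \<in> space M. X \<omega> > K \<and> T \<omega> \<in> {0<..B}}"
      by (rule cK) auto
    also have "\<dots> < \<infinity>" by (simp add: emeasure_eq_measure ennreal_mult_less_top)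
    finally show ?thesis .
  qed
  then have finite: "emeasure ?K {0<..B} < \<infinity>"
    using X_pos[of K] by (auto simp: ennreal_mult_less_top)
  have pos: "emeasure ?K {0<..B} \<noteq> 0"
  proof
    assume "emeasure ?K {0<..B} = 0"
    then have "AE \<theta> in distr M borel T. ennreal (tilt T h B \<theta>) * indicator {0<..B} \<theta> = 0"
      by (subst (asm) density_alt) (auto simp: nn_integral_0_iff_AE)
    then have "AE \<omega> in M. ennreal (tilt T h B (T \<omega>)) * indicator {0<..B} (T \<omega>) = 0"
      by (subst (asm) AE_distr_iff) auto
    with B(2) rv_support_borel(2)[OF T] have "AE \<omega> in M. T \<omega> = 0"
    proof eventually_elim
      case (elim \<omega>)
      show ?case
      proof (rule ccontr)
        assume "T \<omega> \<noteq> 0"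
        then have "T \<omega> \<in> {0<..B}" "tilt T h B (T \<omega>) = h (T \<omega>)" using elim by (auto simp: tilt_def)
        then show False using elim(3) h[of "T \<omega>"] by auto
      qed
    qed
    with T_nz show False by blast
  qed
  interpret F: finite_measure ?K
    using finite by (intro finite_measureI) (simp add: space UNIV_eq)
  show ?thesis
  proof
    show "antimono ?G"
      by (intro antimonoI finite_measure_mono) auto
    show "measure ?K {0<..B} > 0"
      using pos by (simp add: F.emeasure_eq_measure zero_less_measure_iff)
  qed (use X_pos B sets in auto)
qed

lemma integral_tilted:
  fixes T :: "'a \<Rightarrow> real"
  assumes T: "T \<in> borel_measurable M" and h: "\<And>\<theta>. \<theta> \<ge> 0 \<Longrightarrow> h \<theta> > 0"
    and meas: "tilt T h B \<in> borel_measurable borel"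
    and B: "AE \<omega> in M. 0 \<le> T \<omega> \<and> T \<omega> \<le> B"
    and hT: "(\<lambda>\<omega>. T \<omega> powr \<alpha> * h (T \<omega>)) \<in> borel_measurable M"
  shows "(\<integral>\<theta>. indicator {0<..B} \<theta> * \<theta> powr \<alpha> \<partial>tilted T h B) = expectation (\<lambda>\<omega>. T \<omega> powr \<alpha> * h (T \<omega>))"
proof -
  note [measurable] = T meas hT
  have "tilt T h B \<theta> \<ge> 0" for \<theta> using h[of \<theta>] by (auto simp: tilt_def)
  then have "(\<integral>\<theta>. indicator {0<..B} \<theta> * \<theta> powr \<alpha> \<partial>tilted T h B) =
      (\<integral>\<theta>. tilt T h B \<theta> * (indicator {0<..B} \<theta> * \<theta> powr \<alpha>) \<partial>distr M borel T)"
    unfolding tilted_def by (subst integral_density) auto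
  also have "\<dots> = expectation (\<lambda>\<omega>. tilt T h B (T \<omega>) * (indicator {0<..B} (T \<omega>) * T \<omega> powr \<alpha>))"
    by (subst integral_distr) auto
  also have "\<dots> = expectation (\<lambda>\<omega>. T \<omega> powr \<alpha> * h (T \<omega>))"
  proof (rule integral_cong_AE)
    show "AE \<omega> in M. tilt T h B (T \<omega>) * (indicator {0<..B} (T \<omega>) * T \<omega> powr \<alpha>) = T \<omega> powr \<alpha> * h (T \<omega>)"
      using B rv_support_borel(2)[OF T]
    proof eventually_elim
      case (elim \<omega>)
      then show ?case by (cases "T \<omega> = 0") (auto simp: tilt_def)
    qed
  qed measurable
  finally show ?thesis .
qed

lemma product_tail_equiv:
  fixes X T :: "'a \<Rightarrow> real" and \<kappa> :: "real measure"
  assumes X: "X \<in> borel_measurable M" and T: "T \<in> borel_measurable M"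
    and wt: "weighted_tail \<kappa> (\<lambda>x. prob {\<omega> \<in> space M. X \<omega> > x}) B"
    and B: "AE \<omega> in M. 0 \<le> T \<omega> \<and> T \<omega> \<le> B"
    and bounds: "\<And>c. c > 1 \<Longrightarrow> \<exists>K. \<forall>x\<ge>K. \<forall>A\<in>sets borel. A \<subseteq> {0<..B} \<longrightarrow>
      emeasure M {\<omega> \<in> space M. X \<omega> > x \<and> T \<omega> \<in> A}
        \<le> ennreal c * (ennreal (prob {\<omega> \<in> space M. X \<omega> > x}) * emeasure \<kappa> A) \<and>
      ennreal (prob {\<omega> \<in> space M. X \<omega> > x}) * emeasure \<kappa> A
        \<le> ennreal c * emeasure M {\<omega> \<in> space M. X \<omega> > x \<and> T \<omega> \<in> A}"
  shows "((\<lambda>x. prob {\<omega> \<in> space M. T \<omega> * X \<omega> > x} /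
    weighted_tail.part \<kappa> (\<lambda>x. prob {\<omega> \<in> space M. X \<omega> > x}) {0<..B} x) \<longlongrightarrow> 1) at_top"
proof -
  note [measurable] = X T
  let ?G = "\<lambda>x. prob {\<omega> \<in> space M. X \<omega> > x}"
  interpret W: weighted_tail \<kappa> ?G B by (rule wt)
  interpret FX: prob_space "distr M borel X" by (rule prob_space_distr) (rule X)
  define P where "P = distr M (borel \<Otimes>\<^sub>M borel) (\<lambda>\<omega>. (T \<omega>, X \<omega>))"
  define Q where "Q = \<kappa> \<Otimes>\<^sub>M distr M borel X"
  have sets_P: "sets P = sets borel" by (simp add: P_def borel_prod)
  have Q_pair: "sets Q = sets (borel \<Otimes>\<^sub>M borel)"
    unfolding Q_def by (rule sets_pair_measure_cong) (simp_all add: W.sets_\<kappa>)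
  from this[unfolded borel_prod] have sets_Q: "sets Q = sets borel" .
  have G_distr: "emeasure (distr M borel X) {t<..} = ennreal (?G t)" for t
    by (subst emeasure_distr) (auto simp: emeasure_eq_measure vimage_def Int_def conj_commute)
  have P_rect: "emeasure P (A \<times> {t<..}) = emeasure M {\<omega> \<in> space M. X \<omega> > t \<and> T \<omega> \<in> A}"
    if "A \<in> sets borel" for A t
  proof -
    have "(\<lambda>\<omega>. (T \<omega>, X \<omega>)) -` (A \<times> {t<..}) \<inter> space M = {\<omega> \<in> space M. X \<omega> > t \<and> T \<omega> \<in> A}" by auto
    then show ?thesis unfolding P_def using that by (subst emeasure_distr) auto
  qed
  have Q_rect: "emeasure Q (A \<times> {t<..}) = ennreal (?G t) * emeasure \<kappa> A"
    if "A \<in> sets borel" for A t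
    unfolding Q_def using that
    by (subst FX.emeasure_pair_measure_Times) (auto simp: W.sets_\<kappa> G_distr mult.commute)
  show ?thesis
  proof (rule tendsto_quotient_1I)
    show "W.J x > 0" for x by (rule W.J_pos)
    fix c :: real assume c: "c > 1"
    obtain K where K: "\<And>x A. x \<ge> K \<Longrightarrow> A \<in> sets borel \<Longrightarrow> A \<subseteq> {0<..B} \<Longrightarrow>
        emeasure M {\<omega> \<in> space M. X \<omega> > x \<and> T \<omega> \<in> A} \<le> ennreal c * (ennreal (?G x) * emeasure \<kappa> A) \<and>
        ennreal (?G x) * emeasure \<kappa> A \<le> ennreal c * emeasure M {\<omega> \<in> space M. X \<omega> > x \<and> T \<omega> \<in> A}"
      using bounds[OF c] by blast
    show "\<forall>\<^sub>F x in at_top. prob {\<omega> \<in> space M. T \<omega> * X \<omega> > x} \<le> c * W.J x \<and>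
        W.J x \<le> c * prob {\<omega> \<in> space M. T \<omega> * X \<omega> > x}"
      using eventually_ge_at_top[of "max K 0 * B"] eventually_gt_at_top[of 0]
    proof eventually_elim
      case (elim x)
      define S where "S = {(\<theta>, z). \<theta> \<in> {0<..B} \<and> z > x / \<theta>}"
      have [measurable]: "(\<lambda>\<theta>. x / \<theta>) \<in> borel_measurable borel" by measurable
      have K_le: "K \<le> x / \<theta>" if "\<theta> \<in> {0<..B}" for \<theta>
      proof -
        have "max K 0 * \<theta> \<le> max K 0 * B" using that by (intro mult_left_mono) auto
        then have "max K 0 * \<theta> \<le> x" using elim by linarith
        then have "max K 0 \<le> x / \<theta>" using that by (subst pos_le_divide_eq) auto
        then show ?thesis by simp
      qed
      have S_sets: "S \<in> sets (borel \<Otimes>\<^sub>M borel)"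
      proof -
        have "{p \<in> space (borel \<Otimes>\<^sub>M borel). fst p \<in> {0<..B} \<and> x / fst p < snd p} \<in> sets (borel \<Otimes>\<^sub>M borel)"
          by measurable
        also have "{p \<in> space (borel \<Otimes>\<^sub>M borel). fst p \<in> {0<..B} \<and> x / fst p < snd p} = S"
          by (auto simp: S_def space_pair_measure)
        finally show ?thesis .
      qed
      have PS: "emeasure P S = ennreal (prob {\<omega> \<in> space M. T \<omega> * X \<omega> > x})"
      proof -
        have "emeasure P S = emeasure M ((\<lambda>\<omega>. (T \<omega>, X \<omega>)) -` S \<inter> space M)"
          unfolding P_def using S_sets by (subst emeasure_distr) auto
        also have "\<dots> = emeasure M {\<omega> \<in> space M. T \<omega> * X \<omega> > x}"
        proof (rule emeasure_eq_AE)
          show "AE \<omega> in M. (\<omega> \<in> (\<lambda>\<omega>. (T \<omega>, X \<omega>)) -` S \<inter> space M) = (\<omega> \<in> {\<omega> \<in> space M. T \<omega> * X \<omega> > x})"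
            using B
          proof eventually_elim
            case (elim \<omega>)
            then show ?case using \<open>0 < x\<close>
              by (cases "T \<omega> = 0") (auto simp: S_def pos_divide_less_eq mult.commute)
          qed
          show "(\<lambda>\<omega>. (T \<omega>, X \<omega>)) -` S \<inter> space M \<in> events"
            using S_sets by (intro measurable_sets[of _ M "borel \<Otimes>\<^sub>M borel"]) auto
        qed measurable
        finally show ?thesis by (simp add: emeasure_eq_measure)
      qed
      have QS: "emeasure Q S = ennreal (W.J x)"
      proof -
        have "emeasure Q S = (\<integral>\<^sup>+\<theta>. emeasure (distr M borel X) (Pair \<theta> -` S) \<partial>\<kappa>)"
          unfolding Q_def using S_sets unfolding Q_pair[unfolded Q_def, symmetric]
          by (rule FX.emeasure_pair_measure_alt)
        also have "\<dots> = (\<integral>\<^sup>+\<theta>. ennreal (indicator {0<..B} \<theta> * ?G (x / \<theta>)) \<partial>\<kappa>)"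
        proof (rule nn_integral_cong)
          fix \<theta> :: real
          have "Pair \<theta> -` S = (if \<theta> \<in> {0<..B} then {x / \<theta><..} else {})" by (auto simp: S_def)
          then show "emeasure (distr M borel X) (Pair \<theta> -` S) = ennreal (indicator {0<..B} \<theta> * ?G (x / \<theta>))"
            using G_distr[of "x / \<theta>"] by auto
        qed
        also have "\<dots> = ennreal (W.J x)"
          unfolding W.part_def
          by (intro nn_integral_eq_integral W.part_integrable') auto
        finally show ?thesis .
      qed
      have "emeasure P S \<le> emeasure (scale_measure c Q) S"
        unfolding S_def
        using K sets_P sets_Q K_le
        by (intro emeasure_epigraph_le[where K = K]) (auto simp: P_rect Q_rect)
      moreover have "emeasure Q S \<le> emeasure (scale_measure c P) S"
        unfolding S_def
        using K sets_P sets_Q K_le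
        by (intro emeasure_epigraph_le[where K = K]) (auto simp: P_rect Q_rect)
      ultimately show ?case
        using c W.part_nonneg[of "{0<..B}" x] by (simp add: PS QS flip: ennreal_mult)
    qed
  qed
qed

section \<open>Joint exceedances of weighted variables\<close>

lemma weighted_pair_le:
  fixes X \<Theta> :: "nat \<Rightarrow> 'a \<Rightarrow> real"
  assumes "X i \<in> borel_measurable M" "X j \<in> borel_measurable M"
    and "\<Theta> i \<in> borel_measurable M" "\<Theta> j \<in> borel_measurable M"
    and B: "B > 0" "AE \<omega> in M. 0 \<le> \<Theta> i \<omega> \<and> \<Theta> i \<omega> \<le> B" "AE \<omega> in M. 0 \<le> \<Theta> j \<omega> \<and> \<Theta> j \<omega> \<le> B"
    and "a \<ge> 0" "x \<ge> 0"
  shows "prob {\<omega> \<in> space M. \<bar>\<Theta> i \<omega> * X i \<omega>\<bar> > a \<and> \<Theta> j \<omega> * X j \<omega> > x}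
    \<le> prob {\<omega> \<in> space M. \<bar>X i \<omega>\<bar> > a / B \<and> X j \<omega> > x / B}"
proof (rule finite_measure_mono_AE)
  note [measurable] = assms(1-4)
  have gt: "u / B < y" if "0 \<le> t" "t \<le> B" "t * y > u" "u \<ge> 0" for t u y :: real
  proof -
    have "y > 0" using that by (metis le_less_trans mult_nonneg_nonpos not_le)
    then have "t * y \<le> B * y" using that by (intro mult_right_mono) auto
    then show ?thesis using that B(1) by (simp add: pos_divide_less_eq mult.commute)
  qed
  show "AE \<omega> in M. \<omega> \<in> {\<omega> \<in> space M. \<bar>\<Theta> i \<omega> * X i \<omega>\<bar> > a \<and> \<Theta> j \<omega> * X j \<omega> > x} \<longrightarrow>
      \<omega> \<in> {\<omega> \<in> space M. \<bar>X i \<omega>\<bar> > a / B \<and> X j \<omega> > x / B}"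
    using B(2,3)
  proof eventually_elim
    case (elim \<omega>)
    then show ?case
      using gt[of "\<Theta> i \<omega>" a "\<bar>X i \<omega>\<bar>"] gt[of "\<Theta> j \<omega>" x "X j \<omega>"] \<open>a \<ge> 0\<close> \<open>x \<ge> 0\<close>
      by (auto simp: abs_mult)
  qed
  show "{\<omega> \<in> space M. \<bar>X i \<omega>\<bar> > a / B \<and> X j \<omega> > x / B} \<in> events" by measurable
qed

context
  fixes X \<Theta> :: "nat \<Rightarrow> 'a \<Rightarrow> real" and n :: nat and B :: real and G T :: "real \<Rightarrow> real"
  assumes X: "\<And>i. i \<in> {1..n} \<Longrightarrow> X i \<in> borel_measurable M"
    and \<Theta>: "\<And>i. i \<in> {1..n} \<Longrightarrow> \<Theta> i \<in> borel_measurable M"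
    and G: "\<And>i x. i \<in> {1..n} \<Longrightarrow> prob {\<omega> \<in> space M. X i \<omega> > x} = G x"
    and G_pos: "\<And>x. G x > 0"
    and T: "\<And>i x. i \<in> {1..n} \<Longrightarrow> prob {\<omega> \<in> space M. \<Theta> i \<omega> * X i \<omega> > x} = T x"
    and B: "B > 0" "\<And>i. i \<in> {1..n} \<Longrightarrow> AE \<omega> in M. 0 \<le> \<Theta> i \<omega> \<and> \<Theta> i \<omega> \<le> B"
    and dom: "\<And>s. s > 0 \<Longrightarrow> \<exists>C>0. \<forall>\<^sub>F x in at_top. G (s * x) \<le> C * T x"
begin

text \<open>The shift is a constant, large enough for the conditional probabilities to be small.\<close>

lemma jump_pTAI:
  assumes long: "\<And>a \<epsilon>. a > 0 \<Longrightarrow> \<epsilon> > 0 \<Longrightarrow> \<forall>\<^sub>F x in at_top. T (x - a) \<le> (1 + \<epsilon>) * T x"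
    and ind: "pTAI M n X" and m: "m \<in> {1..n}" and "\<epsilon> > 0"
  shows "\<exists>l. \<forall>\<^sub>F x in at_top. 0 \<le> l x \<and>
      T (x - l x) \<le> (1 + \<epsilon>) * T x \<and> (1 - \<epsilon>) * T x \<le> T (x + l x) \<and>
      (\<forall>i\<in>{1..m}. \<forall>j\<in>{1..m}. i \<noteq> j \<longrightarrow>
        prob {\<omega> \<in> space M. \<bar>\<Theta> i \<omega> * X i \<omega>\<bar> > l x / m \<and> \<Theta> j \<omega> * X j \<omega> > x / m} \<le> \<epsilon> * T x)"
proof -
  have T_nonneg: "T x \<ge> 0" for x using T[OF m, of x] by (metis measure_nonneg)
  define s where "s = 1 / (m * B)"
  have mB: "m * B > 0" "s > 0" using m B by (auto simp: s_def)
  obtain C where C: "C > 0" "\<forall>\<^sub>F x in at_top. G (s * x) \<le> C * T x" using dom[OF mB(2)] by blast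
  have "\<forall>\<^sub>F p in min_at_top. \<forall>i\<in>{1..n}. \<forall>j\<in>{1..n}. i \<noteq> j \<longrightarrow>
      (case p of (u, v) \<Rightarrow> \<P>(\<omega> in M. \<bar>X i \<omega>\<bar> > u \<bar> X j \<omega> > v)) < \<epsilon> / C"
  proof (intro eventually_ball_finite ballI finite_atLeastAtMost)
    fix i j assume "i \<in> {1..n}" "j \<in> {1..n}"
    then show "\<forall>\<^sub>F p in min_at_top. i \<noteq> j \<longrightarrow>
      (case p of (u, v) \<Rightarrow> \<P>(\<omega> in M. \<bar>X i \<omega>\<bar> > u \<bar> X j \<omega> > v)) < \<epsilon> / C"
      using ind \<open>\<epsilon> > 0\<close> C(1) unfolding pTAI_def
      by (cases "i = j") (auto intro!: order_tendstoD(2)[of _ 0])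
  qed
  then obtain K where "\<forall>u\<ge>K. \<forall>v\<ge>K. \<forall>i\<in>{1..n}. \<forall>j\<in>{1..n}. i \<noteq> j \<longrightarrow>
      \<P>(\<omega> in M. \<bar>X i \<omega>\<bar> > u \<bar> X j \<omega> > v) < \<epsilon> / C"
    unfolding eventually_min_at_top prod.case by blast
  then have K: "\<And>u v i j. u \<ge> K \<Longrightarrow> v \<ge> K \<Longrightarrow> i \<in> {1..n} \<Longrightarrow> j \<in> {1..n} \<Longrightarrow> i \<noteq> j \<Longrightarrow>
      \<P>(\<omega> in M. \<bar>X i \<omega>\<bar> > u \<bar> X j \<omega> > v) < \<epsilon> / C"
    by blast
  define a where "a = max K 1 * (m * B)"
  have a: "a > 0" using mB by (simp add: a_def)
  have "filterlim (\<lambda>x. a + x) at_top at_top"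
    by (intro filterlim_tendsto_add_at_top[OF tendsto_const] filterlim_ident)
  from eventually_compose_filterlim[OF long[OF a \<open>\<epsilon> > 0\<close>] this]
  have long': "\<forall>\<^sub>F x in at_top. T x \<le> (1 + \<epsilon>) * T (x + a)" by (simp add: add.commute)
  show ?thesis
  proof (rule exI[of _ "\<lambda>_. a"])
    show "\<forall>\<^sub>F x in at_top. 0 \<le> a \<and> T (x - a) \<le> (1 + \<epsilon>) * T x \<and> (1 - \<epsilon>) * T x \<le> T (x + a) \<and>
      (\<forall>i\<in>{1..m}. \<forall>j\<in>{1..m}. i \<noteq> j \<longrightarrow>
        prob {\<omega> \<in> space M. \<bar>\<Theta> i \<omega> * X i \<omega>\<bar> > a / m \<and> \<Theta> j \<omega> * X j \<omega> > x / m} \<le> \<epsilon> * T x)"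
      using long[OF a \<open>\<epsilon> > 0\<close>] long' C(2) eventually_ge_at_top[of a]
    proof eventually_elim
      case (elim x)
      have "(1 - \<epsilon>) * T x \<le> T (x + a)"
      proof (cases "\<epsilon> \<ge> 1")
        case True
        then have "(1 - \<epsilon>) * T x \<le> 0" using T_nonneg by (intro mult_nonpos_nonneg) auto
        then show ?thesis using T_nonneg[of "x + a"] by linarith
      next
        case False
        then have "(1 - \<epsilon>) * T x \<le> (1 - \<epsilon>) * ((1 + \<epsilon>) * T (x + a))"
          using elim by (intro mult_left_mono) auto
        also have "\<dots> = (1 - \<epsilon> * \<epsilon>) * T (x + a)" by (simp add: algebra_simps)
        also have "\<dots> \<le> 1 * T (x + a)" using T_nonneg by (intro mult_right_mono) auto
        finally show ?thesis by simp
      qed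
      moreover have "prob {\<omega> \<in> space M. \<bar>\<Theta> i \<omega> * X i \<omega>\<bar> > a / m \<and> \<Theta> j \<omega> * X j \<omega> > x / m} \<le> \<epsilon> * T x"
        if ij: "i \<in> {1..m}" "j \<in> {1..m}" "i \<noteq> j" for i j
      proof -
        have ij': "i \<in> {1..n}" "j \<in> {1..n}" using ij m by auto
        have u: "K \<le> a / m / B" "K \<le> x / m / B"
        proof -
          show "K \<le> a / m / B" using mB m B(1) by (simp add: a_def)
          also have "a / m / B \<le> x / m / B" using elim(4) B(1) by (intro divide_right_mono) auto
          finally show "K \<le> x / m / B" .
        qed
        have sx: "x / m / B = s * x" by (simp add: s_def)
        have "prob {\<omega> \<in> space M. \<bar>\<Theta> i \<omega> * X i \<omega>\<bar> > a / m \<and> \<Theta> j \<omega> * X j \<omega> > x / m}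
            \<le> prob {\<omega> \<in> space M. \<bar>X i \<omega>\<bar> > a / m / B \<and> X j \<omega> > x / m / B}"
          using ij' a elim(4) by (intro weighted_pair_le X \<Theta> B) auto
        also have "\<dots> = \<P>(\<omega> in M. \<bar>X i \<omega>\<bar> > a / m / B \<bar> X j \<omega> > x / m / B) * G (s * x)"
          using G_pos[of "s * x"] unfolding sx cond_prob_def G[OF ij'(2)] by simp
        also have "\<dots> \<le> \<epsilon> / C * G (s * x)"
          using K[OF u ij' ij(3)] G_pos[of "s * x"] by (intro mult_right_mono) auto
        also have "\<dots> \<le> \<epsilon> / C * (C * T x)" using elim(3) C(1) \<open>\<epsilon> > 0\<close> by (intro mult_left_mono) auto
        finally show ?thesis using C(1) by simp
      qed
      ultimately show ?case using elim(1) a by auto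
    qed
  qed
qed

text \<open>The shift is (1 - v) x with v close to 1. Both levels of the X are lowered to the common value
  s x, at which quasi independence is available separately for a positive and a negative
  \<^term>\<open>X i\<close>.\<close>

lemma jump_pQAI:
  assumes cons: "\<And>\<epsilon>. \<epsilon> > 0 \<Longrightarrow> \<exists>v. 0 < v \<and> v < 1 \<and> (\<forall>\<^sub>F x in at_top. T (v * x) \<le> (1 + \<epsilon>) * T x)"
    and T_anti: "antimono T"
    and ind: "pQAI M n X" and m: "m \<in> {1..n}" and "\<epsilon> > 0"
  shows "\<exists>l. \<forall>\<^sub>F x in at_top. 0 \<le> l x \<and>
      T (x - l x) \<le> (1 + \<epsilon>) * T x \<and> (1 - \<epsilon>) * T x \<le> T (x + l x) \<and>
      (\<forall>i\<in>{1..m}. \<forall>j\<in>{1..m}. i \<noteq> j \<longrightarrow>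
        prob {\<omega> \<in> space M. \<bar>\<Theta> i \<omega> * X i \<omega>\<bar> > l x / m \<and> \<Theta> j \<omega> * X j \<omega> > x / m} \<le> \<epsilon> * T x)"
proof -
  have T_nonneg: "T x \<ge> 0" for x using T[OF m, of x] by (metis measure_nonneg)
  obtain v where v: "0 < v" "v < 1" "\<forall>\<^sub>F x in at_top. T (v * x) \<le> (1 + \<epsilon>) * T x"
    using cons[OF \<open>\<epsilon> > 0\<close>] by blast
  define s where "s = (1 - v) / (m * B)"
  have s: "m * B > 0" "s > 0" using m B v by (auto simp: s_def)
  obtain C where C: "C > 0" "\<forall>\<^sub>F x in at_top. G (s * x) \<le> C * T x" using dom[OF s(2)] by blast
  define e where "e = \<epsilon> / (4 * C)"
  have "e > 0" using C \<open>\<epsilon> > 0\<close> by (simp add: e_def)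
  have "\<forall>\<^sub>F y in at_top. \<forall>i\<in>{1..n}. \<forall>j\<in>{1..n}. i \<noteq> j \<longrightarrow>
      prob {\<omega> \<in> space M. max (X i \<omega>) 0 > y \<and> max (X j \<omega>) 0 > y} / (G y + G y) < e \<and>
      prob {\<omega> \<in> space M. - min (X i \<omega>) 0 > y \<and> X j \<omega> > y} / (G y + G y) < e"
  proof (intro eventually_ball_finite ballI finite_atLeastAtMost)
    fix i j assume ij: "i \<in> {1..n}" "j \<in> {1..n}"
    show "\<forall>\<^sub>F y in at_top. i \<noteq> j \<longrightarrow>
      prob {\<omega> \<in> space M. max (X i \<omega>) 0 > y \<and> max (X j \<omega>) 0 > y} / (G y + G y) < e \<and>
      prob {\<omega> \<in> space M. - min (X i \<omega>) 0 > y \<and> X j \<omega> > y} / (G y + G y) < e"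
    proof (cases "i = j")
      case False
      then have "((\<lambda>y. prob {\<omega> \<in> space M. max (X i \<omega>) 0 > y \<and> max (X j \<omega>) 0 > y} / (G y + G y)) \<longlongrightarrow> 0) at_top"
        "((\<lambda>y. prob {\<omega> \<in> space M. - min (X i \<omega>) 0 > y \<and> X j \<omega> > y} / (G y + G y)) \<longlongrightarrow> 0) at_top"
        using ind[unfolded pQAI_def, rule_format, OF ij False]
        unfolding G[OF ij(1)] G[OF ij(2)] by blast+
      from order_tendstoD(2)[OF this(1) \<open>e > 0\<close>] order_tendstoD(2)[OF this(2) \<open>e > 0\<close>]
      show ?thesis by eventually_elim simp
    qed simp
  qed
  moreover have "filterlim (\<lambda>x. s * x) at_top at_top"
    using s by (intro filterlim_tendsto_pos_mult_at_top[OF tendsto_const] filterlim_ident) auto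
  ultimately have pairs: "\<forall>\<^sub>F x in at_top. \<forall>i\<in>{1..n}. \<forall>j\<in>{1..n}. i \<noteq> j \<longrightarrow>
      prob {\<omega> \<in> space M. max (X i \<omega>) 0 > s * x \<and> max (X j \<omega>) 0 > s * x} / (G (s * x) + G (s * x)) < e \<and>
      prob {\<omega> \<in> space M. - min (X i \<omega>) 0 > s * x \<and> X j \<omega> > s * x} / (G (s * x) + G (s * x)) < e"
    by (rule eventually_compose_filterlim)
  have "filterlim (\<lambda>x. (1 / v) * x) at_top at_top"
    using v by (intro filterlim_tendsto_pos_mult_at_top[OF tendsto_const] filterlim_ident) auto
  from eventually_compose_filterlim[OF v(3) this]
  have cons': "\<forall>\<^sub>F x in at_top. T x \<le> (1 + \<epsilon>) * T (x / v)" using v by simp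
  show ?thesis
  proof (rule exI[of _ "\<lambda>x. (1 - v) * x"])
    show "\<forall>\<^sub>F x in at_top. 0 \<le> (1 - v) * x \<and> T (x - (1 - v) * x) \<le> (1 + \<epsilon>) * T x \<and>
      (1 - \<epsilon>) * T x \<le> T (x + (1 - v) * x) \<and>
      (\<forall>i\<in>{1..m}. \<forall>j\<in>{1..m}. i \<noteq> j \<longrightarrow>
        prob {\<omega> \<in> space M. \<bar>\<Theta> i \<omega> * X i \<omega>\<bar> > (1 - v) * x / m \<and> \<Theta> j \<omega> * X j \<omega> > x / m} \<le> \<epsilon> * T x)"
      using v(3) cons' C(2) pairs eventually_gt_at_top[of 0]
    proof eventually_elim
      case (elim x)
      have "(1 - \<epsilon>) * T x \<le> T (x + (1 - v) * x)"
      proof (cases "\<epsilon> \<ge> 1")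
        case True
        then have "(1 - \<epsilon>) * T x \<le> 0" using T_nonneg by (intro mult_nonpos_nonneg) auto
        then show ?thesis using T_nonneg[of "x + (1 - v) * x"] by linarith
      next
        case False
        then have "(1 - \<epsilon>) * T x \<le> (1 - \<epsilon>) * ((1 + \<epsilon>) * T (x / v))"
          using elim by (intro mult_left_mono) auto
        also have "\<dots> = (1 - \<epsilon> * \<epsilon>) * T (x / v)" by (simp add: algebra_simps)
        also have "\<dots> \<le> 1 * T (x / v)" using T_nonneg by (intro mult_right_mono) auto
        also have "\<dots> \<le> T (x + (1 - v) * x)"
        proof -
          \<comment> \<open>the shift upwards is no larger than the one that division by v makes\<close>
          have "(2 - v) * v \<le> 1"
            using zero_le_power2[of "1 - v"] by (simp add: power2_eq_square algebra_simps)
          then have "(2 - v) * v * x \<le> 1 * x" using elim by (intro mult_right_mono) auto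
          then have "(x + (1 - v) * x) * v \<le> x" by (simp add: algebra_simps)
          then have "x + (1 - v) * x \<le> x / v" using v by (simp only: pos_le_divide_eq)
          then show ?thesis using T_anti by (simp add: antimono_def)
        qed
        finally show ?thesis .
      qed
      moreover have "prob {\<omega> \<in> space M. \<bar>\<Theta> i \<omega> * X i \<omega>\<bar> > (1 - v) * x / m \<and> \<Theta> j \<omega> * X j \<omega> > x / m} \<le> \<epsilon> * T x"
        if ij: "i \<in> {1..m}" "j \<in> {1..m}" "i \<noteq> j" for i j
      proof -
        have ij': "i \<in> {1..n}" "j \<in> {1..n}" using ij m by auto
        note [measurable] = X[OF ij'(1)] X[OF ij'(2)]
        let ?y = "s * x"
        have y: "(1 - v) * x / m / B = ?y" "?y > 0"
          using mult_pos_pos[OF s(2), of x] elim by (simp_all add: s_def)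
        have "?y \<le> x / m / B"
        proof -
          have "(1 - v) * x \<le> 1 * x" using v elim by (intro mult_right_mono) auto
          then show ?thesis unfolding y(1)[symmetric] using B(1) by (intro divide_right_mono) auto
        qed
        define A1 where "A1 = {\<omega> \<in> space M. max (X i \<omega>) 0 > ?y \<and> max (X j \<omega>) 0 > ?y}"
        define A2 where "A2 = {\<omega> \<in> space M. - min (X i \<omega>) 0 > ?y \<and> X j \<omega> > ?y}"
        have A_sets: "A1 \<in> events" "A2 \<in> events" unfolding A1_def A2_def by measurable
        have "prob {\<omega> \<in> space M. \<bar>\<Theta> i \<omega> * X i \<omega>\<bar> > (1 - v) * x / m \<and> \<Theta> j \<omega> * X j \<omega> > x / m}
            \<le> prob {\<omega> \<in> space M. \<bar>X i \<omega>\<bar> > (1 - v) * x / m / B \<and> X j \<omega> > x / m / B}"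
          using ij' v elim by (intro weighted_pair_le X \<Theta> B) auto
        also have "\<dots> \<le> prob (A1 \<union> A2)"
        proof (rule finite_measure_mono)
          show "{\<omega> \<in> space M. \<bar>X i \<omega>\<bar> > (1 - v) * x / m / B \<and> X j \<omega> > x / m / B} \<subseteq> A1 \<union> A2"
            unfolding y(1) A1_def A2_def using \<open>?y \<le> x / m / B\<close> y(2) by auto
        qed (use A_sets in auto)
        also have "\<dots> \<le> prob A1 + prob A2" using A_sets by (rule measure_Un_le)
        also have "\<dots> \<le> e * (G ?y + G ?y) + e * (G ?y + G ?y)"
        proof -
          have G2: "G ?y + G ?y > 0" using G_pos[of ?y] by simp
          have "prob A1 / (G ?y + G ?y) < e" "prob A2 / (G ?y + G ?y) < e"
            using elim(4) ij' ij(3) unfolding A1_def A2_def by blast+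
          then show ?thesis using G2 by (simp add: pos_divide_less_eq)
        qed
        also have "\<dots> = 4 * e * G ?y" by simp
        also have "\<dots> \<le> 4 * e * (C * T x)" using elim(3) \<open>e > 0\<close> by (intro mult_left_mono) auto
        also have "\<dots> = \<epsilon> * T x" using C(1) by (simp add: e_def)
        finally show ?thesis .
      qed
      ultimately show ?case using elim v by (auto simp: left_diff_distrib)
    qed
  qed
qed

end

end

section \<open>Maxima of partial sums\<close>

text \<open>If a partial sum exceeds x although every single term stays below x - l, then some term exceeds
  the mean x / m, and the positive parts of the others must make up for more than l.\<close>

lemma two_large_terms:
  fixes y :: "nat \<Rightarrow> real"
  assumes "m \<ge> 1" "x \<ge> 0" "l \<ge> 0" "k \<le> m" and sum: "(\<Sum>i=1..k. y i) > x"
    and small: "\<And>i. i \<in> {1..m} \<Longrightarrow> y i \<le> x - l"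
  shows "\<exists>i\<in>{1..m}. \<exists>j\<in>{1..m}. i \<noteq> j \<and> \<bar>y i\<bar> > l / m \<and> y j > x / m"
proof -
  define z where "z i = max (y i) 0" for i
  have "(\<Sum>i=1..k. y i) \<le> (\<Sum>i=1..k. z i)" by (intro sum_mono) (simp add: z_def)
  also have "\<dots> \<le> (\<Sum>i=1..m. z i)" using assms(4) by (intro sum_mono2) (auto simp: z_def)
  finally have z: "(\<Sum>i=1..m. z i) > x" using sum by simp
  have "\<exists>j\<in>{1..m}. z j > x / m"
  proof (rule ccontr)
    assume "\<not> ?thesis"
    then have "(\<Sum>i=1..m. z i) \<le> (\<Sum>i=1..m. x / m)" by (intro sum_mono) (auto simp: not_less)
    then show False using z assms(1) by simp
  qed
  then obtain j where j: "j \<in> {1..m}" "z j > x / m" by blast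
  have "x / m \<ge> 0" using assms by simp
  then have yj: "y j > x / m" "z j = y j" using j by (auto simp: z_def max_def split: if_splits)
  have "\<exists>i\<in>{1..m} - {j}. z i > l / m"
  proof (rule ccontr)
    assume "\<not> ?thesis"
    then have "(\<Sum>i\<in>{1..m} - {j}. z i) \<le> (\<Sum>i\<in>{1..m} - {j}. l / m)"
      by (intro sum_mono) (auto simp: not_less)
    also have "\<dots> \<le> (\<Sum>i\<in>{1..m}. l / m)" using assms by (intro sum_mono2) auto
    also have "\<dots> = l" using assms(1) by simp
    finally have "(\<Sum>i=1..m. z i) \<le> z j + l" using j(1) by (subst sum.remove[of _ j]) auto
    then show False using z small[OF j(1)] yj by linarith
  qed
  then obtain i where i: "i \<in> {1..m}" "i \<noteq> j" "z i > l / m" by blast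
  have "l / m \<ge> 0" using assms by simp
  then have "\<bar>y i\<bar> > l / m" using i by (auto simp: z_def max_def split: if_splits)
  with i j yj show ?thesis by blast
qed

lemma one_large_term:
  fixes y :: "nat \<Rightarrow> real"
  assumes "l \<ge> 0" "j \<in> {1..m}" "y j > x + l"
    and small: "\<And>i. i \<in> {1..m} \<Longrightarrow> i \<noteq> j \<Longrightarrow> \<bar>y i\<bar> \<le> l / m"
  shows "(\<Sum>i=1..m. y i) > x"
proof -
  have "(\<Sum>i\<in>{1..m} - {j}. l / m) \<le> (\<Sum>i\<in>{1..m}. l / m)"
    using assms by (intro sum_mono2) auto
  also have "\<dots> = l" using assms(2) by simp
  finally have "- l \<le> (\<Sum>i\<in>{1..m} - {j}. - (l / m))" by (simp only: sum_negf neg_le_iff_le)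
  also have "\<dots> \<le> (\<Sum>i\<in>{1..m} - {j}. y i)"
    using small by (intro sum_mono) (force simp: abs_le_iff)
  finally have "y j - l \<le> (\<Sum>i=1..m. y i)" using assms(2) by (subst sum.remove[of _ j]) auto
  then show ?thesis using assms(3) by linarith
qed

context prob_space
begin

text \<open>A single big jump: if a shift by l does not change the tail T much, while two of the
  variables rarely exceed the levels l / m and x / m together, then the maximum of the partial sums
  exceeds x essentially when exactly one of the variables does.\<close>

lemma max_partial_sum_tail:
  fixes Y :: "nat \<Rightarrow> 'a \<Rightarrow> real" and T :: "real \<Rightarrow> real"
  assumes m: "m \<ge> 1" and meas: "\<And>i. i \<in> {1..m} \<Longrightarrow> Y i \<in> borel_measurable M"
    and T: "\<And>i x. i \<in> {1..m} \<Longrightarrow> prob {\<omega> \<in> space M. Y i \<omega> > x} = T x"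
    and T_pos: "\<forall>\<^sub>F x in at_top. T x > 0"
    and jump: "\<And>\<epsilon>. \<epsilon> > 0 \<Longrightarrow> \<exists>l. \<forall>\<^sub>F x in at_top. 0 \<le> l x \<and>
      T (x - l x) \<le> (1 + \<epsilon>) * T x \<and> (1 - \<epsilon>) * T x \<le> T (x + l x) \<and>
      (\<forall>i\<in>{1..m}. \<forall>j\<in>{1..m}. i \<noteq> j \<longrightarrow>
        prob {\<omega> \<in> space M. \<bar>Y i \<omega>\<bar> > l x / m \<and> Y j \<omega> > x / m} \<le> \<epsilon> * T x)"
  shows "((\<lambda>x. prob {\<omega> \<in> space M. Max ((\<lambda>k. \<Sum>i=1..k. Y i \<omega>) ` {1..m}) > x} / T x)
    \<longlongrightarrow> real m) at_top"
proof (rule tendstoI)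
  fix e :: real assume "e > 0"
  define w :: real where "w = m + m ^ 3"
  define \<epsilon> where "\<epsilon> = e / (2 * w)"
  have "w > 0" using m by (simp add: w_def add_pos_pos)
  then have \<epsilon>: "\<epsilon> > 0" "w * \<epsilon> < e"
    using \<open>e > 0\<close> by (auto simp: \<epsilon>_def)
  obtain l where l: "\<forall>\<^sub>F x in at_top. 0 \<le> l x \<and>
      T (x - l x) \<le> (1 + \<epsilon>) * T x \<and> (1 - \<epsilon>) * T x \<le> T (x + l x) \<and>
      (\<forall>i\<in>{1..m}. \<forall>j\<in>{1..m}. i \<noteq> j \<longrightarrow>
        prob {\<omega> \<in> space M. \<bar>Y i \<omega>\<bar> > l x / m \<and> Y j \<omega> > x / m} \<le> \<epsilon> * T x)"
    using jump[OF \<epsilon>(1)] by blast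
  show "\<forall>\<^sub>F x in at_top.
    dist (prob {\<omega> \<in> space M. Max ((\<lambda>k. \<Sum>i=1..k. Y i \<omega>) ` {1..m}) > x} / T x) (real m) < e"
    using l T_pos eventually_ge_at_top[of 0]
  proof eventually_elim
    case (elim x)
    define Ev where "Ev = {\<omega> \<in> space M. Max ((\<lambda>k. \<Sum>i=1..k. Y i \<omega>) ` {1..m}) > x}"
    define Bp where "Bp p = {\<omega> \<in> space M. \<bar>Y (fst p) \<omega>\<bar> > l x / m \<and> Y (snd p) \<omega> > x / m}" for p
    define I where "I = {p \<in> {1..m} \<times> {1..m}. fst p \<noteq> snd p}"
    define Bad where "Bad = (\<Union>p\<in>I. Bp p)"
    define H where "H t j = {\<omega> \<in> space M. Y j \<omega> > t}" for t j
    have H_sets: "H t j \<in> events" if "j \<in> {1..m}" for t j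
      using meas[OF that] unfolding H_def by measurable
    have Bp_sets: "Bp p \<in> events" if "p \<in> I" for p
    proof -
      have [measurable]: "Y (fst p) \<in> borel_measurable M" "Y (snd p) \<in> borel_measurable M"
        using that by (auto simp: I_def intro: meas)
      show ?thesis unfolding Bp_def by measurable
    qed
    have "finite I" by (auto simp: I_def)
    have Bad_sets: "Bad \<in> events" using Bp_sets \<open>finite I\<close> by (auto simp: Bad_def)
    have Ev_alt: "Ev = (\<Union>k\<in>{1..m}. {\<omega> \<in> space M. (\<Sum>i=1..k. Y i \<omega>) > x})"
      using m by (auto simp: Ev_def Max_gr_iff)
    have Ev_sets: "Ev \<in> events"
      unfolding Ev_alt
    proof (intro sets.finite_UN)
      fix k assume "k \<in> {1..m}"
      then have [measurable]: "(\<lambda>\<omega>. \<Sum>i=1..k. Y i \<omega>) \<in> borel_measurable M"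
        by (intro borel_measurable_sum meas) auto
      show "{\<omega> \<in> space M. (\<Sum>i=1..k. Y i \<omega>) > x} \<in> events" by measurable
    qed simp
    have "card I \<le> m ^ 2"
      using card_mono[of "{1..m} \<times> {1..m}" I] by (auto simp: I_def power2_eq_square)
    then have cardI: "real (card I) \<le> real m ^ 2" by (metis of_nat_le_iff of_nat_power)
    have "prob Bad \<le> (\<Sum>p\<in>I. prob (Bp p))"
      unfolding Bad_def using Bp_sets \<open>finite I\<close> by (intro finite_measure_subadditive_finite) auto
    also have "\<dots> \<le> (\<Sum>p\<in>I. \<epsilon> * T x)"
      using elim by (intro sum_mono) (auto simp: I_def Bp_def)
    also have "\<dots> \<le> m ^ 2 * (\<epsilon> * T x)"
      using cardI \<epsilon> elim by (auto intro: mult_right_mono)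
    finally have Bad: "prob Bad \<le> m ^ 2 * (\<epsilon> * T x)" .
    have "prob Ev \<le> m * T x + (m + m ^ 2) * (\<epsilon> * T x)"
    proof -
      have "Ev \<subseteq> (\<Union>j\<in>{1..m}. H (x - l x) j) \<union> Bad"
      proof
        fix \<omega> assume \<omega>: "\<omega> \<in> Ev"
        then obtain k where k: "k \<in> {1..m}" "(\<Sum>i=1..k. Y i \<omega>) > x" "\<omega> \<in> space M"
          by (auto simp: Ev_alt)
        show "\<omega> \<in> (\<Union>j\<in>{1..m}. H (x - l x) j) \<union> Bad"
        proof (cases "\<exists>j\<in>{1..m}. Y j \<omega> > x - l x")
          case False
          then have "\<exists>i\<in>{1..m}. \<exists>j\<in>{1..m}. i \<noteq> j \<and> \<bar>Y i \<omega>\<bar> > l x / m \<and> Y j \<omega> > x / m"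
            using m k elim by (intro two_large_terms[of m x "l x" k]) (auto simp: not_less)
          then obtain i j where "(i, j) \<in> I" "\<omega> \<in> Bp (i, j)"
            using k(3) by (auto simp: I_def Bp_def)
          then show ?thesis by (auto simp: Bad_def)
        qed (use k in \<open>auto simp: H_def\<close>)
      qed
      then have "prob Ev \<le> prob ((\<Union>j\<in>{1..m}. H (x - l x) j) \<union> Bad)"
        using H_sets Bad_sets by (intro finite_measure_mono) auto
      also have "\<dots> \<le> prob (\<Union>j\<in>{1..m}. H (x - l x) j) + prob Bad"
        using H_sets Bad_sets by (intro measure_Un_le) auto
      also have "prob (\<Union>j\<in>{1..m}. H (x - l x) j) \<le> (\<Sum>j\<in>{1..m}. prob (H (x - l x) j))"
        using H_sets by (intro finite_measure_subadditive_finite) auto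
      also have "\<dots> = m * T (x - l x)" using T by (simp add: H_def)
      also have "\<dots> \<le> m * ((1 + \<epsilon>) * T x)" using elim by (intro mult_left_mono) auto
      finally show ?thesis using Bad by (simp add: algebra_simps)
    qed
    moreover have "m * T x - (m + m ^ 3) * (\<epsilon> * T x) \<le> prob Ev"
    proof -
      define D where "D j = H (x + l x) j - Bad" for j
      have div_le: "x / m \<le> x + l x" "l x / m \<le> x + l x"
      proof -
        have "x / m \<le> x / 1" "l x / m \<le> l x / 1" using elim m by (intro divide_left_mono; simp)+
        then show "x / m \<le> x + l x" "l x / m \<le> x + l x" using elim by auto
      qed
      have bad: "\<omega> \<in> Bad" if "i \<in> {1..m}" "j \<in> {1..m}" "i \<noteq> j" "\<omega> \<in> space M"
        "\<bar>Y i \<omega>\<bar> > l x / m" "Y j \<omega> > x + l x" for i j \<omega>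
        using that div_le unfolding Bad_def I_def Bp_def by (intro UN_I[of "(i, j)"]) auto
      have D_sets: "D j \<in> events" if "j \<in> {1..m}" for j
        using H_sets[OF that] Bad_sets by (auto simp: D_def)
      have "disjoint_family_on D {1..m}"
        unfolding disjoint_family_on_def
      proof (intro ballI impI)
        fix i j assume ij: "i \<in> {1..m}" "j \<in> {1..m}" "i \<noteq> j"
        have "\<omega> \<in> Bad" if "\<omega> \<in> H (x + l x) i" "\<omega> \<in> H (x + l x) j" for \<omega>
        proof (rule bad[OF ij])
          show "\<bar>Y i \<omega>\<bar> > l x / m" using that div_le by (auto simp: H_def)
        qed (use that in \<open>auto simp: H_def\<close>)
        then show "D i \<inter> D j = {}" by (auto simp: D_def)
      qed
      then have "(\<Sum>j\<in>{1..m}. prob (D j)) = prob (\<Union>j\<in>{1..m}. D j)"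
        using D_sets by (intro finite_measure_finite_Union[symmetric]) auto
      also have "\<dots> \<le> prob Ev"
      proof (rule finite_measure_mono[OF _ Ev_sets], rule UN_least)
        fix j assume j: "j \<in> {1..m}"
        show "D j \<subseteq> Ev"
        proof
          fix \<omega> assume \<omega>: "\<omega> \<in> D j"
          have "(\<Sum>i=1..m. Y i \<omega>) > x"
          proof (rule one_large_term)
            show "Y j \<omega> > x + l x" using \<omega> by (auto simp: D_def H_def)
            fix i assume "i \<in> {1..m}" "i \<noteq> j"
            then show "\<bar>Y i \<omega>\<bar> \<le> l x / m"
              using bad[of i j \<omega>] \<omega> j by (force simp: D_def H_def)
          qed (use elim j in auto)
          then show "\<omega> \<in> Ev" using \<omega> m by (auto simp: Ev_alt D_def H_def)
        qed
      qed
      finally have "(\<Sum>j\<in>{1..m}. prob (D j)) \<le> prob Ev" .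
      moreover have "(\<Sum>j\<in>{1..m}. (1 - \<epsilon>) * T x - m ^ 2 * (\<epsilon> * T x)) \<le> (\<Sum>j\<in>{1..m}. prob (D j))"
      proof (rule sum_mono)
        fix j assume j: "j \<in> {1..m}"
        have "prob (H (x + l x) j) \<le> prob (D j \<union> Bad)"
          using H_sets[OF j] Bad_sets by (intro finite_measure_mono) (auto simp: D_def)
        also have "\<dots> \<le> prob (D j) + prob Bad"
          using D_sets[OF j] Bad_sets by (intro measure_Un_le) auto
        finally show "(1 - \<epsilon>) * T x - m ^ 2 * (\<epsilon> * T x) \<le> prob (D j)"
          using Bad elim T[OF j, of "x + l x"] by (simp add: H_def)
      qed
      ultimately show ?thesis by (simp add: algebra_simps power2_eq_square power3_eq_cube)
    qed
    moreover have "real m ^ 2 \<le> real m ^ 3" using m by (intro power_increasing) auto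
    then have "(m + m ^ 2) * (\<epsilon> * T x) \<le> (m + m ^ 3) * (\<epsilon> * T x)"
      using m \<epsilon> elim by (intro mult_right_mono add_left_mono) auto
    moreover have "(m + m ^ 3) * (\<epsilon> * T x) < e * T x"
      using \<epsilon> elim unfolding w_def by (simp flip: mult.assoc)
    ultimately have "\<bar>prob Ev - m * T x\<bar> < e * T x" by linarith
    then have "\<bar>prob Ev / T x - m\<bar> < e"
      using elim by (simp add: field_simps abs_less_iff)
    then show ?case by (simp add: dist_real_def Ev_def)
  qed
qed

section \<open>Random horizon\<close>

lemma ruin_prob_eq_sum:
  fixes N :: "'a \<Rightarrow> nat" and X \<Theta> :: "nat \<Rightarrow> 'a \<Rightarrow> real"
  assumes X: "\<And>i. i \<ge> 1 \<Longrightarrow> X i \<in> borel_measurable M"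
    and \<Theta>: "\<And>i. i \<ge> 1 \<Longrightarrow> \<Theta> i \<in> borel_measurable M"
    and N: "N \<in> measurable M (count_space UNIV)"
    and bound: "prob {\<omega> \<in> space M. N \<omega> > n} = 0"
    and indep: "indep_of_sequences M N X \<Theta>" and "x \<ge> 0"
  shows "ruin_prob M \<Theta> X N x = (\<Sum>m=1..n. prob {\<omega> \<in> space M. N \<omega> = m} *
    prob {\<omega> \<in> space M. Max ((\<lambda>k. \<Sum>i=1..k. \<Theta> i \<omega> * X i \<omega>) ` {1..m}) > x})"
proof -
  note [measurable] = N
  define P where "P = PiM {1::nat..} (\<lambda>_. borel \<Otimes>\<^sub>M (borel :: real measure) :: (real \<times> real) measure)"
  define Z where "Z \<omega> = (\<lambda>i\<in>{1..}. (X i \<omega>, \<Theta> i \<omega>))" for \<omega>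
  define S where "S m = {\<omega> \<in> space M. Max ((\<lambda>k. \<Sum>i=1..k. \<Theta> i \<omega> * X i \<omega>) ` {1..m}) > x}" for m
  define C where "C m = {\<omega> \<in> space M. N \<omega> = m}" for m
  have S_gen: "S m \<in> sets (vimage_algebra (space M) Z P)" and S_sets: "S m \<in> events"
    if m: "m \<ge> 1" for m
  proof -
    define A where "A = (\<Union>k\<in>{1..m}. {f \<in> space P. (\<Sum>i=1..k. snd (f i) * fst (f i)) > x})"
    have "A \<in> sets P"
      unfolding A_def
    proof (intro sets.finite_UN)
      fix k
      have "(\<lambda>f. snd (f i) * fst (f i)) \<in> borel_measurable P" if "i \<ge> 1" for i
      proof -
        have [measurable]: "(\<lambda>f. f i) \<in> measurable P (borel \<Otimes>\<^sub>M borel)"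
          unfolding P_def using that by (intro measurable_component_singleton) auto
        show ?thesis by measurable
      qed
      then have [measurable]: "(\<lambda>f. \<Sum>i=1..k. snd (f i) * fst (f i)) \<in> borel_measurable P"
        by (intro borel_measurable_sum) auto
      show "{f \<in> space P. (\<Sum>i=1..k. snd (f i) * fst (f i)) > x} \<in> sets P" by measurable
    qed simp
    moreover have S_eq: "S m = Z -` A \<inter> space M"
    proof -
      have sums: "(\<Sum>i=1..k. snd (Z \<omega> i) * fst (Z \<omega> i)) = (\<Sum>i=1..k. \<Theta> i \<omega> * X i \<omega>)" for k \<omega>
        by (intro sum.cong) (auto simp: Z_def)
      have space: "Z \<omega> \<in> space P" for \<omega>
        by (auto simp: Z_def P_def space_PiM space_pair_measure)
      have "Z \<omega> \<in> A \<longleftrightarrow> (\<exists>k\<in>{1..m}. (\<Sum>i=1..k. \<Theta> i \<omega> * X i \<omega>) > x)" for \<omega>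
        unfolding A_def by (simp only: UN_iff mem_Collect_eq sums space simp_thms)
      then have "Z -` A \<inter> space M = {\<omega> \<in> space M. \<exists>k\<in>{1..m}. (\<Sum>i=1..k. \<Theta> i \<omega> * X i \<omega>) > x}"
        by (simp only: set_eq_iff Int_iff vimage_eq mem_Collect_eq) blast
      also have "\<dots> = S m" using m by (auto simp: S_def Max_gr_iff)
      finally show ?thesis by (rule sym)
    qed
    ultimately show "S m \<in> sets (vimage_algebra (space M) Z P)"
      using in_vimage_algebra by metis
    have "Z \<in> measurable M P"
      unfolding Z_def P_def
      by (intro measurable_restrict measurable_Pair) (auto intro: X \<Theta>)
    then show "S m \<in> events"
      using \<open>A \<in> sets P\<close> S_eq by (auto intro: measurable_sets)
  qed
  have C_gen: "C m \<in> sets (vimage_algebra (space M) N (count_space UNIV))" for m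
  proof -
    have "C m = N -` {m} \<inter> space M" by (auto simp: C_def)
    then show ?thesis by (auto intro: in_vimage_algebra)
  qed
  have indep': "indep_set (sets (vimage_algebra (space M) N (count_space UNIV)))
      (sets (vimage_algebra (space M) Z P))"
    using indep by (simp add: indep_of_sequences_def P_def Z_def[abs_def])
  have C_sets: "C m \<in> events" for m unfolding C_def by measurable
  have "ruin_prob M \<Theta> X N x = prob (\<Union>m\<in>{1..n}. C m \<inter> S m)"
    unfolding ruin_prob_def
  proof (rule measure_eq_AE)
    have "AE \<omega> in M. \<not> N \<omega> > n"
      using bound by (subst (asm) prob_eq_0) auto
    then show "AE \<omega> in M. \<omega> \<in> {\<omega> \<in> space M. x < max_weighted_sum \<Theta> X (N \<omega>) \<omega>} \<longleftrightarrow>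
        \<omega> \<in> (\<Union>m\<in>{1..n}. C m \<inter> S m)"
    proof eventually_elim
      case (elim \<omega>)
      then show ?case using \<open>x \<ge> 0\<close>
        by (cases "N \<omega> = 0") (auto simp: C_def S_def max_weighted_sum_def)
    qed
    have "{\<omega> \<in> space M. x < max_weighted_sum \<Theta> X (N \<omega>) \<omega>} = (\<Union>m\<in>{1..}. C m \<inter> S m)"
      using \<open>x \<ge> 0\<close> by (auto simp: C_def S_def max_weighted_sum_def split: if_splits)
    also have "\<dots> \<in> events" using C_sets S_sets by (intro sets.countable_UN') auto
    finally show "{\<omega> \<in> space M. x < max_weighted_sum \<Theta> X (N \<omega>) \<omega>} \<in> events" .
  qed (use C_sets S_sets in auto)
  also have "\<dots> = (\<Sum>m=1..n. prob (C m \<inter> S m))"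
    using C_sets S_sets
    by (intro finite_measure_finite_Union) (auto simp: disjoint_family_on_def C_def)
  also have "\<dots> = (\<Sum>m=1..n. prob (C m) * prob (S m))"
    using indep_setD[OF indep' C_gen S_gen] by (intro sum.cong) auto
  finally show ?thesis by (simp add: C_def S_def)
qed

lemma expectation_bounded_nat:
  fixes N :: "'a \<Rightarrow> nat"
  assumes N: "N \<in> measurable M (count_space UNIV)"
    and bound: "prob {\<omega> \<in> space M. N \<omega> > n} = 0"
  shows "expectation (\<lambda>\<omega>. real (N \<omega>)) = (\<Sum>m=1..n. prob {\<omega> \<in> space M. N \<omega> = m} * m)"
proof -
  note [measurable] = N
  have sets: "{\<omega> \<in> space M. N \<omega> = m} \<in> events" for m by measurable
  have "expectation (\<lambda>\<omega>. real (N \<omega>)) =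
      expectation (\<lambda>\<omega>. \<Sum>m=1..n. real m * indicator {\<omega> \<in> space M. N \<omega> = m} \<omega>)"
  proof (rule integral_cong_AE)
    have "AE \<omega> in M. \<not> N \<omega> > n" using bound by (subst (asm) prob_eq_0) auto
    then show "AE \<omega> in M. real (N \<omega>) = (\<Sum>m=1..n. real m * indicator {\<omega> \<in> space M. N \<omega> = m} \<omega>)"
      using AE_space
    proof eventually_elim
      case (elim \<omega>)
      have "(\<Sum>m=1..n. real m * indicator {\<omega> \<in> space M. N \<omega> = m} \<omega>) =
          (\<Sum>m=1..n. if m = N \<omega> then real m else 0)"
        using elim by (intro sum.cong) auto
      also have "\<dots> = real (N \<omega>)" using elim by auto
      finally show ?case by simp
    qed
  qed measurable
  also have "\<dots> = (\<Sum>m=1..n. m * prob {\<omega> \<in> space M. N \<omega> = m})"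
    using sets
    by (subst Bochner_Integration.integral_sum)
       (auto intro!: integrable_mult_right integrable_real_indicator simp: emeasure_eq_measure)
  finally show ?thesis by (simp add: mult.commute)
qed

end

section \<open>Ruin probability\<close>

text \<open>Asymptotically equivalent tails share the behaviour under a change of argument, at the price of
  an arbitrarily small increase of the constant.\<close>

lemma eventually_tail_transfer:
  fixes T J :: "real \<Rightarrow> real"
  assumes lim: "((\<lambda>x. T x / J x) \<longlongrightarrow> 1) at_top" and J_pos: "\<And>x. J x > 0"
    and \<phi>: "filterlim \<phi> at_top at_top" and le: "\<forall>\<^sub>F x in at_top. J (\<phi> x) \<le> c * J x"
    and c: "0 < c" "c < c'"
  shows "\<forall>\<^sub>F x in at_top. T (\<phi> x) \<le> c' * T x"
proof -
  define d where "d = c' / c"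
  have d: "d > 1" using c by (simp add: d_def)
  define r where "r = sqrt d"
  have r: "r > 1" "r * r = d" using d by (auto simp: r_def)
  have upper: "\<forall>\<^sub>F x in at_top. T (\<phi> x) / J (\<phi> x) < r"
    using eventually_compose_filterlim[OF order_tendstoD(2)[OF lim r(1)] \<phi>] .
  have "1 / r < 1" using r by simp
  from order_tendstoD(1)[OF lim this] upper le show ?thesis
  proof eventually_elim
    case (elim x)
    have "T (\<phi> x) \<le> r * J (\<phi> x)" using elim(2) J_pos[of "\<phi> x"] by (simp add: pos_divide_less_eq)
    also have "\<dots> \<le> r * (c * J x)" using elim(3) r by (intro mult_left_mono) auto
    also have "J x \<le> r * T x"
      using elim(1) J_pos[of x] r(1) by (simp add: pos_less_divide_eq pos_divide_less_eq mult.commute)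
    then have "r * (c * J x) \<le> r * (c * (r * T x))" using r c by (intro mult_left_mono) auto
    also have "\<dots> = c' * T x" using c r(2) by (simp add: d_def mult_ac)
    finally show ?case .
  qed
qed

lemma (in prob_space) ruin_prob_tail:
  fixes N :: "'a \<Rightarrow> nat" and X \<Theta> :: "nat \<Rightarrow> 'a \<Rightarrow> real" and T :: "real \<Rightarrow> real"
  assumes X: "\<And>i. i \<ge> 1 \<Longrightarrow> X i \<in> borel_measurable M"
    and \<Theta>: "\<And>i. i \<ge> 1 \<Longrightarrow> \<Theta> i \<in> borel_measurable M"
    and N: "N \<in> measurable M (count_space UNIV)"
    and bound: "prob {\<omega> \<in> space M. N \<omega> > n} = 0"
    and indep: "indep_of_sequences M N X \<Theta>"
    and T: "\<And>i x. i \<ge> 1 \<Longrightarrow> prob {\<omega> \<in> space M. \<Theta> i \<omega> * X i \<omega> > x} = T x"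
    and T_pos: "\<forall>\<^sub>F x in at_top. T x > 0"
    and jump: "\<And>m \<epsilon>. m \<in> {1..n} \<Longrightarrow> \<epsilon> > 0 \<Longrightarrow> \<exists>l. \<forall>\<^sub>F x in at_top. 0 \<le> l x \<and>
      T (x - l x) \<le> (1 + \<epsilon>) * T x \<and> (1 - \<epsilon>) * T x \<le> T (x + l x) \<and>
      (\<forall>i\<in>{1..m}. \<forall>j\<in>{1..m}. i \<noteq> j \<longrightarrow>
        prob {\<omega> \<in> space M. \<bar>\<Theta> i \<omega> * X i \<omega>\<bar> > l x / m \<and> \<Theta> j \<omega> * X j \<omega> > x / m} \<le> \<epsilon> * T x)"
  shows "((\<lambda>x. ruin_prob M \<Theta> X N x / T x) \<longlongrightarrow> expectation (\<lambda>\<omega>. real (N \<omega>))) at_top"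
proof -
  define P where "P m x = prob {\<omega> \<in> space M. Max ((\<lambda>k. \<Sum>i=1..k. \<Theta> i \<omega> * X i \<omega>) ` {1..m}) > x}" for m x
  have P: "((\<lambda>x. P m x / T x) \<longlongrightarrow> real m) at_top" if "m \<in> {1..n}" for m
    unfolding P_def using that X \<Theta> T T_pos jump[OF that]
    by (intro max_partial_sum_tail) auto
  have "((\<lambda>x. \<Sum>m=1..n. prob {\<omega> \<in> space M. N \<omega> = m} * (P m x / T x))
      \<longlongrightarrow> (\<Sum>m=1..n. prob {\<omega> \<in> space M. N \<omega> = m} * m)) at_top"
    using P by (intro tendsto_sum tendsto_mult tendsto_const)
  moreover have "\<forall>\<^sub>F x in at_top. (\<Sum>m=1..n. prob {\<omega> \<in> space M. N \<omega> = m} * (P m x / T x)) =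
      ruin_prob M \<Theta> X N x / T x"
    using eventually_ge_at_top[of 0]
  proof eventually_elim
    case (elim x)
    show ?case
      using ruin_prob_eq_sum[OF X \<Theta> N bound indep elim]
      by (simp only: P_def sum_divide_distrib times_divide_eq_right)
  qed
  ultimately show ?thesis
    unfolding expectation_bounded_nat[OF N bound] by (rule Lim_transform_eventually)
qed

lemma (in prob_space) tail_distr:
  fixes Y :: "'a \<Rightarrow> real"
  assumes "Y \<in> borel_measurable M"
  shows "tail (distr M borel Y) x = prob {\<omega> \<in> space M. Y \<omega> > x}"
proof -
  note [measurable] = assms
  have "measure (distr M borel Y) {..x} = prob {\<omega> \<in> space M. Y \<omega> \<le> x}"
    by (subst measure_distr) (auto simp: vimage_def Int_def conj_commute)
  moreover have "prob {\<omega> \<in> space M. \<not> Y \<omega> \<le> x} = 1 - prob {\<omega> \<in> space M. Y \<omega> \<le> x}"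
    by (intro prob_neg) measurable
  ultimately show ?thesis by (simp add: tail_def cdf_def not_le)
qed

lemma (in prob_space) tail_tendsto_0:
  fixes Y :: "'a \<Rightarrow> real"
  assumes "Y \<in> borel_measurable M"
  shows "((\<lambda>x. prob {\<omega> \<in> space M. Y \<omega> > x}) \<longlongrightarrow> 0) at_top"
proof -
  interpret D: real_distribution "distr M borel Y"
    by (rule real_distribution_distr) (rule assms)
  have "((\<lambda>x. 1 - cdf (distr M borel Y) x) \<longlongrightarrow> 1 - 1) at_top"
    by (intro tendsto_diff tendsto_const D.cdf_lim_at_top_prob)
  then show ?thesis by (simp add: tail_distr[OF assms, symmetric] tail_def)
qed

lemma (in prob_space) prob_eq_of_distr_eq:
  fixes Y Z :: "'a \<Rightarrow> real"
  assumes "Y \<in> borel_measurable M" "Z \<in> borel_measurable M" "distr M borel Y = distr M borel Z"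
    and "A \<in> sets borel"
  shows "prob {\<omega> \<in> space M. Y \<omega> \<in> A} = prob {\<omega> \<in> space M. Z \<omega> \<in> A}"
proof -
  have "measure (distr M borel Y) A = prob {\<omega> \<in> space M. Y \<omega> \<in> A}"
    "measure (distr M borel Z) A = prob {\<omega> \<in> space M. Z \<omega> \<in> A}"
    using assms(1,2,4) by (subst measure_distr; simp add: vimage_def Int_def conj_commute)+
  then show ?thesis using assms(3) by simp
qed

lemma (in prob_space) AE_of_distr_eq:
  fixes Y Z :: "'a \<Rightarrow> real"
  assumes "Y \<in> borel_measurable M" "Z \<in> borel_measurable M" "distr M borel Y = distr M borel Z"
    and A: "A \<in> sets borel" and AE: "AE \<omega> in M. Y \<omega> \<in> A"
  shows "AE \<omega> in M. Z \<omega> \<in> A"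
proof -
  have "{\<theta> \<in> space borel. \<theta> \<in> A} \<in> sets borel" using A by simp
  note iff = AE_distr_iff[OF assms(1) this] AE_distr_iff[OF assms(2) this]
  show ?thesis using AE unfolding iff[symmetric] assms(3) .
qed

text \<open>The little-o condition forces bounded weights: with the first level fixed, the right-hand side
  vanishes as the second level grows, while the left-hand side does not depend on it.\<close>

lemma (in prob_space) bounded_of_smallo:
  fixes Y Z W :: "'a \<Rightarrow> real"
  assumes Z: "Z \<in> borel_measurable M" and Y: "Y \<in> borel_measurable M" and W: "W \<in> borel_measurable M"
    and o: "(\<lambda>(x, y). prob {\<omega> \<in> space M. W \<omega> > b x})
      \<in> o[min_at_top](\<lambda>(x, y). prob {\<omega> \<in> space M. Y \<omega> > x \<and> Z \<omega> > y})"
  shows "\<exists>C. AE \<omega> in M. W \<omega> \<le> C"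
proof -
  note [measurable] = Y Z W
  have "\<forall>\<^sub>F p in min_at_top. norm ((\<lambda>(x, y). prob {\<omega> \<in> space M. W \<omega> > b x}) p)
      \<le> 1 * norm ((\<lambda>(x, y). prob {\<omega> \<in> space M. Y \<omega> > x \<and> Z \<omega> > y}) p)"
    using landau_o.smallD[OF o, of 1] by simp
  then obtain K where "\<forall>x\<ge>K. \<forall>y\<ge>K.
      prob {\<omega> \<in> space M. W \<omega> > b x} \<le> prob {\<omega> \<in> space M. Y \<omega> > x \<and> Z \<omega> > y}"
    by (auto simp: eventually_min_at_top)
  then have K: "\<And>x y. x \<ge> K \<Longrightarrow> y \<ge> K \<Longrightarrow>
      prob {\<omega> \<in> space M. W \<omega> > b x} \<le> prob {\<omega> \<in> space M. Y \<omega> > x \<and> Z \<omega> > y}"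
    by blast
  have "\<forall>\<^sub>F y in at_top. prob {\<omega> \<in> space M. W \<omega> > b K} \<le> prob {\<omega> \<in> space M. Z \<omega> > y}"
    using eventually_ge_at_top[of K]
  proof eventually_elim
    case (elim y)
    have "prob {\<omega> \<in> space M. Y \<omega> > K \<and> Z \<omega> > y} \<le> prob {\<omega> \<in> space M. Z \<omega> > y}"
      by (intro finite_measure_mono) auto
    then show ?case using K[of K y] elim by simp
  qed
  then have "prob {\<omega> \<in> space M. W \<omega> > b K} \<le> 0"
    by (intro tendsto_lowerbound[OF tail_tendsto_0[OF Z]]) auto
  then have "prob {\<omega> \<in> space M. W \<omega> > b K} = 0" by (simp add: measure_le_0_iff)
  then have "AE \<omega> in M. \<not> W \<omega> > b K" by (subst (asm) prob_eq_0) auto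
  then show ?thesis by (intro exI[of _ "b K"]) (auto simp: not_less)
qed

lemma consistently_varyingD:
  assumes "consistently_varying F" and "\<epsilon> > 0" and pos: "\<And>x. tail F x > 0"
  shows "\<exists>v. 0 < v \<and> v < 1 \<and> (\<forall>\<^sub>F x in at_top. tail F (v * x) \<le> (1 + \<epsilon>) * tail F x)"
proof -
  let ?L = "\<lambda>v. Limsup at_top (\<lambda>x. ereal (tail F (v * x) / tail F x))"
  have "\<forall>\<^sub>F v in at_left 1. ?L v < ereal (1 + \<epsilon>)"
    using assms(1,2) unfolding consistently_varying_def by (intro order_tendstoD(2)) auto
  moreover have "\<forall>\<^sub>F v in at_left 1. v \<in> {0<..<1::real}"
    by (intro eventually_at_left_real) simp
  ultimately have "\<forall>\<^sub>F v in at_left 1. ?L v < ereal (1 + \<epsilon>) \<and> v \<in> {0<..<1}"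
    by eventually_elim simp
  then obtain v where v: "?L v < ereal (1 + \<epsilon>)" "0 < v" "v < 1"
    using eventually_happens'[of "at_left (1::real)"] by auto
  from Limsup_lessD[OF v(1)] have "\<forall>\<^sub>F x in at_top. tail F (v * x) \<le> (1 + \<epsilon>) * tail F x"
  proof eventually_elim
    case (elim x)
    then show ?case using pos[of x] by (simp add: pos_divide_less_eq)
  qed
  with v show ?thesis by blast
qed

lemma consistently_varying_of_regularly_varying:
  assumes "regularly_varying \<alpha> F"
  shows "consistently_varying F"
proof -
  have L: "Limsup at_top (\<lambda>x. ereal (tail F (v * x) / tail F x)) = ereal (v powr (- \<alpha>))" if "v > 0" for v
    using assms that unfolding regularly_varying_def
    by (intro lim_imp_Limsup) auto
  have "((\<lambda>v. ereal (v powr (- \<alpha>))) \<longlongrightarrow> ereal (1 powr (- \<alpha>))) (at_left 1)"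
    by (intro tendsto_intros) auto
  moreover have "\<forall>\<^sub>F v in at_left 1. v \<in> {0<..<1::real}"
    by (intro eventually_at_left_real) simp
  then have "\<forall>\<^sub>F v in at_left 1. ereal (v powr (- \<alpha>)) =
      Limsup at_top (\<lambda>x. ereal (tail F (v * x) / tail F x))"
    by eventually_elim (simp add: L)
  ultimately show ?thesis
    unfolding consistently_varying_def by (auto intro: Lim_transform_eventually simp: one_ereal_def)
qed

lemma dominatedly_varyingD:
  assumes "dominatedly_varying F" and "0 < v" "v < 1" and pos: "\<And>x. tail F x > 0"
  shows "\<exists>C. \<forall>\<^sub>F x in at_top. tail F (v * x) \<le> C * tail F x"
proof -
  have "Limsup at_top (\<lambda>x. ereal (tail F (v * x) / tail F x)) < \<infinity>"
    using assms unfolding dominatedly_varying_def by blast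
  then have "Limsup at_top (\<lambda>x. ereal (tail F (v * x) / tail F x)) \<noteq> \<infinity>" by (rule less_imp_neq)
  then obtain C :: nat where "Limsup at_top (\<lambda>x. ereal (tail F (v * x) / tail F x)) < ereal C"
    using less_PInf_Ex_of_nat[THEN iffD1] by metis
  from Limsup_lessD[OF this] have "\<forall>\<^sub>F x in at_top. tail F (v * x) \<le> real C * tail F x"
  proof eventually_elim
    case (elim x)
    then show ?case using pos[of x] by (simp add: pos_divide_less_eq)
  qed
  then show ?thesis by blast
qed

theorem corollary5p2:
  fixes M :: "'a measure"
    and F :: "real measure"
    and X0 \<Theta>0 :: "'a \<Rightarrow> real"
    and X \<Theta> :: "nat \<Rightarrow> 'a \<Rightarrow> real"
    and N :: "'a \<Rightarrow> nat"
    and n :: nat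
    and b h :: "real \<Rightarrow> real"
    and g :: "real \<times> real \<Rightarrow> real"
    and L U :: real
  assumes "prob_space M"
    and "X0 \<in> borel_measurable M" and "\<And>i. i \<ge> 1 \<Longrightarrow> X i \<in> borel_measurable M"
    and "distr M borel X0 = F" and "\<And>i. i \<ge> 1 \<Longrightarrow> distr M borel (X i) = F"
    and "\<And>x. x \<ge> 0 \<Longrightarrow> tail F x > 0"
    and "dominatedly_varying F" and "long_tailed F"
    and "\<Theta>0 \<in> borel_measurable M" and "\<And>i. i \<ge> 1 \<Longrightarrow> \<Theta> i \<in> borel_measurable M"
    and "\<And>i. i \<ge> 1 \<Longrightarrow> distr M borel (\<Theta> i) = distr M borel \<Theta>0"
    and "AE \<omega> in M. \<Theta>0 \<omega> \<ge> 0" and "\<And>i. i \<ge> 1 \<Longrightarrow> AE \<omega> in M. \<Theta> i \<omega> \<ge> 0"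
    and "\<not> (AE \<omega> in M. \<Theta>0 \<omega> = 0)"
    and "\<And>i. i \<ge> 1 \<Longrightarrow>
      distr M borel (\<lambda>\<omega>. \<Theta> i \<omega> * X i \<omega>) = distr M borel (\<lambda>\<omega>. \<Theta>0 \<omega> * X0 \<omega>)"
    and "N \<in> measurable M (count_space UNIV)"
    and "\<not> (AE \<omega> in M. N \<omega> = 0)"
    and "n \<ge> 2" and "\<P>(\<omega> in M. N \<omega> > n) = 0"
    and "indep_of_sequences M N X \<Theta>"
    \<comment> \<open>(i)\<close>
    and "\<And>x. x \<ge> 0 \<Longrightarrow> b x > 0"
    and "filterlim b at_top at_top" and "((\<lambda>x. b x / x) \<longlongrightarrow> 0) at_top"
    and "\<And>i j. \<lbrakk>i \<in> {1..n}; j \<in> {1..n}; i \<noteq> j\<rbrakk> \<Longrightarrow>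
      (\<lambda>(xi, xj). \<P>(\<omega> in M. \<Theta> i \<omega> > b xi))
        \<in> o[min_at_top](\<lambda>(xi, xj). \<P>(\<omega> in M. \<Theta> i \<omega> * X i \<omega> > xi \<and> \<Theta> j \<omega> * X j \<omega> > xj))"
    \<comment> \<open>(ii)\<close>
    and "\<And>\<theta>. \<theta> \<ge> 0 \<Longrightarrow> h \<theta> > 0"
    and "\<And>i. i \<in> {1..n} \<Longrightarrow>
      \<forall>\<^sub>F x in at_top. \<forall>\<theta>\<in>rv_support M \<Theta>0. has_cond_prob1 M (\<lambda>\<omega>. X i \<omega> > x) (\<Theta> i) \<theta>"
    and "\<And>i. i \<in> {1..n} \<Longrightarrow>
      uniformly_equiv (rv_support M \<Theta>0) at_top
        (\<lambda>x \<theta>. cond_prob1 M (\<lambda>\<omega>. X i \<omega> > x) (\<Theta> i) \<theta>)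
        (\<lambda>x \<theta>. h \<theta> * \<P>(\<omega> in M. X i \<omega> > x))"
    \<comment> \<open>(iii)\<close>
    and "g \<in> borel_measurable (restrict_space borel ({0..} \<times> {0..}))"
    and "\<And>s t. \<lbrakk>s \<ge> 0; t \<ge> 0\<rbrakk> \<Longrightarrow> g (s, t) > 0"
    and "0 < L" and "L \<le> U"
    and "\<And>i j. \<lbrakk>i \<in> {1..n}; j \<in> {1..n}; i \<noteq> j\<rbrakk> \<Longrightarrow>
      \<forall>\<^sub>F (xi, xj) in min_at_top. \<forall>\<theta>\<in>rv_support M \<Theta>0 \<times> rv_support M \<Theta>0.
        has_cond_prob2 M (\<lambda>\<omega>. \<bar>X i \<omega>\<bar> > xi \<and> X j \<omega> > xj) (\<Theta> i) (\<Theta> j) \<theta> \<and>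
        has_cond_prob2 M (\<lambda>\<omega>. X i \<omega> > xi \<and> X j \<omega> > xj) (\<Theta> i) (\<Theta> j) \<theta>"
    and "\<And>i j. \<lbrakk>i \<in> {1..n}; j \<in> {1..n}; i \<noteq> j\<rbrakk> \<Longrightarrow>
      uniformly_equiv (rv_support M \<Theta>0 \<times> rv_support M \<Theta>0) min_at_top
        (\<lambda>(xi, xj) \<theta>. cond_prob2 M (\<lambda>\<omega>. \<bar>X i \<omega>\<bar> > xi \<and> X j \<omega> > xj) (\<Theta> i) (\<Theta> j) \<theta>)
        (\<lambda>(xi, xj) \<theta>. g \<theta> * \<P>(\<omega> in M. \<bar>X i \<omega>\<bar> > xi \<and> X j \<omega> > xj))"
    and "\<And>i j. \<lbrakk>i \<in> {1..n}; j \<in> {1..n}; i \<noteq> j\<rbrakk> \<Longrightarrow>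
      uniformly_lesssim (rv_support M \<Theta>0 \<times> rv_support M \<Theta>0) min_at_top
        (\<lambda>(xi, xj) \<theta>. L * g \<theta> * \<P>(\<omega> in M. X i \<omega> > xi \<and> X j \<omega> > xj))
        (\<lambda>(xi, xj) \<theta>. cond_prob2 M (\<lambda>\<omega>. X i \<omega> > xi \<and> X j \<omega> > xj) (\<Theta> i) (\<Theta> j) \<theta>)"
    and "\<And>i j. \<lbrakk>i \<in> {1..n}; j \<in> {1..n}; i \<noteq> j\<rbrakk> \<Longrightarrow>
      uniformly_lesssim (rv_support M \<Theta>0 \<times> rv_support M \<Theta>0) min_at_top
        (\<lambda>(xi, xj) \<theta>. cond_prob2 M (\<lambda>\<omega>. X i \<omega> > xi \<and> X j \<omega> > xj) (\<Theta> i) (\<Theta> j) \<theta>)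
        (\<lambda>(xi, xj) \<theta>. U * g \<theta> * \<P>(\<omega> in M. X i \<omega> > xi \<and> X j \<omega> > xj))"
  shows "(pTAI M n X \<or> (pQAI M n X \<and> consistently_varying F) \<longrightarrow>
      ruin_prob M \<Theta> X N \<sim>[at_top]
        (\<lambda>x. (\<integral>\<omega>. real (N \<omega>) \<partial>M) * \<P>(\<omega> in M. \<Theta>0 \<omega> * X0 \<omega> > x)))
    \<and> (\<forall>\<alpha>>0. regularly_varying \<alpha> F \<and>
      (\<exists>p>\<alpha>. integrable M (\<lambda>\<omega>. \<Theta>0 \<omega> powr p * h (\<Theta>0 \<omega>))) \<and>
      (pTAI M n X \<or> pQAI M n X) \<longrightarrow>
      ruin_prob M \<Theta> X N \<sim>[at_top]
        (\<lambda>x. (\<integral>\<omega>. real (N \<omega>) \<partial>M) * (\<integral>\<omega>. \<Theta>0 \<omega> powr \<alpha> * h (\<Theta>0 \<omega>) \<partial>M) * tail F x))"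
proof -
  interpret prob_space M by fact
  note X = assms(3) and \<Theta> = assms(10) and N = assms(16)
  note [measurable] = assms(2) assms(9) N
  have X_tail: "prob {\<omega> \<in> space M. X i \<omega> > x} = tail F x" if "i \<ge> 1" for i x
    using tail_distr[OF X[OF that]] assms(5)[OF that] by simp
  have tail_anti: "antimono (tail F)"
  proof (rule antimonoI)
    fix x y :: real assume "x \<le> y"
    have [measurable]: "X 1 \<in> borel_measurable M" by (rule X) simp
    show "tail F y \<le> tail F x"
      unfolding X_tail[OF order_refl, symmetric]
    proof (rule finite_measure_mono)
      show "{\<omega> \<in> space M. X 1 \<omega> > x} \<in> events" by measurable
    qed (use \<open>x \<le> y\<close> in auto)
  qed
  have tail_pos: "tail F x > 0" for x
  proof -
    have "0 < tail F (max x 0)" by (rule assms(6)) simp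
    also have "\<dots> \<le> tail F x" using tail_anti by (simp add: antimono_def)
    finally show ?thesis .
  qed
  define T where "T x = prob {\<omega> \<in> space M. \<Theta>0 \<omega> * X0 \<omega> > x}" for x
  have T: "prob {\<omega> \<in> space M. \<Theta> i \<omega> * X i \<omega> > x} = T x" if i: "i \<ge> 1" for i x
  proof -
    note [measurable] = X[OF i] \<Theta>[OF i]
    have "prob {\<omega> \<in> space M. \<Theta> i \<omega> * X i \<omega> \<in> {x<..}} = prob {\<omega> \<in> space M. \<Theta>0 \<omega> * X0 \<omega> \<in> {x<..}}"
      by (rule prob_eq_of_distr_eq[OF _ _ assms(15)[OF i]]) measurable
    then show ?thesis by (simp add: T_def)
  qed
  have T_anti: "antimono T"
    unfolding T_def by (intro antimonoI finite_measure_mono) auto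
  have [measurable]: "X 1 \<in> borel_measurable M" "X 2 \<in> borel_measurable M"
    "\<Theta> 1 \<in> borel_measurable M" "\<Theta> 2 \<in> borel_measurable M"
    by (auto intro: X \<Theta>)
  have "\<exists>C. AE \<omega> in M. \<Theta> 1 \<omega> \<le> C"
  proof (rule bounded_of_smallo)
    show "(\<lambda>(x, y). prob {\<omega> \<in> space M. \<Theta> 1 \<omega> > b x}) \<in>
        o[min_at_top](\<lambda>(x, y). prob {\<omega> \<in> space M. \<Theta> 1 \<omega> * X 1 \<omega> > x \<and> \<Theta> 2 \<omega> * X 2 \<omega> > y})"
      using assms(18) by (intro assms(24)) auto
  qed measurable
  then obtain C where C: "AE \<omega> in M. \<Theta> 1 \<omega> \<le> C" by blast
  \<comment> \<open>B has to be positive for the division by B below\<close>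
  define B where "B = max C 1"
  have "B > 0" by (simp add: B_def)
  have \<Theta>0_B: "AE \<omega> in M. 0 \<le> \<Theta>0 \<omega> \<and> \<Theta>0 \<omega> \<le> B"
  proof -
    have "AE \<omega> in M. \<Theta> 1 \<omega> \<in> {..B}" using C by eventually_elim (auto simp: B_def)
    then have "AE \<omega> in M. \<Theta>0 \<omega> \<in> {..B}"
      by (rule AE_of_distr_eq[OF \<Theta>[OF order_refl] assms(9) assms(11)[OF order_refl] atMost_borel])
    with assms(12) show ?thesis by eventually_elim auto
  qed
  have \<Theta>_B: "AE \<omega> in M. 0 \<le> \<Theta> i \<omega> \<and> \<Theta> i \<omega> \<le> B" if i: "i \<ge> 1" for i
  proof -
    have "AE \<omega> in M. \<Theta>0 \<omega> \<in> {0..B}" using \<Theta>0_B by eventually_elim auto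
    then have "AE \<omega> in M. \<Theta> i \<omega> \<in> {0..B}"
      by (rule AE_of_distr_eq[OF assms(9) \<Theta>[OF i] assms(11)[OF i, symmetric], rotated]) simp
    then show ?thesis by eventually_elim auto
  qed
  have supp: "rv_support M (\<Theta> 1) = rv_support M \<Theta>0"
  proof -
    have "prob {\<omega> \<in> space M. \<Theta> 1 \<omega> \<in> {\<theta> - \<delta>..\<theta> + \<delta>}} = prob {\<omega> \<in> space M. \<Theta>0 \<omega> \<in> {\<theta> - \<delta>..\<theta> + \<delta>}}" for \<theta> \<delta>
      by (rule prob_eq_of_distr_eq[OF \<Theta>[OF order_refl] assms(9) assms(11)[OF order_refl]]) simp
    then show ?thesis by (simp only: rv_support_def)
  qed
  have n1: "1 \<in> {1..n}" using assms(18) by simp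
  have X1_pos: "prob {\<omega> \<in> space M. X 1 \<omega> > x} > 0" for x
    using tail_pos by (simp add: X_tail)
  note cond = X[OF order_refl] \<Theta>[OF order_refl] assms(25) X1_pos
    assms(26)[OF n1, folded supp] assms(27)[OF n1, folded supp]
  define \<kappa> where "\<kappa> = tilted (\<Theta> 1) h B"
  have tilted_eq: "\<kappa> = tilted \<Theta>0 h B" and tilt_eq: "tilt (\<Theta> 1) h B = tilt \<Theta>0 h B"
    using assms(11)[of 1] supp by (simp_all add: \<kappa>_def tilted_def tilt_def[abs_def])
  have tilt_meas: "tilt (\<Theta> 1) h B \<in> borel_measurable borel"
    by (rule tilt_measurable[OF cond])
  have bounds: "\<exists>K. \<forall>x\<ge>K. \<forall>A\<in>sets borel. A \<subseteq> {0<..B} \<longrightarrow>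
      emeasure M {\<omega> \<in> space M. X 1 \<omega> > x \<and> \<Theta> 1 \<omega> \<in> A}
        \<le> ennreal c * (ennreal (prob {\<omega> \<in> space M. X 1 \<omega> > x}) * emeasure \<kappa> A) \<and>
      ennreal (prob {\<omega> \<in> space M. X 1 \<omega> > x}) * emeasure \<kappa> A
        \<le> ennreal c * emeasure M {\<omega> \<in> space M. X 1 \<omega> > x \<and> \<Theta> 1 \<omega> \<in> A}"
    if "c > 1" for c
    unfolding \<kappa>_def using that by (intro tilted_bounds[OF cond])
  have one_less_2: "(1::real) < 2" by simp
  have X1: "(\<lambda>x. prob {\<omega> \<in> space M. X 1 \<omega> > x}) = tail F" by (rule ext) (simp add: X_tail)
  have \<Theta>1_nz: "\<not> (AE \<omega> in M. \<Theta> 1 \<omega> = 0)"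
  proof
    assume "AE \<omega> in M. \<Theta> 1 \<omega> = 0"
    then have "AE \<omega> in M. \<Theta> 1 \<omega> \<in> {0}" by simp
    then have "AE \<omega> in M. \<Theta>0 \<omega> \<in> {0}"
      by (rule AE_of_distr_eq[OF \<Theta>[OF order_refl] assms(9) assms(11)[OF order_refl], rotated]) simp
    with assms(14) show False by simp
  qed
  have wt: "weighted_tail \<kappa> (\<lambda>x. prob {\<omega> \<in> space M. X 1 \<omega> > x}) B"
    unfolding \<kappa>_def
  proof (rule weighted_tail_tilted)
    show "\<exists>c K. \<forall>x\<ge>K. \<forall>A\<in>sets borel. A \<subseteq> {0<..B} \<longrightarrow>
      ennreal (prob {\<omega> \<in> space M. X 1 \<omega> > x}) * emeasure (tilted (\<Theta> 1) h B) A
        \<le> ennreal c * emeasure M {\<omega> \<in> space M. X 1 \<omega> > x \<and> \<Theta> 1 \<omega> \<in> A}"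
      using bounds[of 2, OF one_less_2] unfolding \<kappa>_def
      by blast
  qed (fact cond tilt_meas \<open>B > 0\<close> \<Theta>_B[OF order_refl] \<Theta>1_nz assms(25))+
  interpret W: weighted_tail \<kappa> "tail F" B using wt[unfolded X1] .
  have TJ: "((\<lambda>x. T x / W.J x) \<longlongrightarrow> 1) at_top"
    using product_tail_equiv[OF cond(1,2) wt \<Theta>_B[OF order_refl] bounds] unfolding T[OF order_refl] X1 .
  have T_J: "\<forall>\<^sub>F x in at_top. W.J x \<le> 2 * T x"
    using order_tendstoD(1)[OF TJ, of "1 / 2", simplified]
  proof eventually_elim
    case (elim x)
    then show ?case using W.J_pos[of x] by (simp add: pos_less_divide_eq)
  qed
  have T_pos: "\<forall>\<^sub>F x in at_top. T x > 0"
    using T_J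
  proof eventually_elim
    case (elim x)
    then show ?case using W.J_pos[of x] by linarith
  qed
  have dom: "\<exists>C>0. \<forall>\<^sub>F x in at_top. tail F (s * x) \<le> C * T x" if "s > 0" for s
  proof -
    obtain C where C: "C > 0" "\<forall>\<^sub>F x in at_top. tail F (s * x) \<le> C * W.J x"
      using W.J_dominates[OF dominatedly_varyingD[OF assms(7) _ _ tail_pos] \<open>s > 0\<close>] by blast
    from C(2) T_J have "\<forall>\<^sub>F x in at_top. tail F (s * x) \<le> (2 * C) * T x"
    proof eventually_elim
      case (elim x)
      have "C * W.J x \<le> C * (2 * T x)" using elim C(1) by (intro mult_left_mono) auto
      then show ?case using elim by simp
    qed
    then show ?thesis using C(1) by (intro exI[of _ "2 * C"]) auto
  qed
  have long: "\<forall>\<^sub>F x in at_top. T (x - a) \<le> (1 + \<epsilon>) * T x" if "a > 0" "\<epsilon> > 0" for a \<epsilon>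
  proof (rule eventually_tail_transfer[OF TJ W.J_pos])
    show "filterlim (\<lambda>x. x - a) at_top at_top"
      using filterlim_tendsto_add_at_top[OF tendsto_const[of "- a"] filterlim_ident[of at_top]] by simp
    show "\<forall>\<^sub>F x in at_top. W.J (x - a) \<le> (1 + \<epsilon> / 2) * W.J x"
      using assms(8) that unfolding long_tailed_def by (intro W.J_long_tailed) auto
  qed (use that in auto)
  have cons: "\<exists>v. 0 < v \<and> v < 1 \<and> (\<forall>\<^sub>F x in at_top. T (v * x) \<le> (1 + \<epsilon>) * T x)"
    if cv: "consistently_varying F" and \<epsilon>: "\<epsilon> > 0" for \<epsilon>
  proof -
    obtain v where v: "0 < v" "v < 1" "\<forall>\<^sub>F x in at_top. tail F (v * x) \<le> (1 + \<epsilon> / 2) * tail F x"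
      using consistently_varyingD[OF cv _ tail_pos, of "\<epsilon> / 2"] \<epsilon> by auto
    have "\<forall>\<^sub>F x in at_top. T (v * x) \<le> (1 + \<epsilon>) * T x"
    proof (rule eventually_tail_transfer[OF TJ W.J_pos])
      show "filterlim (\<lambda>x. v * x) at_top at_top"
        using v by (intro filterlim_tendsto_pos_mult_at_top[OF tendsto_const] filterlim_ident) auto
      show "\<forall>\<^sub>F x in at_top. W.J (v * x) \<le> (1 + \<epsilon> / 2) * W.J x" by (rule W.J_scale[OF v(3)])
    qed (use that in auto)
    with v show ?thesis by blast
  qed
  define EN where "EN = expectation (\<lambda>\<omega>. real (N \<omega>))"
  \<comment> \<open>asymptotic equivalence needs a factor that does not vanish\<close>
  have "EN > 0"
  proof -
    have EN: "EN = (\<Sum>m=1..n. prob {\<omega> \<in> space M. N \<omega> = m} * m)"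
      unfolding EN_def by (rule expectation_bounded_nat[OF N assms(19)])
    have "EN \<noteq> 0"
    proof
      assume "EN = 0"
      then have "\<forall>m\<in>{1..n}. prob {\<omega> \<in> space M. N \<omega> = m} = 0"
        unfolding EN by (subst (asm) sum_nonneg_eq_0_iff) auto
      then have "\<forall>m\<in>{1..n}. AE \<omega> in M. N \<omega> \<noteq> m" by (subst (asm) prob_eq_0) auto
      then have "AE \<omega> in M. \<forall>m\<in>{1..n}. N \<omega> \<noteq> m" by (subst AE_ball_countable) auto
      moreover have "AE \<omega> in M. \<not> N \<omega> > n" using assms(19) by (subst (asm) prob_eq_0) auto
      ultimately have "AE \<omega> in M. N \<omega> = 0"
      proof eventually_elim
        case (elim \<omega>)
        then show ?case by (cases "N \<omega> = 0") (auto simp: not_less)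
      qed
      with assms(17) show False by blast
    qed
    moreover have "EN \<ge> 0" unfolding EN by (intro sum_nonneg) auto
    ultimately show ?thesis by simp
  qed
  have ruin: "((\<lambda>x. ruin_prob M \<Theta> X N x / T x) \<longlongrightarrow> EN) at_top"
    if ind: "pTAI M n X \<or> (pQAI M n X \<and> consistently_varying F)"
    unfolding EN_def
  proof (rule ruin_prob_tail)
    fix m :: nat and \<epsilon> :: real assume m: "m \<in> {1..n}" and "\<epsilon> > 0"
    have ge_1: "X i \<in> borel_measurable M" "\<Theta> i \<in> borel_measurable M"
      "prob {\<omega> \<in> space M. X i \<omega> > x} = tail F x"
      "prob {\<omega> \<in> space M. \<Theta> i \<omega> * X i \<omega> > x} = T x"
      "AE \<omega> in M. 0 \<le> \<Theta> i \<omega> \<and> \<Theta> i \<omega> \<le> B" if "i \<in> {1..n}" for i x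
      using that X \<Theta> X_tail T \<Theta>_B by auto
    show "\<exists>l. \<forall>\<^sub>F x in at_top. 0 \<le> l x \<and>
      T (x - l x) \<le> (1 + \<epsilon>) * T x \<and> (1 - \<epsilon>) * T x \<le> T (x + l x) \<and>
      (\<forall>i\<in>{1..m}. \<forall>j\<in>{1..m}. i \<noteq> j \<longrightarrow>
        prob {\<omega> \<in> space M. \<bar>\<Theta> i \<omega> * X i \<omega>\<bar> > l x / m \<and> \<Theta> j \<omega> * X j \<omega> > x / m} \<le> \<epsilon> * T x)"
      using ind
    proof
      assume "pTAI M n X"
      show ?thesis
        by (rule jump_pTAI[where G = "tail F" and B = B and n = n])
           (fact ge_1 tail_pos \<open>B > 0\<close> dom long \<open>pTAI M n X\<close> m \<open>\<epsilon> > 0\<close>)+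
    next
      assume *: "pQAI M n X \<and> consistently_varying F"
      have cons': "\<exists>v. 0 < v \<and> v < 1 \<and> (\<forall>\<^sub>F x in at_top. T (v * x) \<le> (1 + \<epsilon>) * T x)"
        if "\<epsilon> > 0" for \<epsilon>
        using cons * that by blast
      show ?thesis
        by (rule jump_pQAI[where G = "tail F" and B = B and n = n])
           (fact ge_1 tail_pos \<open>B > 0\<close> dom cons' T_anti *[THEN conjunct1] m \<open>\<epsilon> > 0\<close>)+
    qed
  qed (fact X \<Theta> N assms(19) assms(20) T T_pos)+
  have part1: "ruin_prob M \<Theta> X N \<sim>[at_top] (\<lambda>x. EN * T x)"
    if "pTAI M n X \<or> (pQAI M n X \<and> consistently_varying F)"
  proof (rule asymp_equivI')
    from tendsto_divide[OF ruin[OF that] tendsto_const[of EN]] \<open>EN > 0\<close>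
    show "((\<lambda>x. ruin_prob M \<Theta> X N x / (EN * T x)) \<longlongrightarrow> 1) at_top"
      by (simp add: mult.commute)
  qed
  have part2: "ruin_prob M \<Theta> X N \<sim>[at_top]
      (\<lambda>x. EN * expectation (\<lambda>\<omega>. \<Theta>0 \<omega> powr \<alpha> * h (\<Theta>0 \<omega>)) * tail F x)"
    if "\<alpha> > 0" and rv: "regularly_varying \<alpha> F" and "p > \<alpha>"
      and int: "integrable M (\<lambda>\<omega>. \<Theta>0 \<omega> powr p * h (\<Theta>0 \<omega>))"
      and ind: "pTAI M n X \<or> pQAI M n X" for \<alpha> p
  proof (rule asymp_equivI')
    define I where "I = expectation (\<lambda>\<omega>. \<Theta>0 \<omega> powr \<alpha> * h (\<Theta>0 \<omega>))"
    \<comment> \<open>h is not assumed measurable; the integrability of the p-th moment provides what is needed\<close>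
    have "(\<lambda>\<omega>. \<Theta>0 \<omega> powr (\<alpha> - p) * (\<Theta>0 \<omega> powr p * h (\<Theta>0 \<omega>))) \<in> borel_measurable M"
      using borel_measurable_integrable[OF int] by measurable
    then have "(\<lambda>\<omega>. \<Theta>0 \<omega> powr \<alpha> * h (\<Theta>0 \<omega>)) \<in> borel_measurable M"
      by (simp flip: mult.assoc powr_add)
    then have I: "(\<integral>\<theta>. indicator {0<..B} \<theta> * \<theta> powr \<alpha> \<partial>\<kappa>) = I"
      unfolding I_def tilted_eq using tilt_meas tilt_eq
      by (intro integral_tilted assms(9) assms(25) \<Theta>0_B) auto
    have "I > 0" unfolding I[symmetric] by (rule W.power_moment_pos[OF \<open>\<alpha> > 0\<close>])
    have JF: "((\<lambda>x. W.J x / tail F x) \<longlongrightarrow> I) at_top"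
      unfolding I[symmetric] using rv unfolding regularly_varying_def
      by (intro W.J_regularly_varying) auto
    have "pTAI M n X \<or> (pQAI M n X \<and> consistently_varying F)"
      using ind consistently_varying_of_regularly_varying[OF rv] by blast
    from tendsto_divide[OF tendsto_mult[OF ruin[OF this] tendsto_mult[OF TJ JF]]
        tendsto_const[of "EN * I"]] \<open>EN > 0\<close> \<open>I > 0\<close>
    have "((\<lambda>x. ruin_prob M \<Theta> X N x / T x * (T x / W.J x * (W.J x / tail F x)) / (EN * I)) \<longlongrightarrow> 1) at_top"
      by simp
    moreover have "\<forall>\<^sub>F x in at_top.
        ruin_prob M \<Theta> X N x / T x * (T x / W.J x * (W.J x / tail F x)) / (EN * I) =
        ruin_prob M \<Theta> X N x / (EN * I * tail F x)"
      using T_pos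
    proof eventually_elim
      case (elim x)
      then show ?case using W.J_pos[of x] by simp
    qed
    ultimately show "((\<lambda>x. ruin_prob M \<Theta> X N x /
        (EN * expectation (\<lambda>\<omega>. \<Theta>0 \<omega> powr \<alpha> * h (\<Theta>0 \<omega>)) * tail F x)) \<longlongrightarrow> 1) at_top"
      unfolding I_def[symmetric] by (rule Lim_transform_eventually)
  qed
  show ?thesis
    using part1 part2 unfolding EN_def T_def by blast
qed

end
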